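(* Let $n\in\mathbb N$ and let $H$ be a real or complex Hilbert space with $\dim H\geq n$. Suppose $\phi:P_n(H)\to P_n(H)$ is a map (not assumed surjective or injective) such that $\angle(\phi(P),\phi(Q))=\angle(P,Q)$ for all $P,Q\in P_n(H)$. If $n=1$ or $n\neq \dim H/2$, then there exists a linear or conjugate-linear isometry $V$ on $H$ such that $\phi(P)=VPV^*$ for all $P\in P_n(H)$. Moreover, if $H$ is infinite dimensional and $\phi:P_\infty(H)\to P_\infty(H)$ is a surjective map with $\angle(\phi(P),\phi(Q))=\angle(P,Q)$ for all $P,Q\in P_\infty(H)$, then there exists a unitary or antiunitary operator $U$ on $H$ such that $\phi(P)=UPU^*$ for all $P\in P_\infty(H)$.
   Context: A projection means a self-adjoint idempotent bounded operator on $H$. $P_n(H)$ denotes the set of all rank-$n$ projections on $H$, and $P_\infty(H)$ the set of all projections of infinite rank. For projections $P,Q,P',Q'$ on $H$, "$\angle(P,Q)=\angle(P',Q')$" (equality of principal angles) means by definition that the positive operators $QPQ$ and $Q'P'Q'$ are unitarily equivalent (orthogonally equivalent in the real case); for finite rank projections this is the same as equality, with multiplicities, of the eigenvalues of $QPQ$ and $Q'P'Q'$ (whose square roots are the cosines of the principal angles). For a conjugate-linear operator $V$, $V^*$ denotes the conjugate-linear operator with $\langle Vx,y\rangle=\overline{\langle x,V^*y\rangle}$ for all $x,y$; an isometry means $\|Vx\|=\|x\|$ for all $x$. *)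

theory Defs
  imports "HOL-Analysis.Analysis"
begin

class complex_inner = real_inner +
  fixes scaleC :: "complex \<Rightarrow> 'a \<Rightarrow> 'a" (infixr "*\<^sub>C" 75)
    and cinner :: "'a \<Rightarrow> 'a \<Rightarrow> complex"
  assumes scaleC_add_right: "a *\<^sub>C (x + y) = a *\<^sub>C x + a *\<^sub>C y"
    and scaleC_add_left: "(a + b) *\<^sub>C x = a *\<^sub>C x + b *\<^sub>C x"
    and scaleC_scaleC: "a *\<^sub>C (b *\<^sub>C x) = (a * b) *\<^sub>C x"
    and scaleC_one: "1 *\<^sub>C x = x"
    and scaleC_of_real: "complex_of_real r *\<^sub>C x = r *\<^sub>R x"
    and cinner_add_left: "cinner (x + y) z = cinner x z + cinner y z"
    and cinner_scaleC_left: "cinner (a *\<^sub>C x) y = a * cinner x y"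
    and cinner_commute: "cinner x y = cnj (cinner y x)"
    and inner_cinner: "inner x y = Re (cinner x y)"

definition rproj :: "('a::real_inner \<Rightarrow> 'a) \<Rightarrow> bool" where
  "rproj P \<longleftrightarrow> bounded_linear P \<and> P \<circ> P = P \<and> (\<forall>x y. inner (P x) y = inner x (P y))"

definition rhas_dim :: "'a::real_vector set \<Rightarrow> nat \<Rightarrow> bool" where
  "rhas_dim S d \<longleftrightarrow> (\<exists>B. finite B \<and> card B = d \<and> independent B \<and> span B = S)"

definition rdim_ge :: "'a::real_vector itself \<Rightarrow> nat \<Rightarrow> bool" where
  "rdim_ge _ n \<longleftrightarrow> (\<exists>B::'a set. finite B \<and> card B = n \<and> independent B)"

definition rProj :: "nat \<Rightarrow> ('a::real_inner \<Rightarrow> 'a) set" where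
  "rProj n = {P. rproj P \<and> rhas_dim (range P) n}"

definition rProj_inf :: "('a::real_inner \<Rightarrow> 'a) set" where
  "rProj_inf = {P. rproj P \<and> \<not> (\<exists>d. rhas_dim (range P) d)}"

definition runitary :: "('a::real_normed_vector \<Rightarrow> 'a) \<Rightarrow> bool" where
  "runitary U \<longleftrightarrow> linear U \<and> surj U \<and> (\<forall>x. norm (U x) = norm x)"

text \<open>Equality of principal angles: Q P Q and Q' P' Q' are orthogonally equivalent.\<close>
definition rangle_eq :: "('a::real_inner \<Rightarrow> 'a) \<Rightarrow> ('a \<Rightarrow> 'a) \<Rightarrow> ('a \<Rightarrow> 'a) \<Rightarrow> ('a \<Rightarrow> 'a) \<Rightarrow> bool" where
  "rangle_eq P Q P' Q' \<longleftrightarrow> (\<exists>U. runitary U \<and> U \<circ> (Q \<circ> P \<circ> Q) = (Q' \<circ> P' \<circ> Q') \<circ> U)"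

definition radjoint :: "('a::real_inner \<Rightarrow> 'a) \<Rightarrow> ('a \<Rightarrow> 'a) \<Rightarrow> bool" where
  "radjoint V W \<longleftrightarrow> (\<forall>x y. inner (V x) y = inner x (W y))"

definition clinear :: "('a::complex_inner \<Rightarrow> 'a) \<Rightarrow> bool" where
  "clinear f \<longleftrightarrow> (\<forall>x y. f (x + y) = f x + f y) \<and> (\<forall>a x. f (a *\<^sub>C x) = a *\<^sub>C f x)"

definition cantilinear :: "('a::complex_inner \<Rightarrow> 'a) \<Rightarrow> bool" where
  "cantilinear f \<longleftrightarrow> (\<forall>x y. f (x + y) = f x + f y) \<and> (\<forall>a x. f (a *\<^sub>C x) = cnj a *\<^sub>C f x)"

definition bounded_op :: "('a::real_normed_vector \<Rightarrow> 'a) \<Rightarrow> bool" where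
  "bounded_op f \<longleftrightarrow> (\<exists>K. \<forall>x. norm (f x) \<le> norm x * K)"

definition cproj :: "('a::complex_inner \<Rightarrow> 'a) \<Rightarrow> bool" where
  "cproj P \<longleftrightarrow> clinear P \<and> bounded_op P \<and> P \<circ> P = P \<and> (\<forall>x y. cinner (P x) y = cinner x (P y))"

definition chas_dim :: "'a::complex_inner set \<Rightarrow> nat \<Rightarrow> bool" where
  "chas_dim S d \<longleftrightarrow> (\<exists>B. finite B \<and> card B = d \<and> \<not> module.dependent scaleC B
      \<and> module.span scaleC B = S)"

definition cdim_ge :: "'a::complex_inner itself \<Rightarrow> nat \<Rightarrow> bool" where
  "cdim_ge _ n \<longleftrightarrow> (\<exists>B::'a set. finite B \<and> card B = n \<and> \<not> module.dependent scaleC B)"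

definition cProj :: "nat \<Rightarrow> ('a::complex_inner \<Rightarrow> 'a) set" where
  "cProj n = {P. cproj P \<and> chas_dim (range P) n}"

definition cProj_inf :: "('a::complex_inner \<Rightarrow> 'a) set" where
  "cProj_inf = {P. cproj P \<and> \<not> (\<exists>d. chas_dim (range P) d)}"

definition cunitary :: "('a::complex_inner \<Rightarrow> 'a) \<Rightarrow> bool" where
  "cunitary U \<longleftrightarrow> clinear U \<and> surj U \<and> (\<forall>x. norm (U x) = norm x)"

definition cantiunitary :: "('a::complex_inner \<Rightarrow> 'a) \<Rightarrow> bool" where
  "cantiunitary U \<longleftrightarrow> cantilinear U \<and> surj U \<and> (\<forall>x. norm (U x) = norm x)"

text \<open>Equality of principal angles: Q P Q and Q' P' Q' are unitarily equivalent.\<close>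
definition cangle_eq :: "('a::complex_inner \<Rightarrow> 'a) \<Rightarrow> ('a \<Rightarrow> 'a) \<Rightarrow> ('a \<Rightarrow> 'a) \<Rightarrow> ('a \<Rightarrow> 'a) \<Rightarrow> bool" where
  "cangle_eq P Q P' Q' \<longleftrightarrow> (\<exists>U. cunitary U \<and> U \<circ> (Q \<circ> P \<circ> Q) = (Q' \<circ> P' \<circ> Q') \<circ> U)"

definition cadjoint :: "('a::complex_inner \<Rightarrow> 'a) \<Rightarrow> ('a \<Rightarrow> 'a) \<Rightarrow> bool" where
  "cadjoint V W \<longleftrightarrow> (\<forall>x y. cinner (V x) y = cinner x (W y))"

definition cantiadjoint :: "('a::complex_inner \<Rightarrow> 'a) \<Rightarrow> ('a \<Rightarrow> 'a) \<Rightarrow> bool" where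
  "cantiadjoint V W \<longleftrightarrow> (\<forall>x y. cinner (V x) y = cnj (cinner x (W y)))"

end

theory Submission
  imports Defs
begin

text \<open>
  Equality of principal angles preserves the Hilbert--Schmidt inner products of projections of finite
  rank and their commutativity. Hence \<open>\<phi>\<close> extends to a linear isometry \<open>\<Phi>\<close> of the span of the projections
  of rank \<open>n\<close>, which contains the rank-one projections when \<open>n < dim H\<close>. The \<open>n\<close>-element subsets of an
  orthonormal \<open>(n+1)\<close>-set are mapped to commuting, pairwise adjacent projections, that is, to a clique of
  a Johnson graph. If this clique is a top, then \<open>\<Phi>\<close> maps the rank-one projections of the set to rank-one
  projections; if it is a star, then \<open>\<Phi> p = R / n - p'\<close> for a projection \<open>R\<close> of rank \<open>2 n\<close>, and counting
  orthogonal \<open>p'\<close> below \<open>R\<close> forces \<open>dim H = 2 n\<close>. Wigner's theorem finishes the proof.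

  For infinite rank, \<open>\<phi>\<close> is an automorphism of the ordered set of projections of infinite rank and
  corank. A covering pair of this order differs by a rank-one projection, so \<open>\<phi>\<close> induces a map of rank-one
  projections; it preserves transition probabilities because these are eigenvalues of the compressions.
  The projections of finite corank are recovered from the projections that commute with them.
\<close>

section \<open>The Hilbert--Schmidt inner product\<close>

text \<open>The exception \<open>dim H = 2 n\<close> is genuine: for \<open>n \<ge> 2\<close> the
  passage to complements then preserves principal angles and maps a sum of \<open>n\<close>
  orthogonal rank-one projections \<open>p\<close> to the sum of the operators
  \<open>I / n - p\<close>, an instance of the star case. For \<open>n = 1\<close> this map is
  itself implemented by an isometry, so that case survives. In finite rank \<open>\<phi>\<close>
  need not be surjective; the information comes from traces, and the linear extension turns it into
  statements on rank-one projections.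

  All traces are taken over the reals, on the underlying real Hilbert space, also in the complex
  case. The inner product of operators is then real-valued, and both scalar fields share one
  argument.

  Projections of infinite rank have no trace; this is where surjectivity comes in. The relation
  \<open>Q P Q = 0\<close> takes over, and \<open>P \<le> Q\<close> is tested by the projections
  orthogonal to Q. The decisive one is the complement of Q, which has infinite rank only if Q has
  infinite corank.\<close>

definition onset :: "'a::real_inner set \<Rightarrow> bool" where
  "onset B \<longleftrightarrow> finite B \<and> (\<forall>a\<in>B. \<forall>b\<in>B. inner a b = (if a = b then 1 else 0))"

lemma onset_exists:
  assumes "finite (F::'a::real_inner set)"
  obtains B where "onset B" "span B = span F"
proof -
  obtain C where C: "finite C" "span C = span F" "pairwise orthogonal C"
    using basis_orthogonal[OF assms] by blast
  let ?D = "C - {0}"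
  let ?B = "(\<lambda>x. x /\<^sub>R norm x) ` ?D"
  have "onset ?B"
    unfolding onset_def
  proof (intro conjI ballI)
    show "finite ?B" using C by auto
    fix a b assume "a \<in> ?B" "b \<in> ?B"
    then obtain x y where xy: "x \<in> ?D" "y \<in> ?D" "a = x /\<^sub>R norm x" "b = y /\<^sub>R norm y" by auto
    show "inner a b = (if a = b then 1 else 0)"
    proof (cases "x = y")
      case True
      then show ?thesis using xy by (simp add: dot_square_norm power2_eq_square)
    next
      case False
      then have o: "inner x y = 0" using C(3) xy by (auto simp: pairwise_def orthogonal_def)
      then have "inner a b = 0" using xy by simp
      moreover have "a \<noteq> b"
      proof
        assume "a = b"
        then have "inner a a = 0" using \<open>inner a b = 0\<close> by simp
        then show False using xy by auto
      qed
      ultimately show ?thesis by simp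
    qed
  qed
  moreover have "span ?B = span F"
  proof -
    have "span ?B = span ?D"
    proof (rule antisym)
      show "span ?B \<subseteq> span ?D"
        by (rule span_minimal) (auto intro: span_mul span_base)
      show "span ?D \<subseteq> span ?B"
      proof (rule span_minimal)
        show "?D \<subseteq> span ?B"
        proof
          fix x assume x: "x \<in> ?D"
          then have "x = norm x *\<^sub>R (x /\<^sub>R norm x)" by simp
          moreover have "x /\<^sub>R norm x \<in> span ?B" using x by (auto intro: span_base)
          ultimately show "x \<in> span ?B" by (metis span_mul)
        qed
      qed simp
    qed
    also have "\<dots> = span C" by (rule span_delete_0)
    finally show ?thesis using C by simp
  qed
  ultimately show ?thesis by (rule that)
qed

lemma onset_expand:
  assumes B: "onset B" and x: "x \<in> span B"
  shows "x = (\<Sum>b\<in>B. inner x b *\<^sub>R b)"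
proof -
  have fB: "finite B" and o: "\<And>a b. a \<in> B \<Longrightarrow> b \<in> B \<Longrightarrow> inner a b = (if a = b then 1 else 0)"
    using B by (auto simp: onset_def)
  show ?thesis
    using x
  proof (induction rule: span_induct_alt)
    case base
    then show ?case by simp
  next
    case (step c a y)
    have "(\<Sum>b\<in>B. inner (c *\<^sub>R a + y) b *\<^sub>R b)
        = c *\<^sub>R (\<Sum>b\<in>B. inner a b *\<^sub>R b) + (\<Sum>b\<in>B. inner y b *\<^sub>R b)"
      by (simp add: inner_add_left scaleR_add_left sum.distrib scaleR_sum_right)
    also have "(\<Sum>b\<in>B. inner a b *\<^sub>R b) = (\<Sum>b\<in>B. if a = b then b else 0)"
      using o step.hyps by (intro sum.cong) auto
    also have "\<dots> = a" using fB step.hyps by simp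
    finally show ?case using step by simp
  qed
qed

lemma onset_parseval:
  assumes "onset B" "x \<in> span B"
  shows "inner x y = (\<Sum>b\<in>B. inner x b * inner b y)"
proof -
  have "inner x y = inner (\<Sum>b\<in>B. inner x b *\<^sub>R b) y"
    using onset_expand[OF assms] by simp
  then show ?thesis by (simp add: inner_sum_left)
qed

definition selfadj :: "('a::real_inner \<Rightarrow> 'a) \<Rightarrow> bool" where
  "selfadj T \<longleftrightarrow> linear T \<and> (\<forall>x y. inner (T x) y = inner x (T y))"

definition finrank :: "('a::real_inner \<Rightarrow> 'a) \<Rightarrow> bool" where
  "finrank T \<longleftrightarrow> (\<exists>F. finite F \<and> range T \<subseteq> span F)"

definition hs_basis :: "('a::real_inner \<Rightarrow> 'a) \<Rightarrow> 'a set" where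
  "hs_basis T = (SOME B. onset B \<and> range T \<subseteq> span B)"

text \<open>The trace of \<open>S T\<close> over the reals. The basis only has to cover the range of
  T, since a self-adjoint T vanishes on the orthogonal complement of its range. Hence S may be
  \<open>id\<close>, and \<open>hs T id\<close> is the trace of T.\<close>

definition hs :: "('a::real_inner \<Rightarrow> 'a) \<Rightarrow> ('a \<Rightarrow> 'a) \<Rightarrow> real" where
  "hs T S = (\<Sum>b\<in>hs_basis T. inner (T b) (S b))"

lemma hs_basis:
  assumes "finrank T"
  shows "onset (hs_basis T) \<and> range T \<subseteq> span (hs_basis T)"
proof -
  obtain F where "finite F" "range T \<subseteq> span F" using assms by (auto simp: finrank_def)
  moreover obtain B where "onset B" "span B = span F" using onset_exists[OF \<open>finite F\<close>] .
  ultimately have "\<exists>B. onset B \<and> range T \<subseteq> span B" by auto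
  then show ?thesis unfolding hs_basis_def by (rule someI_ex)
qed

text \<open>Expanding in both orthonormal sets gives a double sum, and self-adjointness of the two
  operators moves them to the other summation index. So the basis chosen in \<open>hs\<close> is
  immaterial.\<close>

lemma hs_eq:
  assumes T: "selfadj T" and S: "selfadj S" and B: "onset B" "range T \<subseteq> span B"
  shows "hs T S = (\<Sum>b\<in>B. inner (T b) (S b))"
proof -
  let ?C = "hs_basis T"
  have "finrank T" using B by (auto simp: finrank_def onset_def)
  then have C: "onset ?C" "range T \<subseteq> span ?C" using hs_basis by auto
  have sT: "inner (T x) y = inner x (T y)" for x y using T by (simp add: selfadj_def)
  have sS: "inner (S x) y = inner x (S y)" for x y using S by (simp add: selfadj_def)
  have "hs T S = (\<Sum>c\<in>?C. \<Sum>b\<in>B. inner (T c) b * inner b (S c))"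
    unfolding hs_def using B onset_parseval[OF B(1)] by (intro sum.cong refl) (auto simp: image_subset_iff)
  also have "\<dots> = (\<Sum>b\<in>B. \<Sum>c\<in>?C. inner (T b) c * inner c (S b))"
    by (subst sum.swap, intro sum.cong refl) (metis sT sS inner_commute)
  also have "\<dots> = (\<Sum>b\<in>B. inner (T b) (S b))"
    using C onset_parseval[OF C(1)] by (intro sum.cong refl) (auto simp: image_subset_iff)
  finally show ?thesis .
qed

lemma finrank_common:
  assumes "finrank T" "finrank S"
  obtains B where "onset B" "range T \<subseteq> span B" "range S \<subseteq> span B"
proof -
  obtain F G where FG: "finite F" "range T \<subseteq> span F" "finite G" "range S \<subseteq> span G"
    using assms by (auto simp: finrank_def)
  obtain B where "onset B" "span B = span (F \<union> G)"
    using onset_exists[of "F \<union> G"] FG by auto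
  moreover have "span F \<subseteq> span (F \<union> G)" "span G \<subseteq> span (F \<union> G)" by (intro span_mono; blast)+
  ultimately show ?thesis using that FG by blast
qed

lemma hs_commute:
  assumes "selfadj T" "selfadj S" "finrank T" "finrank S"
  shows "hs T S = hs S T"
proof -
  obtain B where B: "onset B" "range T \<subseteq> span B" "range S \<subseteq> span B"
    using finrank_common assms by blast
  show ?thesis using B assms by (simp add: hs_eq inner_commute)
qed

text \<open>This is \<open>tr (P Q) = tr (Q P Q)\<close>, computed in an orthonormal basis of the
  range of Q. It brings in the operator whose unitary class is what principal angles retain.\<close>

lemma hs_compress:
  assumes P: "selfadj P" "finrank P" and Q: "selfadj Q" "finrank Q" and Q2: "Q \<circ> Q = Q"
  shows "hs P Q = hs (Q \<circ> P \<circ> Q) id"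
proof -
  obtain B where B: "onset B" "range P \<subseteq> span B" "range Q \<subseteq> span B"
    using finrank_common P Q by blast
  have lin: "linear P" "linear Q" using P Q by (auto simp: selfadj_def)
  have s: "inner (P x) y = inner x (P y)" "inner (Q x) y = inner x (Q y)" for x y
    using P Q by (auto simp: selfadj_def)
  have "linear (Q \<circ> P \<circ> Q)" by (intro linear_compose lin)
  then have R: "selfadj (Q \<circ> P \<circ> Q)"
    unfolding selfadj_def using s by auto
  have I: "selfadj id" unfolding selfadj_def by (simp add: linear_id)
  have QQ: "Q (Q x) = Q x" for x using Q2 by (metis comp_apply)
  obtain D where D: "onset D" "span D = range Q"
  proof -
    have "range Q = Q ` span B"
    proof
      show "range Q \<subseteq> Q ` span B"
      proof
        fix y assume "y \<in> range Q"
        then show "y \<in> Q ` span B" using B(3) QQ by (metis imageE image_eqI subsetD)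
      qed
    qed auto
    also have "\<dots> = span (Q ` B)" using lin by (simp add: linear_span_image)
    finally have "range Q = span (Q ` B)" .
    moreover have "finite (Q ` B)" using B by (simp add: onset_def)
    ultimately show ?thesis using onset_exists[of "Q ` B"] that by metis
  qed
  have QD: "Q d = d" if "d \<in> D" for d
  proof -
    have "d \<in> range Q" using that D(2) span_base[of d D] by simp
    then show ?thesis using QQ by auto
  qed
  have "hs P Q = hs Q P" using P Q by (intro hs_commute)
  also have "\<dots> = (\<Sum>d\<in>D. inner (Q d) (P d))" using D P Q by (intro hs_eq) auto
  also have "\<dots> = (\<Sum>d\<in>D. inner ((Q \<circ> P \<circ> Q) d) (id d))"
    by (intro sum.cong refl) (simp, metis QD s(2) inner_commute)
  also have "\<dots> = hs (Q \<circ> P \<circ> Q) id"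
    using hs_eq[OF R I D(1)] D(2) by (simp add: image_subset_iff)
  finally show ?thesis .
qed

lemma isometry_inner:
  fixes U :: "'a::real_inner \<Rightarrow> 'b::real_inner"
  assumes "linear U" "\<And>x. norm (U x) = norm x"
  shows "inner (U x) (U y) = inner x y"
proof -
  have "inner (U x) (U y) = ((norm (U (x + y)))\<^sup>2 - (norm (U x))\<^sup>2 - (norm (U y))\<^sup>2) / 2"
    using assms(1) by (simp add: linear_add dot_norm)
  also have "\<dots> = inner x y" using assms(2) by (simp add: dot_norm)
  finally show ?thesis .
qed

text \<open>U carries an orthonormal basis for T to one for \<open>T'\<close> and preserves inner
  products, so the two traces agree term by term.\<close>

lemma hs_unitary:
  assumes U: "linear U" "\<And>x. norm (U x) = norm x" and T: "selfadj T" "finrank T"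
    and T': "selfadj T'" and eq: "U \<circ> T = T' \<circ> U" and surj: "surj U"
  shows "hs T id = hs T' id"
proof -
  let ?B = "hs_basis T"
  have B: "onset ?B" "range T \<subseteq> span ?B" using hs_basis T by auto
  have iU: "inner (U x) (U y) = inner x y" for x y by (rule isometry_inner[OF U])
  have inj: "inj U"
    by (metis U linear_injective_0 norm_eq_zero)
  have TU: "T' (U x) = U (T x)" for x using eq by (metis comp_apply)
  have "onset (U ` ?B)" using B(1) inj by (auto simp: onset_def iU inj_eq)
  moreover have "range T' \<subseteq> span (U ` ?B)"
  proof
    fix y assume "y \<in> range T'"
    then obtain x where "y = U (T x)" using surj TU by (metis imageE surjD)
    then show "y \<in> span (U ` ?B)" using B(2) U(1) by (auto simp: linear_span_image)
  qed
  ultimately have "hs T' id = (\<Sum>b\<in>U ` ?B. inner (T' b) (id b))"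
    using T' by (intro hs_eq) (auto simp: selfadj_def linear_id)
  also have "\<dots> = (\<Sum>b\<in>?B. inner (T' (U b)) (id (U b)))"
    using inj by (subst sum.reindex) (auto intro: inj_on_subset)
  also have "\<dots> = hs T id"
    by (simp add: TU iU hs_def)
  finally show ?thesis by simp
qed

text \<open>A type of its own, so that \<open>span\<close>, \<open>linear\<close> and
  \<open>inner\<close> apply to operators. Only real combinations of self-adjoint operators stay
  self-adjoint, so this is a real inner product space also over complex scalars.\<close>

typedef (overloaded) ('a::real_inner) fsop = "{T::'a \<Rightarrow> 'a. selfadj T \<and> finrank T}"
  morphisms opr Fsop
proof
  show "(\<lambda>_. 0) \<in> {T::'a \<Rightarrow> 'a. selfadj T \<and> finrank T}"
    by (auto simp: selfadj_def finrank_def linear_iff intro: exI[of _ "{}"])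
qed

lemma opr_selfadj [simp]: "selfadj (opr T)" and opr_finrank [simp]: "finrank (opr T)"
  using opr[of T] by auto

lemma finrank_lincomb:
  assumes "finrank T" "finrank S"
  shows "finrank (\<lambda>x. a *\<^sub>R T x + b *\<^sub>R S x)"
proof -
  obtain B where "onset B" "range T \<subseteq> span B" "range S \<subseteq> span B"
    using finrank_common assms by blast
  then show ?thesis unfolding finrank_def
    by (intro exI[of _ B]) (auto simp: onset_def intro!: span_add span_mul)
qed

lemma selfadj_lincomb:
  assumes "selfadj T" "selfadj S"
  shows "selfadj (\<lambda>x. a *\<^sub>R T x + b *\<^sub>R S x)"
  using assms unfolding selfadj_def
  by (auto simp: linear_iff algebra_simps inner_add_left inner_add_right)

instantiation fsop :: (real_inner) real_inner
begin

definition "zero_fsop = Fsop (\<lambda>_. 0::'a)"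
definition "plus_fsop S T = Fsop (\<lambda>x::'a. opr S x + opr T x)"
definition "minus_fsop S T = Fsop (\<lambda>x::'a. opr S x - opr T x)"
definition "uminus_fsop T = Fsop (\<lambda>x::'a. - opr T x)"
definition "scaleR_fsop a T = Fsop (\<lambda>x::'a. a *\<^sub>R opr T x)"
definition "inner_fsop S T = hs (opr S) (opr T :: 'a \<Rightarrow> 'a)"
definition "norm_fsop (T::'a fsop) = sqrt (inner T T)"
definition "sgn_fsop (T::'a fsop) = inverse (norm T) *\<^sub>R T"
definition "dist_fsop (S::'a fsop) T = norm (S - T)"
definition [code del]: "uniformity_fsop = (INF e\<in>{0 <..}. principal {(x::'a fsop, y). dist x y < e})"
definition [code del]: "open_fsop (U::'a fsop set) = (\<forall>x\<in>U. eventually (\<lambda>(x', y). x' = x \<longrightarrow> y \<in> U) uniformity)"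

lemma opr_zero: "opr 0 = (\<lambda>_. 0::'a)"
  unfolding zero_fsop_def
  by (rule Fsop_inverse) (auto simp: selfadj_def finrank_def linear_iff intro: exI[of _ "{}"])

lemma opr_plus: "opr (S + T) = (\<lambda>x. opr S x + opr (T::'a fsop) x)"
  using selfadj_lincomb[of "opr S" "opr T" 1 1] finrank_lincomb[of "opr S" "opr T" 1 1]
  unfolding plus_fsop_def by (intro Fsop_inverse) auto

lemma opr_minus: "opr (S - T) = (\<lambda>x. opr S x - opr (T::'a fsop) x)"
  using selfadj_lincomb[of "opr S" "opr T" 1 "-1"] finrank_lincomb[of "opr S" "opr T" 1 "-1"]
  unfolding minus_fsop_def by (intro Fsop_inverse) auto

lemma opr_uminus: "opr (- T) = (\<lambda>x. - opr (T::'a fsop) x)"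
  using selfadj_lincomb[of "opr T" "opr T" 0 "-1"] finrank_lincomb[of "opr T" "opr T" 0 "-1"]
  unfolding uminus_fsop_def by (intro Fsop_inverse) auto

lemma opr_scaleR: "opr (a *\<^sub>R T) = (\<lambda>x. a *\<^sub>R opr (T::'a fsop) x)"
  using selfadj_lincomb[of "opr T" "opr T" 0 a] finrank_lincomb[of "opr T" "opr T" 0 a]
  unfolding scaleR_fsop_def by (intro Fsop_inverse) auto

lemma fsop_eqI: "(\<And>x. opr S x = opr T x) \<Longrightarrow> S = (T::'a fsop)"
  by (metis opr_inject ext)

instance
proof
  fix S T R :: "'a fsop" and a b :: real
  note oprs = opr_zero opr_plus opr_minus opr_uminus opr_scaleR
  show "S + T + R = S + (T + R)" "S + T = T + S" "0 + S = S" "- S + S = 0" "S - T = S + - T"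
    "a *\<^sub>R (S + T) = a *\<^sub>R S + a *\<^sub>R T" "(a + b) *\<^sub>R S = a *\<^sub>R S + b *\<^sub>R S"
    "a *\<^sub>R b *\<^sub>R S = (a * b) *\<^sub>R S" "1 *\<^sub>R S = S"
    by (rule fsop_eqI, simp add: oprs algebra_simps)+
  show "dist S T = norm (S - T)" "sgn S = inverse (norm S) *\<^sub>R S" "norm S = sqrt (inner S S)"
    by (simp_all add: dist_fsop_def sgn_fsop_def norm_fsop_def)
  show "uniformity = (INF e\<in>{0<..}. principal {(x::'a fsop, y). dist x y < e})"
    by (rule uniformity_fsop_def)
  show "open U = (\<forall>x\<in>U. eventually (\<lambda>(x', y). x' = x \<longrightarrow> y \<in> U) uniformity)" for U :: "'a fsop set"
    by (rule open_fsop_def)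
  show "inner S T = inner T S" unfolding inner_fsop_def by (rule hs_commute) auto
  obtain F where F: "finite F" "range (opr S) \<union> range (opr T) \<union> range (opr R) \<subseteq> span F"
  proof -
    obtain F1 F2 F3 where "finite F1" "range (opr S) \<subseteq> span F1" "finite F2" "range (opr T) \<subseteq> span F2"
      "finite F3" "range (opr R) \<subseteq> span F3"
      using opr_finrank[of S] opr_finrank[of T] opr_finrank[of R] unfolding finrank_def by blast
    moreover have "span F1 \<subseteq> span (F1 \<union> F2 \<union> F3)" "span F2 \<subseteq> span (F1 \<union> F2 \<union> F3)" "span F3 \<subseteq> span (F1 \<union> F2 \<union> F3)"
      by (intro span_mono; blast)+
    ultimately show ?thesis using that[of "F1 \<union> F2 \<union> F3"] by blast
  qed
  obtain B where B: "onset B" "span B = span F" using onset_exists[OF F(1)] .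
  have i: "inner X Y = (\<Sum>b\<in>B. inner (opr X b) (opr Y b))" if "range (opr X) \<subseteq> span F" for X Y :: "'a fsop"
    unfolding inner_fsop_def using that B by (intro hs_eq) auto
  have rp: "range (opr (S + T)) \<subseteq> span F" using F by (auto simp: oprs intro!: span_add)
  show "inner (S + T) R = inner S R + inner T R"
    using F rp by (simp add: i) (simp add: oprs inner_add_left sum.distrib)
  have rs: "range (opr (a *\<^sub>R S)) \<subseteq> span F" using F by (auto simp: oprs intro!: span_mul)
  show "inner (a *\<^sub>R S) T = a * inner S T"
    using F rs by (simp add: i) (simp add: oprs sum_distrib_left)
  have iSS: "inner S S = (\<Sum>b\<in>B. inner (opr S b) (opr S b))" using F by (intro i) auto
  show "0 \<le> inner S S" unfolding iSS by (intro sum_nonneg) auto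
  show "(inner S S = 0) = (S = 0)"
  proof
    assume "inner S S = 0"
    then have z: "opr S b = 0" if "b \<in> B" for b
      using that B(1) unfolding iSS onset_def by (subst (asm) sum_nonneg_eq_0_iff) auto
    show "S = 0"
    proof (rule fsop_eqI)
      fix x
      \<comment> \<open>\<open>opr S x\<close> lies in \<open>span B\<close>, and its coefficients
        there are \<open>inner x (opr S b)\<close>, which vanish by \<open>z\<close>.\<close>
      have "inner (opr S x) (opr S x) = (\<Sum>b\<in>B. inner (opr S x) b * inner b (opr S x))"
        using onset_parseval[OF B(1), of "opr S x"] F B by blast
      also have "\<dots> = 0"
      proof (rule sum.neutral, rule ballI)
        fix b assume "b \<in> B"
        then have "inner (opr S x) b = inner x (opr S b)" using opr_selfadj[of S] unfolding selfadj_def by blast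
        then show "inner (opr S x) b * inner b (opr S x) = 0" using z[OF \<open>b \<in> B\<close>] by simp
      qed
      finally show "opr S x = opr 0 x" by (simp add: opr_zero)
    qed
  next
    assume "S = 0"
    then have "opr S b = 0" for b by (simp add: opr_zero)
    then show "inner S S = 0" unfolding iSS by simp
  qed
qed

end

lemma opr_sum: "opr (sum f A) x = (\<Sum>a\<in>A. opr (f a) x)"
  by (induction A rule: infinite_finite_induct) (auto simp: opr_zero opr_plus)

text \<open>Equal Gram matrices force compatibility with every linear relation in X: extend from a
  basis B of \<open>span X\<close> inside X, and \<open>\<Phi> x - \<phi> x\<close> has norm zero
  for the remaining x. The extension is controlled on \<open>span X\<close> only, so later arguments
  first have to place their operators there.\<close>

lemma inner_preserving_extension:
  fixes \<phi> :: "'v::real_inner \<Rightarrow> 'w::real_inner"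
  assumes \<phi>: "\<And>x y. x \<in> X \<Longrightarrow> y \<in> X \<Longrightarrow> inner (\<phi> x) (\<phi> y) = inner x y"
  obtains \<Phi> where "linear \<Phi>" "\<And>x. x \<in> X \<Longrightarrow> \<Phi> x = \<phi> x"
    "\<And>x y. x \<in> span X \<Longrightarrow> y \<in> span X \<Longrightarrow> inner (\<Phi> x) (\<Phi> y) = inner x y"
proof -
  obtain B where B: "B \<subseteq> X" "independent B" "X \<subseteq> span B"
    using maximal_independent_subset[of X] by blast
  obtain \<Phi> where lin: "linear \<Phi>" and ext: "\<forall>b\<in>B. \<Phi> b = \<phi> b"
    using linear_independent_extend[OF B(2), of \<phi>] by blast
  have key: "inner (\<Phi> x) (\<phi> y) = inner x y" if "x \<in> span B" "y \<in> X" for x y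
    using that(1)
  proof (induction rule: span_induct_alt)
    case base
    then show ?case using lin by (simp add: linear_0)
  next
    case (step c a z)
    then show ?case using lin ext \<phi> that B(1) by (auto simp: linear_add linear_scale inner_add_left)
  qed
  have pres: "inner (\<Phi> x) (\<Phi> y) = inner x y" if "x \<in> span B" "y \<in> span B" for x y
    using that(2)
  proof (induction rule: span_induct_alt)
    case base
    then show ?case using lin by (simp add: linear_0)
  next
    case (step c a z)
    then have "\<Phi> a = \<phi> a" "inner (\<Phi> x) (\<phi> a) = inner x a" using ext key[OF that(1)] B(1) by auto
    then show ?case using lin step by (simp add: linear_add linear_scale inner_add_right)
  qed
  have ext': "\<Phi> x = \<phi> x" if "x \<in> X" for x
  proof -
    have xs: "x \<in> span B" using that B by auto
    have "inner (\<Phi> x - \<phi> x) (\<Phi> x - \<phi> x) = 0"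
      using key[OF xs that] pres[OF xs xs] \<phi>[OF that that]
      by (simp add: inner_diff_left inner_diff_right inner_commute)
    then show ?thesis by simp
  qed
  have "span X = span B"
    by (metis B(1,3) span_eq span_mono span_superset subset_trans)
  then show ?thesis using that[OF lin ext'] pres by simp
qed

section \<open>Hilbert spaces over the reals or the complex numbers\<close>

text \<open>If a lies outside A and b outside B, then \<open>a - b\<close> lies in neither: a group
  is not the union of two proper subgroups. This turns an alternative that may depend on the vector
  or scalar into a uniform one.\<close>

lemma additive_unionE:
  fixes A B :: "'v::ab_group_add set"
  assumes "\<And>x y. x \<in> A \<Longrightarrow> y \<in> A \<Longrightarrow> x - y \<in> A" "\<And>x y. x \<in> B \<Longrightarrow> y \<in> B \<Longrightarrow> x - y \<in> B"
    and "\<And>x y. x \<in> S \<Longrightarrow> y \<in> S \<Longrightarrow> x - y \<in> S" and "S \<subseteq> A \<union> B"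
  shows "S \<subseteq> A \<or> S \<subseteq> B"
proof (rule ccontr)
  assume "\<not> ?thesis"
  then obtain a b where ab: "a \<in> S" "a \<notin> A" "b \<in> S" "b \<notin> B" by blast
  then have "a \<in> B" "b \<in> A" using assms(4) by auto
  have "a - b \<in> A \<union> B" using assms(3,4) ab by blast
  then show False
  proof
    assume "a - b \<in> A"
    \<comment> \<open>\<open>b - b - b\<close> is \<open>- b\<close>, obtained by subtraction
      alone.\<close>
    then have "(a - b) - (b - b - b) \<in> A" using \<open>b \<in> A\<close> assms(1) by blast
    then show False using ab by simp
  next
    assume "a - b \<in> B"
    then have "a - (a - b) \<in> B" using \<open>a \<in> B\<close> assms(2) by blast
    then show False using ab by simp
  qed
qed

text \<open>Covers real scalars with trivial conjugation and complex scalars with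
  \<open>cnj\<close>. The axiom \<open>re_norm_determines\<close> is the source of the linear or
  conjugate-linear alternative; \<open>scalars_finite_dim\<close> gives scalar lines finite real
  dimension, hence rank-one projections a real trace.\<close>

locale kspace =
  fixes scale :: "'k::real_normed_field \<Rightarrow> 'a::{real_inner, complete_space} \<Rightarrow> 'a" (infixr "*\<^sub>K" 75)
    and ip :: "'a \<Rightarrow> 'a \<Rightarrow> 'k" and cj :: "'k \<Rightarrow> 'k" and re :: "'k \<Rightarrow> real"
  assumes scale_add_right: "a *\<^sub>K (x + y) = a *\<^sub>K x + a *\<^sub>K y"
    and scale_add_left: "(a + b) *\<^sub>K x = a *\<^sub>K x + b *\<^sub>K x"
    and scale_scale: "a *\<^sub>K b *\<^sub>K x = (a * b) *\<^sub>K x"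
    and scale_of_real: "of_real r *\<^sub>K x = r *\<^sub>R x"
    and ip_add_left: "ip (x + y) z = ip x z + ip y z"
    and ip_scale_left: "ip (a *\<^sub>K x) y = a * ip x y"
    and ip_commute: "ip x y = cj (ip y x)"
    and inner_ip: "inner x y = re (ip x y)"
    and cj_add: "cj (a + b) = cj a + cj b"
    and cj_mult: "cj (a * b) = cj a * cj b"
    and cj_cj [simp]: "cj (cj a) = a"
    and mult_cj: "a * cj a = of_real ((norm a)\<^sup>2)"
    and cj_fixed: "cj a = a \<Longrightarrow> a = of_real (re a)"
    and re_add: "re (a + b) = re a + re b"
    and re_cj [simp]: "re (cj a) = re a"
    and re_of_real [simp]: "re (of_real r) = r"
    and re_norm_determines: "re a = re b \<Longrightarrow> norm a = norm b \<Longrightarrow> a = b \<or> a = cj b"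
    and scalars_finite_dim: "\<exists>F::'k set. finite F \<and> span F = UNIV"
begin

section \<open>Scalars, conjugation and the inner product\<close>

lemma scale_one [simp]: "1 *\<^sub>K x = x"
  using scale_of_real[of 1 x] by simp

sublocale K: vector_space scale
  by unfold_locales (simp_all add: scale_add_right scale_add_left scale_scale)

lemma scaleR_K: "r *\<^sub>R x = of_real r *\<^sub>K x"
  by (simp add: scale_of_real)

lemma cj_0 [simp]: "cj 0 = 0"
  using cj_add[of 0 0] by simp

lemma cj_of_real [simp]: "cj (of_real r) = of_real r"
proof (cases "r = 0")
  case False
  have "of_real r * cj (of_real r) = (of_real r * of_real r :: 'k)"
    by (subst mult_cj) (simp add: power2_eq_square flip: of_real_mult)
  then show ?thesis using False by simp
qed simp

lemma cj_1 [simp]: "cj 1 = 1"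
  using cj_of_real[of 1] by simp

lemma cj_minus: "cj (- a) = - cj a"
  using cj_add[of a "- a"] by (simp add: eq_neg_iff_add_eq_0 add.commute)

lemma norm_cj [simp]: "norm (cj a) = norm a"
proof (cases "a = 0")
  case False
  have "norm a * norm (cj a) = norm a * norm a"
    using arg_cong[OF mult_cj[of a], of norm] by (simp add: norm_mult power2_eq_square)
  then show ?thesis using False by simp
qed simp

lemma cj_eq_0_iff [simp]: "cj a = 0 \<longleftrightarrow> a = 0"
  by (metis norm_cj norm_eq_zero)

lemma cj_divide: "cj (a / b) = cj a / cj b"
proof (cases "b = 0")
  case False
  have "cj (a / b) * cj b = cj a" using False by (simp flip: cj_mult)
  then show ?thesis using False by (simp add: field_simps)
qed simp

lemma re_0 [simp]: "re 0 = 0" and re_1 [simp]: "re 1 = 1"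
  using re_of_real[of 0] re_of_real[of 1] by simp_all

text \<open>Recovers the real part of z from the moduli of z and \<open>1 + z\<close>; moduli are
  all that transition probabilities provide.\<close>

lemma norm_one_plus: "(norm (1 + z))\<^sup>2 = 1 + 2 * re z + (norm z)\<^sup>2"
proof -
  have z: "z + cj z = of_real (2 * re z)"
    using cj_fixed[of "z + cj z"] by (simp add: cj_add re_add add.commute)
  have "of_real ((norm (1 + z))\<^sup>2) = (1 + z) * cj (1 + z)" by (simp only: mult_cj)
  also have "\<dots> = 1 + (z + cj z) + z * cj z" by (simp add: cj_add algebra_simps)
  also have "\<dots> = of_real (1 + 2 * re z + (norm z)\<^sup>2)" by (simp add: z mult_cj)
  finally show ?thesis using of_real_eq_iff by blast
qed

lemma ip_add_right: "ip x (y + z) = ip x y + ip x z"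
  by (metis ip_commute ip_add_left cj_add)

lemma ip_scale_right: "ip x (a *\<^sub>K y) = cj a * ip x y"
  by (metis ip_commute ip_scale_left cj_mult)

lemma ip_zero_left [simp]: "ip 0 y = 0" and ip_zero_right [simp]: "ip x 0 = 0"
  using ip_scale_left[of 0 0 y] ip_scale_right[of x 0 0] by auto

lemma ip_minus_left: "ip (- x) y = - ip x y"
  using ip_scale_left[of "-1" x y] by simp

lemma ip_minus_right: "ip x (- y) = - ip x y"
  by (metis ip_commute ip_minus_left cj_minus)

lemma ip_diff_left: "ip (x - y) z = ip x z - ip y z"
  using ip_add_left[of x "- y" z] by (simp add: ip_minus_left)

lemma ip_diff_right: "ip x (y - z) = ip x y - ip x z"
  using ip_add_right[of x y "- z"] by (simp add: ip_minus_right)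

lemma ip_sum_left: "ip (sum f A) y = (\<Sum>a\<in>A. ip (f a) y)"
  by (induction A rule: infinite_finite_induct) (auto simp: ip_add_left)

lemma ip_sum_right: "ip x (sum f A) = (\<Sum>a\<in>A. ip x (f a))"
  by (induction A rule: infinite_finite_induct) (auto simp: ip_add_right)

lemmas ip_simps = ip_add_left ip_add_right ip_diff_left ip_diff_right ip_scale_left ip_scale_right

lemma ip_self: "ip x x = of_real ((norm x)\<^sup>2)"
proof -
  have "ip x x = of_real (re (ip x x))" by (rule cj_fixed) (metis ip_commute)
  then show ?thesis by (simp flip: inner_ip add: power2_norm_eq_inner)
qed

lemma ip_self_unit: "norm x = 1 \<Longrightarrow> ip x x = 1"
  by (simp add: ip_self)

lemma ip_self_eq_0 [simp]: "ip x x = 0 \<longleftrightarrow> x = 0"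
  by (simp add: ip_self)

lemma norm_ip_commute: "norm (ip x y) = norm (ip y x)"
  by (metis ip_commute norm_cj)

lemma ip_eq_0_commute: "ip x y = 0 \<longleftrightarrow> ip y x = 0"
  by (metis norm_ip_commute norm_eq_zero)

lemma norm_scale: "norm (a *\<^sub>K x) = norm a * norm x"
proof -
  have "of_real ((norm (a *\<^sub>K x))\<^sup>2) = (a * cj a) * ip x x"
    by (simp add: ip_self[symmetric] ip_simps algebra_simps del: of_real_power)
  also have "\<dots> = of_real ((norm a * norm x)\<^sup>2)"
    by (simp add: mult_cj ip_self power_mult_distrib)
  finally have "(norm (a *\<^sub>K x))\<^sup>2 = (norm a * norm x)\<^sup>2" by (simp only: of_real_eq_iff)
  then show ?thesis by (simp add: power2_eq_iff_nonneg)
qed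

lemma ip_ext: "(\<And>y. ip x y = ip z y) \<Longrightarrow> x = z"
proof -
  assume "\<And>y. ip x y = ip z y"
  then have "ip (x - z) (x - z) = 0" by (simp add: ip_diff_left)
  then show ?thesis by simp
qed

lemma norm_minus_component:
  assumes "norm e = 1"
  shows "(norm (x - ip x e *\<^sub>K e))\<^sup>2 = (norm x)\<^sup>2 - (norm (ip x e))\<^sup>2"
proof -
  have "of_real ((norm (x - ip x e *\<^sub>K e))\<^sup>2) = ip (x - ip x e *\<^sub>K e) (x - ip x e *\<^sub>K e)"
    by (simp only: ip_self)
  also have "\<dots> = ip x x - cj (ip x e) * ip x e - ip x e * ip e x + ip x e * cj (ip x e) * ip e e"
    by (simp add: ip_simps algebra_simps)
  also have "\<dots> = ip x x - ip x e * cj (ip x e)"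
    using assms ip_commute[of e x] by (simp add: ip_self_unit algebra_simps)
  also have "\<dots> = of_real ((norm x)\<^sup>2 - (norm (ip x e))\<^sup>2)"
    by (simp add: mult_cj ip_self)
  finally show ?thesis by (simp only: of_real_eq_iff)
qed

text \<open>The equality case of Cauchy-Schwarz: the part of x orthogonal to e has norm
  zero.\<close>

lemma norm_ip_eq_imp:
  assumes "norm e = 1" "norm (ip x e) = norm x"
  shows "x = ip x e *\<^sub>K e"
  using norm_minus_component[OF assms(1), of x] assms(2) by simp

lemma norm_ip_eq_imp':
  assumes "norm (ip x y) = norm x * norm y" "norm x = norm y"
  obtains c where "norm c = 1" "x = c *\<^sub>K y"
proof (cases "y = 0")
  case True
  then show ?thesis using assms that[of 1] by simp
next
  case False
  define e where "e = (1 / norm y) *\<^sub>R y"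
  have e: "norm e = 1" using False by (simp add: e_def)
  have ie: "ip x e = of_real (1 / norm y) * ip x y"
    by (simp only: e_def scaleR_K ip_simps cj_of_real)
  have "norm (ip x e) = norm x" using assms False by (simp add: ie norm_mult norm_divide)
  then have "x = ip x e *\<^sub>K e" using norm_ip_eq_imp e by blast
  then have "x = (ip x e * of_real (1 / norm y)) *\<^sub>K y"
    unfolding e_def scaleR_K by (simp only: scale_scale)
  moreover have "norm (ip x e * of_real (1 / norm y)) = 1"
    using \<open>norm (ip x e) = norm x\<close> assms False by (simp add: norm_mult norm_divide)
  ultimately show ?thesis using that by blast
qed

lemma real_linearI:
  assumes "\<And>x y. f (x + y) = f x + f y" "\<And>a x. f (a *\<^sub>K x) = a *\<^sub>K f x"
  shows "linear f"
  by (rule linearI) (simp_all add: assms scaleR_K)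

section \<open>Wigner's theorem\<close>

text \<open>Bargmann's normalisation: fix a unit vector \<open>e\<close> and choose the phase of the image of \<open>e + x\<close>,
  for \<open>x\<close> orthogonal to \<open>e\<close>, so that this image is \<open>f e + T x\<close>. Comparing the transition probabilities
  of \<open>x, y\<close> and of \<open>e + x, e + y\<close> shows that \<open>T\<close> preserves real parts of inner products.\<close>

theorem wigner:
  assumes f: "\<And>x. norm x = 1 \<Longrightarrow> norm (f x) = 1"
    and ff: "\<And>x y. norm x = 1 \<Longrightarrow> norm y = 1 \<Longrightarrow> norm (ip (f x) (f y)) = norm (ip x y)"
  obtains V where "\<And>x y. V (x + y) = V x + V y"
    "(\<forall>a x. V (a *\<^sub>K x) = a *\<^sub>K V x) \<or> (\<forall>a x. V (a *\<^sub>K x) = cj a *\<^sub>K V x)"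
    "\<And>x. norm (V x) = norm x" "\<And>x. norm x = 1 \<Longrightarrow> \<exists>c. norm c = 1 \<and> f x = c *\<^sub>K V x"
proof (cases "\<exists>e::'a. norm e = 1")
  case False
  have "x = 0" for x :: 'a
  proof (rule ccontr)
    assume "x \<noteq> 0"
    then have "norm (x /\<^sub>R norm x) = 1" by simp
    then show False using False by blast
  qed
  then show ?thesis using that[of id] False by auto
next
  case True
  then obtain e :: 'a where e: "norm e = 1" by blast
  \<comment> \<open>Extends f homogeneously from the unit sphere, so that \<open>g (e + x)\<close>
    makes sense for every x.\<close>
  define g where "g x = norm x *\<^sub>R f (x /\<^sub>R norm x)" for x
  define e' where "e' = f e"
  have e': "norm e' = 1" using f e by (simp add: e'_def)
  have g_e: "g e = e'" by (simp add: g_def e'_def e)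
  have ng: "norm (g x) = norm x" for x
    by (cases "x = 0") (simp_all add: g_def f)
  have gg: "norm (ip (g x) (g y)) = norm (ip x y)" for x y
  proof (cases "x = 0 \<or> y = 0")
    case True
    then show ?thesis using ng[of x] ng[of y] by auto
  next
    case False
    have xx: "x = norm x *\<^sub>R (x /\<^sub>R norm x)" if "x \<noteq> 0" for x :: 'a using that by simp
    have "norm (ip (g x) (g y)) = norm x * norm y * norm (ip (f (x /\<^sub>R norm x)) (f (y /\<^sub>R norm y)))"
      by (simp only: g_def scaleR_K ip_simps cj_of_real norm_mult) simp
    also have "\<dots> = norm x * norm y * norm (ip (x /\<^sub>R norm x) (y /\<^sub>R norm y))"
      using False ff by simp
    also have "\<dots> = norm (ip (norm x *\<^sub>R (x /\<^sub>R norm x)) (norm y *\<^sub>R (y /\<^sub>R norm y)))"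
      by (simp only: scaleR_K[of "norm _"] ip_simps cj_of_real norm_mult) simp
    finally show ?thesis using xx False by metis
  qed
  \<comment> \<open>The scalar makes the component along \<open>e'\<close> equal to 1; T keeps the
    rest.\<close>
  define T where "T x = inverse (ip (g (e + x)) e') *\<^sub>K g (e + x) - e'" for x
  let ?O = "{x. ip x e = 0}"
  have c: "norm (ip (g (e + x)) e') = 1" if "x \<in> ?O" for x
    using gg[of "e + x" e] that e by (simp add: g_e ip_add_left ip_self_unit)
  have Teq: "e' + T x = inverse (ip (g (e + x)) e') *\<^sub>K g (e + x)" for x
    by (simp add: T_def)
  have T_orth: "ip (T x) e' = 0" if "x \<in> ?O" for x
  proof -
    have "ip (g (e + x)) e' \<noteq> 0" using c[OF that] by auto
    then show ?thesis by (simp add: T_def ip_simps ip_self_unit[OF e'])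
  qed
  have T_orth': "ip e' (T x) = 0" if "x \<in> ?O" for x
    using T_orth[OF that] ip_eq_0_commute by blast
  have orth: "ip e x = 0" if "x \<in> ?O" for x using that ip_eq_0_commute by blast
  have onep: "norm (1 + ip (T x) (T y)) = norm (1 + ip x y)" if "x \<in> ?O" "y \<in> ?O" for x y
  proof -
    have "1 + ip (T x) (T y) = ip (e' + T x) (e' + T y)"
      using that by (simp add: ip_simps T_orth T_orth' ip_self_unit[OF e'])
    then have "norm (1 + ip (T x) (T y)) = norm (ip (g (e + x)) (g (e + y)))"
      unfolding Teq using c[OF that(1)] c[OF that(2)]
      by (simp add: ip_simps norm_mult norm_inverse)
    also have "\<dots> = norm (ip (e + x) (e + y))" by (rule gg)
    also have "ip (e + x) (e + y) = 1 + ip x y"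
      using that orth by (simp add: ip_simps ip_self_unit[OF e])
    finally show ?thesis .
  qed
  have nT: "norm (T x) = norm x" if "x \<in> ?O" for x
  proof -
    have "ip (T x) (T x) = of_real ((norm (T x))\<^sup>2)" "ip x x = of_real ((norm x)\<^sup>2)" by (simp_all only: ip_self)
    then have "norm (of_real (1 + (norm (T x))\<^sup>2)::'k) = norm (of_real (1 + (norm x)\<^sup>2)::'k)"
      using onep[OF that that] by (simp only: of_real_add of_real_1)
    then have "\<bar>1 + (norm (T x))\<^sup>2\<bar> = \<bar>1 + (norm x)\<^sup>2\<bar>" by (simp only: norm_of_real)
    then have "(norm (T x))\<^sup>2 = (norm x)\<^sup>2" by simp
    then show ?thesis by (simp add: power2_eq_iff_nonneg)
  qed
  have gT: "\<exists>c. norm c = 1 \<and> g x = c *\<^sub>K T x" if "x \<in> ?O" for x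
  proof -
    have "norm (ip (g x) e') = 0" using gg[of x e] that by (simp add: g_e)
    then have "norm (ip (g x) (T x)) = norm (ip (g x) (e' + T x))" by (simp add: ip_simps)
    also have "\<dots> = norm (ip (g x) (g (e + x)))"
      unfolding Teq using c[OF that] by (simp add: ip_simps norm_mult norm_inverse)
    also have "\<dots> = norm (ip x x)" using that ip_eq_0_commute[of x e] by (simp add: gg ip_simps)
    also have "\<dots> = norm (g x) * norm (T x)"
      using nT[OF that] ng by (simp add: ip_self norm_power norm_mult power2_eq_square)
    finally show ?thesis using norm_ip_eq_imp'[of "g x" "T x"] nT[OF that] ng by metis
  qed
  have nTT: "norm (ip (T x) (T y)) = norm (ip x y)" if xy: "x \<in> ?O" "y \<in> ?O" for x y
  proof -
    obtain c d where "norm c = 1" "g x = c *\<^sub>K T x" "norm d = 1" "g y = d *\<^sub>K T y"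
      using gT xy by metis
    then show ?thesis using gg[of x y] by (simp add: ip_simps norm_mult)
  qed
  have rT: "re (ip (T x) (T y)) = re (ip x y)" if "x \<in> ?O" "y \<in> ?O" for x y
    using arg_cong[OF onep[OF that], of "\<lambda>t. t\<^sup>2"] nTT[OF that] by (simp add: norm_one_plus)
  have iT: "inner (T x) (T y) = inner x y" if "x \<in> ?O" "y \<in> ?O" for x y
    using rT[OF that] by (simp add: inner_ip)
  have Osub: "x + y \<in> ?O" "x - y \<in> ?O" "a *\<^sub>K x \<in> ?O" if "x \<in> ?O" "y \<in> ?O" for x y a
    using that by (auto simp: ip_simps)
  have Tadd: "T (x + y) = T x + T y" if "x \<in> ?O" "y \<in> ?O" for x y
  proof -
    \<comment> \<open>Expanding the square involves only inner products preserved by T, so it equals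
      the square of \<open>x + y - x - y = 0\<close>.\<close>
    have "inner (T (x + y) - T x - T y) (T (x + y) - T x - T y)
      = inner (x + y - x - y) (x + y - x - y)"
      using that Osub by (simp only: inner_diff_left inner_diff_right iT)
    then have "T (x + y) - T x - T y = 0" by simp
    then show ?thesis by (simp add: algebra_simps)
  qed
  have Tdiff: "T (x - y) = T x - T y" if "x \<in> ?O" "y \<in> ?O" for x y
    using Tadd[of "x - y" y] that Osub by simp
  have Tscale: "T (a *\<^sub>K x) = a *\<^sub>K T x \<or> T (a *\<^sub>K x) = cj a *\<^sub>K T x" if x: "x \<in> ?O" for a x
  proof (cases "x = 0")
    case True
    have "T 0 = 0" using nT[of 0] by simp
    then show ?thesis using True by simp
  next
    case False
    let ?N = "of_real ((norm x)\<^sup>2) :: 'k"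
    have N: "?N \<noteq> 0" using False by simp
    have ax: "a *\<^sub>K x \<in> ?O" using x by (simp add: ip_simps)
    have "ip (T (a *\<^sub>K x)) (T x) = ip (a *\<^sub>K x) x \<or> ip (T (a *\<^sub>K x)) (T x) = cj (ip (a *\<^sub>K x) x)"
      using re_norm_determines[OF rT[OF ax x] nTT[OF ax x]] .
    then have 1: "ip (T (a *\<^sub>K x)) (T x) = a * ?N \<or> ip (T (a *\<^sub>K x)) (T x) = cj a * ?N"
      by (simp only: ip_scale_left ip_self cj_mult cj_of_real)
    define u where "u = (1 / norm x) *\<^sub>R T x"
    have u: "norm u = 1" using nT[OF x] False by (simp add: u_def)
    have iu: "ip (T (a *\<^sub>K x)) u = of_real (1 / norm x) * ip (T (a *\<^sub>K x)) (T x)"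
      by (simp only: u_def scaleR_K ip_simps cj_of_real)
    have "norm (ip (T (a *\<^sub>K x)) u) = norm (T (a *\<^sub>K x))"
      using 1 False nT[OF ax]
      by (auto simp: iu norm_mult norm_divide norm_power norm_scale power2_eq_square)
    then have "T (a *\<^sub>K x) = ip (T (a *\<^sub>K x)) u *\<^sub>K u" using norm_ip_eq_imp u by blast
    also have "\<dots> = (of_real (1 / norm x) * ip (T (a *\<^sub>K x)) (T x) * of_real (1 / norm x)) *\<^sub>K T x"
      unfolding iu by (simp only: u_def scaleR_K scale_scale)
    finally have 2: "T (a *\<^sub>K x) = (of_real (1 / norm x) * ip (T (a *\<^sub>K x)) (T x) * of_real (1 / norm x)) *\<^sub>K T x" .
    have 3: "of_real (1 / norm x) * (b * ?N) * of_real (1 / norm x) = b" for b :: 'k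
      using False by (simp add: power2_eq_square field_simps)
    from 1 show ?thesis
    proof
      assume "ip (T (a *\<^sub>K x)) (T x) = a * ?N"
      then show ?thesis using 2 3 by simp
    next
      assume "ip (T (a *\<^sub>K x)) (T x) = cj a * ?N"
      then show ?thesis using 2 3 by simp
    qed
  qed
  \<comment> \<open>In \<open>Tscale\<close> the alternative may depend on both a and x. Here the
    dependence on x is removed, and in \<open>Tscale3\<close> that on a.\<close>
  have Tscale2: "(\<forall>x\<in>?O. T (a *\<^sub>K x) = a *\<^sub>K T x) \<or> (\<forall>x\<in>?O. T (a *\<^sub>K x) = cj a *\<^sub>K T x)" for a
  proof -
    have "?O \<subseteq> {x\<in>?O. T (a *\<^sub>K x) = a *\<^sub>K T x} \<or> ?O \<subseteq> {x\<in>?O. T (a *\<^sub>K x) = cj a *\<^sub>K T x}"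
    proof (rule additive_unionE)
      show "?O \<subseteq> {x\<in>?O. T (a *\<^sub>K x) = a *\<^sub>K T x} \<union> {x\<in>?O. T (a *\<^sub>K x) = cj a *\<^sub>K T x}"
        using Tscale by blast
    qed (auto simp: K.scale_right_diff_distrib Tdiff ip_simps)
    then show ?thesis by blast
  qed
  have Tscale3: "(\<forall>a. \<forall>x\<in>?O. T (a *\<^sub>K x) = a *\<^sub>K T x) \<or> (\<forall>a. \<forall>x\<in>?O. T (a *\<^sub>K x) = cj a *\<^sub>K T x)"
  proof -
    have cjd: "cj (a - b) = cj a - cj b" for a b using cj_add[of a "-b"] by (simp add: cj_minus)
    have "UNIV \<subseteq> {a. \<forall>x\<in>?O. T (a *\<^sub>K x) = a *\<^sub>K T x} \<or> UNIV \<subseteq> {a. \<forall>x\<in>?O. T (a *\<^sub>K x) = cj a *\<^sub>K T x}"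
    proof (rule additive_unionE)
      show "UNIV \<subseteq> {a. \<forall>x\<in>?O. T (a *\<^sub>K x) = a *\<^sub>K T x} \<union> {a. \<forall>x\<in>?O. T (a *\<^sub>K x) = cj a *\<^sub>K T x}"
        using Tscale2 by blast
    qed (auto simp: K.scale_left_diff_distrib Tdiff ip_simps cjd)
    then show ?thesis by blast
  qed
  then obtain \<sigma> where \<sigma>: "\<sigma> = (\<lambda>a. a) \<or> \<sigma> = cj"
    and Ts: "\<And>a x. x \<in> ?O \<Longrightarrow> T (a *\<^sub>K x) = \<sigma> a *\<^sub>K T x"
  proof
    assume "\<forall>a. \<forall>x\<in>?O. T (a *\<^sub>K x) = a *\<^sub>K T x"
    then show ?thesis using that[of "\<lambda>a. a"] by auto
  next
    assume "\<forall>a. \<forall>x\<in>?O. T (a *\<^sub>K x) = cj a *\<^sub>K T x"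
    then show ?thesis using that[of cj] by auto
  qed
  have \<sigma>_add: "\<sigma> (a + b) = \<sigma> a + \<sigma> b" and \<sigma>_mult: "\<sigma> (a * b) = \<sigma> a * \<sigma> b"
    and \<sigma>_norm: "norm (\<sigma> a) = norm a" and \<sigma>_div: "\<sigma> (a / b) = \<sigma> a / \<sigma> b" and \<sigma>_1: "\<sigma> 1 = 1" and \<sigma>_0: "\<sigma> 0 = 0" for a b
    using \<sigma> by (auto simp: cj_add cj_mult cj_divide)
  \<comment> \<open>The line of e must be mapped with the same \<open>\<sigma>\<close> that T obeys
    on the orthogonal complement.\<close>
  define V where "V x = \<sigma> (ip x e) *\<^sub>K e' + T (x - ip x e *\<^sub>K e)" for x
  have comp: "x - ip x e *\<^sub>K e \<in> ?O" for x by (simp add: ip_simps ip_self_unit[OF e])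
  have nV: "norm (V x) = norm x" for x
  proof -
    have t: "T (x - ip x e *\<^sub>K e) = V x - ip (V x) e' *\<^sub>K e'" "ip (V x) e' = \<sigma> (ip x e)"
      unfolding V_def by (simp_all add: ip_simps T_orth[OF comp] ip_self_unit[OF e'])
    have "(norm (V x))\<^sup>2 = (norm (V x - ip (V x) e' *\<^sub>K e'))\<^sup>2 + (norm (ip (V x) e'))\<^sup>2"
      using norm_minus_component[OF e', of "V x"] by simp
    also have "\<dots> = (norm (x - ip x e *\<^sub>K e))\<^sup>2 + (norm (ip x e))\<^sup>2"
      using t(2) nT[OF comp, of x, unfolded t(1)] by (simp add: \<sigma>_norm)
    also have "\<dots> = (norm x)\<^sup>2" using norm_minus_component[OF e, of x] by simp
    finally show ?thesis by (simp add: power2_eq_iff_nonneg)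
  qed
  show ?thesis
  proof (rule that[of V])
    fix x y
    have "x + y - ip (x + y) e *\<^sub>K e = (x - ip x e *\<^sub>K e) + (y - ip y e *\<^sub>K e)"
      by (simp add: ip_simps scale_add_left algebra_simps)
    then have "T (x + y - ip (x + y) e *\<^sub>K e) = T (x - ip x e *\<^sub>K e) + T (y - ip y e *\<^sub>K e)"
      by (simp only: Tadd[OF comp comp])
    then show "V (x + y) = V x + V y"
      unfolding V_def by (simp add: ip_add_left \<sigma>_add scale_add_left)
  next
    have "V (a *\<^sub>K x) = \<sigma> a *\<^sub>K V x" for a x
    proof -
      have "a *\<^sub>K x - ip (a *\<^sub>K x) e *\<^sub>K e = a *\<^sub>K (x - ip x e *\<^sub>K e)"
        by (simp add: ip_simps K.scale_right_diff_distrib scale_scale)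
      then have "T (a *\<^sub>K x - ip (a *\<^sub>K x) e *\<^sub>K e) = \<sigma> a *\<^sub>K T (x - ip x e *\<^sub>K e)"
        by (simp only: Ts[OF comp])
      then show ?thesis unfolding V_def
        by (simp add: ip_scale_left \<sigma>_mult scale_add_right scale_scale)
    qed
    then show "(\<forall>a x. V (a *\<^sub>K x) = a *\<^sub>K V x) \<or> (\<forall>a x. V (a *\<^sub>K x) = cj a *\<^sub>K V x)"
      using \<sigma> by auto
  next
    show "norm (V x) = norm x" for x by (rule nV)
  next
    fix x assume x: "norm (x::'a) = 1"
    let ?l = "ip x e" and ?y = "x - ip x e *\<^sub>K e"
    have gf: "g x = f x" by (simp add: g_def x)
    have "norm (ip (g x) (V x)) = 1"
    proof (cases "?l = 0")
      case True
      then have "V x = T x" by (simp add: V_def \<sigma>_0)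
      moreover obtain c where "norm c = 1" "g x = c *\<^sub>K T x" using gT[of x] True by auto
      moreover have "norm (T x) = 1" using nT[of x] True x by simp
      ultimately show ?thesis by (simp add: ip_simps ip_self_unit)
    next
      case False
      \<comment> \<open>Rescaling makes the component along e equal to 1:
        \<open>e + ?z = (1 / ?l) *\<^sub>K x\<close>, and T is defined through such vectors.\<close>
      let ?z = "(1 / ?l) *\<^sub>K ?y"
      have zO: "?z \<in> ?O" using comp[of x] by (simp add: ip_simps)
      have "e' + T ?z = (1 / \<sigma> ?l) *\<^sub>K V x"
      proof -
        have "T ?z = (1 / \<sigma> ?l) *\<^sub>K T ?y" using Ts[OF comp, of "1 / ?l" x] by (simp add: \<sigma>_div \<sigma>_1)
        moreover have "\<sigma> ?l \<noteq> 0" using False \<sigma>_norm by (metis norm_eq_zero)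
        ultimately show ?thesis by (simp add: V_def scale_add_right scale_scale)
      qed
      then have "(1 / \<sigma> ?l) *\<^sub>K V x = inverse (ip (g (e + ?z)) e') *\<^sub>K g (e + ?z)" using Teq by simp
      then have "norm (ip (g x) ((1 / \<sigma> ?l) *\<^sub>K V x)) = norm (ip (g x) (g (e + ?z)))"
        using c[OF zO] by (simp add: ip_simps norm_mult norm_inverse)
      then have "norm (ip (g x) (V x)) = norm ?l * norm (ip (g x) (g (e + ?z)))"
        using False by (simp add: ip_simps norm_mult norm_divide \<sigma>_norm field_simps)
      also have "norm (ip (g x) (g (e + ?z))) = norm (ip x (e + ?z))" by (rule gg)
      also have "e + ?z = (1 / ?l) *\<^sub>K x"
        using False by (simp add: K.scale_right_diff_distrib scale_scale)
      also have "norm ?l * norm (ip x ((1 / ?l) *\<^sub>K x)) = 1"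
        using False x by (simp add: ip_simps norm_mult norm_divide ip_self_unit)
      finally show ?thesis .
    qed
    then show "\<exists>c. norm c = 1 \<and> f x = c *\<^sub>K V x"
      using norm_ip_eq_imp'[of "f x" "V x"] nV x gf f by (metis mult_1)
  qed
qed

end

section \<open>Projections\<close>

lemma closed_subspace_nearest:
  fixes S :: "'v::{real_inner, complete_space} set"
  assumes cl: "closed S" and sub: "subspace S"
  obtains y where "y \<in> S" "\<And>s. s \<in> S \<Longrightarrow> inner (x - y) s = 0"
proof -
  define d where "d = Inf ((\<lambda>y. (norm (x - y))\<^sup>2) ` S)"
  have ne: "(\<lambda>y. (norm (x - y))\<^sup>2) ` S \<noteq> {}" using subspace_0[OF sub] by auto
  have bdd: "bdd_below ((\<lambda>y. (norm (x - y))\<^sup>2) ` S)" by (rule bdd_belowI[of _ 0]) auto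
  have dle: "d \<le> (norm (x - y))\<^sup>2" if "y \<in> S" for y
    unfolding d_def using that bdd by (intro cInf_lower) auto
  have "\<exists>y\<in>S. (norm (x - y))\<^sup>2 < d + 1 / real (Suc n)" for n
    using cInf_lessD[OF ne, of "d + 1 / real (Suc n)"] unfolding d_def by auto
  then obtain y where y: "\<And>n. y n \<in> S" "\<And>n. (norm (x - y n))\<^sup>2 < d + 1 / real (Suc n)" by metis
  \<comment> \<open>Parallelogram law for \<open>x - y m\<close> and \<open>x - y n\<close>: the
    midpoint of \<open>y m\<close> and \<open>y n\<close> lies in S, so its squared distance from x
    is at least d.\<close>
  have par: "(norm (y m - y n))\<^sup>2 \<le> 2 / real (Suc m) + 2 / real (Suc n)" for m n
  proof -
    have "(1/2) *\<^sub>R (y m + y n) \<in> S" using y sub by (intro subspace_scale subspace_add)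
    then have "d \<le> (norm (x - (1/2) *\<^sub>R (y m + y n)))\<^sup>2" by (rule dle)
    moreover have "(norm (y m - y n))\<^sup>2 = 2 * (norm (x - y m))\<^sup>2 + 2 * (norm (x - y n))\<^sup>2
      - 4 * (norm (x - (1/2) *\<^sub>R (y m + y n)))\<^sup>2"
      by (simp add: power2_norm_eq_inner inner_commute algebra_simps)
    moreover have "2 / real (Suc k) = 2 * (1 / real (Suc k))" for k by simp
    ultimately show ?thesis using y(2)[of m] y(2)[of n] by (smt (verit))
  qed
  have "Cauchy y"
  proof (rule metric_CauchyI)
    fix r :: real assume r: "0 < r"
    obtain N where N: "4 / r\<^sup>2 < real N" using reals_Archimedean2 by blast
    then have "4 < real N * r\<^sup>2" using r by (simp add: field_simps)
    also have "\<dots> \<le> real (Suc N) * r\<^sup>2" by (simp add: mult_right_mono)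
    finally have N': "4 / real (Suc N) < r\<^sup>2" by (simp add: field_simps)
    have "dist (y m) (y n) < r" if mn: "m \<ge> N" "n \<ge> N" for m n
    proof -
      have "2 / real (Suc m) \<le> 2 / real (Suc N)" "2 / real (Suc n) \<le> 2 / real (Suc N)"
        using mn by (auto intro!: divide_left_mono)
      then have "(norm (y m - y n))\<^sup>2 < r\<^sup>2" using par[of m n] N' by simp
      then show ?thesis using r by (simp add: dist_norm power2_less_imp_less)
    qed
    then show "\<exists>M. \<forall>m\<ge>M. \<forall>n\<ge>M. dist (y m) (y n) < r" by blast
  qed
  then obtain l where l: "y \<longlonglongrightarrow> l" using Cauchy_convergent convergent_def by blast
  have lS: "l \<in> S" using closed_sequentially[OF cl] y l by blast
  have "(\<lambda>n. (norm (x - y n))\<^sup>2) \<longlonglongrightarrow> (norm (x - l))\<^sup>2" by (intro tendsto_intros l)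
  moreover have "(\<lambda>n. d + 1 / real (Suc n)) \<longlonglongrightarrow> d + 0"
    by (intro tendsto_intros LIMSEQ_Suc[OF lim_1_over_n])
  ultimately have le: "(norm (x - l))\<^sup>2 \<le> d"
    using LIMSEQ_le[of "\<lambda>n. (norm (x - y n))\<^sup>2" "(norm (x - l))\<^sup>2" "\<lambda>n. d + 1 / real (Suc n)" d] y(2)
    by (auto intro: less_imp_le)
  have "inner (x - l) s = 0" if s: "s \<in> S" for s
  proof (cases "s = 0")
    case False
    \<comment> \<open>The t that minimises the distance from x to \<open>l + t s\<close>. As l is
      already nearest, the gain over \<open>t = 0\<close> must vanish.\<close>
    define t where "t = inner (x - l) s / inner s s"
    have "l + t *\<^sub>R s \<in> S" using lS s sub by (intro subspace_add subspace_scale)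
    then have "(norm (x - l))\<^sup>2 \<le> (norm (x - (l + t *\<^sub>R s)))\<^sup>2" using dle[of "l + t *\<^sub>R s"] le by linarith
    also have "\<dots> = (norm (x - l))\<^sup>2 - 2 * t * inner (x - l) s + t * t * inner s s"
      by (simp add: power2_norm_eq_inner inner_commute algebra_simps)
    also have "\<dots> = (norm (x - l))\<^sup>2 - (inner (x - l) s)\<^sup>2 / inner s s"
      using False by (simp add: t_def power2_eq_square)
    finally have "(inner (x - l) s)\<^sup>2 / inner s s \<le> 0" by simp
    moreover have "inner s s > 0" using False by simp
    ultimately show ?thesis by (simp add: divide_le_0_iff)
  qed simp
  then show ?thesis using that lS by blast
qed

context kspace
begin

text \<open>Boundedness follows by \<open>kproj_norm_le\<close>, which makes this agree with
  \<open>rproj\<close> and \<open>cproj\<close>.\<close>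

definition kproj :: "('a \<Rightarrow> 'a) \<Rightarrow> bool" where
  "kproj P \<longleftrightarrow> (\<forall>x y. P (x + y) = P x + P y) \<and> (\<forall>a x. P (a *\<^sub>K x) = a *\<^sub>K P x)
    \<and> (\<forall>x. P (P x) = P x) \<and> (\<forall>x y. ip (P x) y = ip x (P y))"

definition hasdim :: "'a set \<Rightarrow> nat \<Rightarrow> bool" where
  "hasdim S d \<longleftrightarrow> (\<exists>B. finite B \<and> card B = d \<and> \<not> K.dependent B \<and> K.span B = S)"

definition KP :: "nat \<Rightarrow> ('a \<Rightarrow> 'a) set" where
  "KP n = {P. kproj P \<and> hasdim (range P) n}"

definition KI :: "('a \<Rightarrow> 'a) set" where
  "KI = {P. kproj P \<and> \<not> (\<exists>d. hasdim (range P) d)}"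

definition kunitary :: "('a \<Rightarrow> 'a) \<Rightarrow> bool" where
  "kunitary U \<longleftrightarrow> (\<forall>x y. U (x + y) = U x + U y) \<and> (\<forall>a x. U (a *\<^sub>K x) = a *\<^sub>K U x)
    \<and> surj U \<and> (\<forall>x. norm (U x) = norm x)"

definition kangle_eq :: "('a \<Rightarrow> 'a) \<Rightarrow> ('a \<Rightarrow> 'a) \<Rightarrow> ('a \<Rightarrow> 'a) \<Rightarrow> ('a \<Rightarrow> 'a) \<Rightarrow> bool" where
  "kangle_eq P Q P' Q' \<longleftrightarrow> (\<exists>U. kunitary U \<and> U \<circ> (Q \<circ> P \<circ> Q) = (Q' \<circ> P' \<circ> Q') \<circ> U)"

definition kon :: "'a set \<Rightarrow> bool" where
  "kon B \<longleftrightarrow> finite B \<and> (\<forall>a\<in>B. \<forall>b\<in>B. ip a b = (if a = b then 1 else 0))"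

text \<open>For \<open>kon B\<close> this is the orthogonal projection onto the span of B; by
  \<open>KP_iff\<close> every projection of rank n has this form.\<close>

definition PS :: "'a set \<Rightarrow> 'a \<Rightarrow> 'a" where
  "PS B x = (\<Sum>b\<in>B. ip x b *\<^sub>K b)"

definition rk1 :: "'a \<Rightarrow> 'a \<Rightarrow> 'a" where
  "rk1 e x = ip x e *\<^sub>K e"

section \<open>Algebra and order of projections\<close>

lemma kproj_add: "kproj P \<Longrightarrow> P (x + y) = P x + P y"
  and kproj_scale: "kproj P \<Longrightarrow> P (a *\<^sub>K x) = a *\<^sub>K P x"
  and kproj_idem: "kproj P \<Longrightarrow> P (P x) = P x"
  and kproj_sa: "kproj P \<Longrightarrow> ip (P x) y = ip x (P y)"
  by (auto simp: kproj_def)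

lemma kproj_zero: "kproj P \<Longrightarrow> P 0 = 0"
  using kproj_scale[of P 0 0] by simp

lemma kproj_diff: "kproj P \<Longrightarrow> P (x - y) = P x - P y"
  using kproj_add[of P x "- y"] kproj_scale[of P "-1" y] by simp

lemma kproj_range: "kproj P \<Longrightarrow> x \<in> range P \<longleftrightarrow> P x = x"
  by (metis kproj_idem rangeE rangeI)

lemma kproj_linear: "kproj P \<Longrightarrow> linear P"
  by (rule real_linearI) (auto simp: kproj_def)

lemma kproj_selfadj: "kproj P \<Longrightarrow> selfadj P"
  by (simp add: selfadj_def kproj_linear inner_ip kproj_sa)

lemma kproj_subspace: "kproj P \<Longrightarrow> K.subspace (range P)"
  unfolding K.subspace_def
  by (auto simp: kproj_range kproj_zero kproj_add kproj_scale kproj_idem)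

lemma kproj_pythagoras:
  assumes "kproj P"
  shows "(norm x)\<^sup>2 = (norm (P x))\<^sup>2 + (norm (x - P x))\<^sup>2"
proof -
  have "ip (P x) (x - P x) = 0" using assms by (simp add: kproj_sa kproj_diff kproj_idem)
  then have "inner (P x) (x - P x) = 0" by (simp add: inner_ip)
  then have "(norm (P x + (x - P x)))\<^sup>2 = (norm (P x))\<^sup>2 + (norm (x - P x))\<^sup>2"
    by (intro norm_add_Pythagorean) (simp add: orthogonal_def)
  then show ?thesis by simp
qed

lemma kproj_norm_le: "kproj P \<Longrightarrow> norm (P x) \<le> norm x"
  by (rule power2_le_imp_le) (simp_all add: kproj_pythagoras[of P x])


definition kle :: "('a \<Rightarrow> 'a) \<Rightarrow> ('a \<Rightarrow> 'a) \<Rightarrow> bool" where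
  "kle P Q \<longleftrightarrow> (\<forall>x. Q (P x) = P x)"

lemma kle_left:
  assumes "kproj P" "kproj Q" "kle P Q"
  shows "P (Q x) = P x"
proof (rule ip_ext)
  fix y
  have "ip (P (Q x)) y = ip x (Q (P y))" using assms by (simp add: kproj_sa)
  then show "ip (P (Q x)) y = ip (P x) y" using assms by (simp add: kle_def kproj_sa)
qed

lemma kle_antisym: "kproj P \<Longrightarrow> kproj Q \<Longrightarrow> kle P Q \<Longrightarrow> kle Q P \<Longrightarrow> P = Q"
proof
  fix x assume a: "kproj P" "kproj Q" "kle P Q" "kle Q P"
  have "P x = P (Q x)" using kle_left[OF a(1-3)] by simp
  also have "\<dots> = Q x" using a(4) by (simp add: kle_def)
  finally show "P x = Q x" .
qed

lemma kproj_eqI: "kproj P \<Longrightarrow> kproj Q \<Longrightarrow> range P = range Q \<Longrightarrow> P = Q"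
  by (rule kle_antisym) (metis kle_def kproj_range rangeI)+

lemma kproj_orth_sym:
  assumes "kproj P" "kproj Q" "\<And>x. P (Q x) = 0"
  shows "Q (P x) = 0"
proof (rule ip_ext)
  fix y
  have "ip (Q (P x)) y = ip x (P (Q y))" using assms by (simp add: kproj_sa)
  then show "ip (Q (P x)) y = ip 0 y" using assms by simp
qed

lemma kproj_compl: "kproj P \<Longrightarrow> kproj (\<lambda>x. x - P x)"
  by (subst kproj_def) (simp add: kproj_add kproj_scale kproj_diff kproj_idem kproj_sa ip_simps
      K.scale_right_diff_distrib)

lemma kproj_orth_sum:
  assumes P: "kproj P" and Q: "kproj Q" and o: "\<And>x. P (Q x) = 0"
  shows "kproj (\<lambda>x. P x + Q x)"
proof -
  note o' = kproj_orth_sym[OF P Q o]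
  show ?thesis
    unfolding kproj_def
    using P Q by (auto simp: kproj_add kproj_scale kproj_idem kproj_sa ip_simps scale_add_right o o' algebra_simps)
qed

lemma kproj_kle_diff:
  assumes P: "kproj P" and Q: "kproj Q" and le: "kle P Q"
  shows "kproj (\<lambda>x. Q x - P x)"
  unfolding kproj_def
  using P Q le kle_left[OF P Q le]
  by (auto simp: kproj_add kproj_diff kproj_scale kproj_idem kproj_sa ip_simps kle_def
      K.scale_right_diff_distrib)

lemma kproj_comp:
  assumes P: "kproj P" and Q: "kproj Q" and c: "\<And>x. P (Q x) = Q (P x)"
  shows "kproj (\<lambda>x. P (Q x))"
proof -
  have "P (Q (P (Q x))) = P (Q x)" for x
    by (simp only: c[of "Q x", symmetric] kproj_idem[OF P] kproj_idem[OF Q])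
  moreover have "ip (P (Q x)) y = ip x (P (Q y))" for x y
    by (simp only: kproj_sa[OF P] kproj_sa[OF Q] c)
  ultimately show ?thesis
    unfolding kproj_def by (simp add: kproj_add[OF P] kproj_add[OF Q] kproj_scale[OF P] kproj_scale[OF Q])
qed

lemma kproj_id: "kproj (\<lambda>x. x)"
  by (simp add: kproj_def)

lemma rk1_kproj:
  assumes "norm e = 1"
  shows "kproj (rk1 e)"
proof -
  have "cj (ip y e) = ip e y" for y by (rule ip_commute[symmetric])
  then show ?thesis unfolding kproj_def rk1_def
    using assms by (simp add: ip_simps ip_self_unit scale_add_left scale_scale)
qed

lemma rk1_self: "norm e = 1 \<Longrightarrow> rk1 e e = e"
  by (simp add: rk1_def ip_self_unit)

lemma rk1_phase: "norm c = 1 \<Longrightarrow> rk1 (c *\<^sub>K e) = rk1 e"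
proof
  fix x assume "norm c = 1"
  then have "cj c * c = 1" using mult_cj[of c] by (simp add: mult.commute)
  then have "cj c * ip x e * c = ip x e" by (metis mult.assoc mult.commute mult_1)
  then show "rk1 (c *\<^sub>K e) x = rk1 e x" by (simp add: rk1_def ip_simps scale_scale)
qed

lemma rk1_eqD:
  assumes "norm e = 1" "norm f = 1" "rk1 e = rk1 f"
  shows "norm (ip e f) = 1"
proof -
  have "e = ip e f *\<^sub>K f" using rk1_self[OF assms(1)] assms(3) by (simp add: rk1_def)
  then show ?thesis using assms norm_scale[of "ip e f" f] by simp
qed

lemma rk1_eqI:
  assumes "norm e = 1" "norm f = 1" "norm (ip e f) = 1"
  shows "rk1 e = rk1 f"
  using norm_ip_eq_imp[of f e] assms rk1_phase[of "ip e f" f] by simp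

section \<open>Finite orthonormal sets and the projections onto their spans\<close>

lemma kon_ip: "kon B \<Longrightarrow> a \<in> B \<Longrightarrow> b \<in> B \<Longrightarrow> ip a b = (if a = b then 1 else 0)"
  by (simp add: kon_def)

lemma kon_finite: "kon B \<Longrightarrow> finite B"
  by (simp add: kon_def)

lemma kon_norm: "kon B \<Longrightarrow> b \<in> B \<Longrightarrow> norm b = 1"
proof -
  assume "kon B" "b \<in> B"
  then have "of_real ((norm b)\<^sup>2) = (of_real 1 :: 'k)" using ip_self[of b] by (simp add: kon_def)
  then have "(norm b)\<^sup>2 = 1" by (simp only: of_real_eq_iff)
  then show ?thesis by (simp add: power2_eq_1_iff) (metis norm_ge_zero neg_0_le_iff_le not_one_le_zero)
qed

lemma kon_subset: "kon B \<Longrightarrow> A \<subseteq> B \<Longrightarrow> kon A"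
  unfolding kon_def by (meson finite_subset subset_iff)

lemma kon_insert:
  assumes "kon B" "norm e = 1" "\<And>b. b \<in> B \<Longrightarrow> ip e b = 0"
  shows "kon (insert e B)" "e \<notin> B"
proof -
  show "e \<notin> B" using assms ip_self_unit[OF assms(2)] by force
  then show "kon (insert e B)"
    using assms ip_eq_0_commute ip_self_unit[OF assms(2)] by (auto simp: kon_def)
qed

lemma PS_rk1: "PS B x = (\<Sum>b\<in>B. rk1 b x)"
  by (simp add: PS_def rk1_def)

lemma PS_insert: "finite B \<Longrightarrow> e \<notin> B \<Longrightarrow> PS (insert e B) x = rk1 e x + PS B x"
  by (simp add: PS_rk1)

lemma PS_add: "PS B (x + y) = PS B x + PS B y"
  by (simp add: PS_def ip_add_left scale_add_left sum.distrib)

lemma PS_scale: "PS B (a *\<^sub>K x) = a *\<^sub>K PS B x"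
  by (simp add: PS_def ip_scale_left K.scale_sum_right scale_scale)

lemma PS_span: "PS B x \<in> K.span B"
  unfolding PS_def by (intro K.span_sum K.span_scale K.span_base)

lemma PS_base:
  assumes "kon B" "b \<in> B"
  shows "PS B b = b"
proof -
  have "PS B b = (\<Sum>c\<in>B. if b = c then c else 0)"
    unfolding PS_def using assms by (intro sum.cong) (auto simp: kon_def)
  then show ?thesis using assms by (simp add: kon_finite)
qed

lemma PS_fix:
  assumes "kon B" "x \<in> K.span B"
  shows "PS B x = x"
  using assms(2)
proof (induction rule: K.span_induct_alt)
  case base
  then show ?case by (simp add: PS_def)
next
  case (step c a y)
  then show ?case using PS_base[OF assms(1)] by (simp add: PS_add PS_scale)
qed

lemma PS_orth: "(\<And>b. b \<in> B \<Longrightarrow> ip x b = 0) \<Longrightarrow> PS B x = 0"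
  by (simp add: PS_def)

lemma PS_kproj: "kon B \<Longrightarrow> kproj (PS B)"
proof -
  assume B: "kon B"
  have "ip (PS B x) y = ip x (PS B y)" for x y
  proof -
    have "cj (ip y b) = ip b y" for b by (metis ip_commute)
    then show ?thesis unfolding PS_def by (simp add: ip_sum_left ip_sum_right ip_simps mult.commute)
  qed
  then show "kproj (PS B)" unfolding kproj_def
    using PS_fix[OF B PS_span] by (simp add: PS_add PS_scale)
qed

lemma range_PS: "kon B \<Longrightarrow> range (PS B) = K.span B"
proof (intro subset_antisym subsetI)
  fix x assume "kon B" "x \<in> K.span B"
  then show "x \<in> range (PS B)" using PS_fix[of B x] by (metis rangeI)
qed (auto simp: PS_span)

lemma ip_minus_PS:
  assumes "kon B" "b \<in> B"
  shows "ip (x - PS B x) b = 0"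
  using assms by (simp add: ip_diff_left kproj_sa[OF PS_kproj] PS_base)

lemma kon_independent: "kon B \<Longrightarrow> \<not> K.dependent B"
proof
  assume B: "kon B" and "K.dependent B"
  then obtain b where b: "b \<in> B" "b \<in> K.span (B - {b})" unfolding K.dependent_def by blast
  have "PS (B - {b}) b = b" using kon_subset[OF B, of "B - {b}"] b PS_fix by blast
  moreover have "PS (B - {b}) b = 0" using B b by (intro PS_orth) (auto simp: kon_def)
  ultimately show False using kon_norm[OF B b(1)] by simp
qed

lemma kon_card_le: "kon A \<Longrightarrow> finite F \<Longrightarrow> A \<subseteq> K.span F \<Longrightarrow> card A \<le> card F"
  using K.independent_span_bound kon_independent by blast

lemma kon_step:
  assumes B: "kon B" and v: "v \<notin> K.span B"
  obtains e where "norm e = 1" "\<And>b. b \<in> B \<Longrightarrow> ip e b = 0" "K.span (insert e B) = K.span (insert v B)"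
proof -
  define y where "y = v - PS B v"
  have "y \<noteq> 0" using v PS_span[of B v] by (auto simp: y_def)
  define e where "e = (1 / norm y) *\<^sub>R y"
  have 1: "norm e = 1" using \<open>y \<noteq> 0\<close> by (simp add: e_def)
  have 2: "ip e b = 0" if "b \<in> B" for b
    using ip_minus_PS[OF B that] by (simp add: e_def y_def scaleR_K ip_scale_left)
  have ve: "v = norm y *\<^sub>R e + PS B v" using \<open>y \<noteq> 0\<close> by (simp add: e_def y_def)
  have PSs: "PS B v \<in> K.span (insert z B)" for z
    using PS_span[of B v] K.span_mono[of B "insert z B"] by blast
  have "v \<in> K.span (insert e B)"
    by (subst ve, unfold scaleR_K, intro K.span_add K.span_scale PSs K.span_base) simp
  moreover have "e \<in> K.span (insert v B)"
    unfolding e_def y_def scaleR_K by (intro K.span_scale K.span_diff PSs K.span_base) simp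
  ultimately have "K.span (insert e B) = K.span (insert v B)"
    by (intro subset_antisym K.span_minimal) (auto intro: K.span_base)
  then show ?thesis using that 1 2 by blast
qed

lemma gram_schmidt:
  assumes "finite F"
  obtains B where "kon B" "K.span B = K.span F"
proof -
  have "\<exists>B. kon B \<and> K.span B = K.span F"
    using assms
  proof (induction rule: finite_induct)
    case empty
    show ?case by (intro exI[of _ "{}"]) (simp add: kon_def)
  next
    case (insert v F)
    then obtain B where B: "kon B" "K.span B = K.span F" by blast
    have sp: "K.span (insert v B) = K.span (insert v F)" using B(2) by (simp add: K.span_insert)
    show ?case
    proof (cases "v \<in> K.span B")
      case True
      then have "K.span (insert v B) = K.span B" by (rule K.span_redundant)
      then show ?thesis using B(1) sp by metis
    next
      case False
      obtain e where "norm e = 1" "\<And>b. b \<in> B \<Longrightarrow> ip e b = 0" "K.span (insert e B) = K.span (insert v B)"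
        using kon_step[OF B(1) False] by blast
      then show ?thesis using kon_insert(1)[OF B(1)] sp by metis
    qed
  qed
  then show ?thesis using that by blast
qed

lemma hasdim_kon:
  assumes "hasdim S d"
  obtains B where "kon B" "card B = d" "K.span B = S"
proof -
  obtain F where F: "finite F" "card F = d" "\<not> K.dependent F" "K.span F = S"
    using assms by (auto simp: hasdim_def)
  obtain B where B: "kon B" "K.span B = K.span F" using gram_schmidt[OF F(1)] .
  have "card B = card F"
    using K.dim_eq_card[OF B(2) kon_independent[OF B(1)]] K.dim_eq_card[OF refl F(3)] by simp
  then show ?thesis using that B F by metis
qed

lemma kon_hasdim: "kon B \<Longrightarrow> hasdim (K.span B) (card B)"
  unfolding hasdim_def using kon_independent kon_finite by blast

lemma hasdim_span: "finite F \<Longrightarrow> \<exists>d. hasdim (K.span F) d"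
proof -
  assume "finite F"
  then obtain B where "kon B" "K.span B = K.span F" by (rule gram_schmidt)
  then show ?thesis using kon_hasdim[of B] by auto
qed

lemma KP_iff: "P \<in> KP n \<longleftrightarrow> (\<exists>B. kon B \<and> card B = n \<and> P = PS B)"
proof
  assume "P \<in> KP n"
  then have P: "kproj P" "hasdim (range P) n" by (auto simp: KP_def)
  then obtain B where B: "kon B" "card B = n" "K.span B = range P" using hasdim_kon by blast
  then have "P = PS B" using P by (intro kproj_eqI) (auto simp: PS_kproj range_PS)
  then show "\<exists>B. kon B \<and> card B = n \<and> P = PS B" using B by blast
next
  assume "\<exists>B. kon B \<and> card B = n \<and> P = PS B"
  then show "P \<in> KP n" by (auto simp: KP_def PS_kproj range_PS kon_hasdim)
qed

lemma kon_extend: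
  assumes A: "kon A" and B: "kon B" and le: "card A \<le> card B"
  obtains C where "kon C" "A \<subseteq> C" "card C = card B"
proof -
  have "\<exists>C. kon C \<and> A \<subseteq> C \<and> card C = card B"
    using A le
  proof (induction "card B - card A" arbitrary: A)
    case 0
    then show ?case by auto
  next
    case (Suc k)
    have "\<not> B \<subseteq> K.span A" using kon_card_le[OF B kon_finite[OF Suc.prems(1)]] Suc.hyps(2) by auto
    then obtain v where v: "v \<notin> K.span A" by blast
    obtain e where e: "norm e = 1" "\<And>b. b \<in> A \<Longrightarrow> ip e b = 0"
      "K.span (insert e A) = K.span (insert v A)" using kon_step[OF Suc.prems(1) v] by metis
    have i: "kon (insert e A)" "e \<notin> A" using kon_insert[OF Suc.prems(1) e(1,2)] by simp_all
    have c: "card (insert e A) = Suc (card A)" using i kon_finite[OF Suc.prems(1)] by simp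
    have "\<exists>C. kon C \<and> insert e A \<subseteq> C \<and> card C = card B"
      by (rule Suc.hyps(1)[OF _ i(1)]) (use c Suc.hyps(2) in linarith)+
    then show ?case by blast
  qed
  then show ?thesis using that by blast
qed

section \<open>Existence of orthogonal projections\<close>

lemma subspace_K: "K.subspace S \<Longrightarrow> subspace S"
  unfolding K.subspace_def subspace_def by (simp add: scaleR_K)

lemma re_minus: "re (- a) = - re a"
  using re_add[of a "- a"] by simp

text \<open>The passage from real to scalar-valued inner products: testing with the conjugate of
  \<open>z - w\<close> yields the squared modulus of \<open>z - w\<close>.\<close>

lemma re_mult_eqI: "(\<And>a. re (a * z) = re (a * w)) \<Longrightarrow> z = w"
proof -
  assume "\<And>a. re (a * z) = re (a * w)"
  then have "re (cj (z - w) * z) = re (cj (z - w) * w)" by blast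
  then have "re (cj (z - w) * (z - w)) = 0"
    using re_add[of "cj (z - w) * z" "- (cj (z - w) * w)"] by (simp add: right_diff_distrib re_minus)
  then have "re (of_real ((norm (z - w))\<^sup>2)) = 0" by (metis mult_cj mult.commute)
  then show ?thesis by (simp only: re_of_real) simp
qed

text \<open>S contains all scalar multiples of s, so real orthogonality to S controls the real part
  of every multiple of \<open>ip z s\<close>.\<close>

lemma ip_eq_0_if_inner:
  assumes "K.subspace S" "\<And>s. s \<in> S \<Longrightarrow> inner z s = 0" "s \<in> S"
  shows "ip z s = 0"
proof (rule re_mult_eqI)
  fix a
  have "cj a *\<^sub>K s \<in> S" using assms by (simp add: K.subspace_scale)
  then have "re (ip z (cj a *\<^sub>K s)) = 0" using assms(2) by (simp add: inner_ip)
  then show "re (a * ip z s) = re (a * 0)" by (simp add: ip_simps)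
qed

theorem projection_theorem:
  assumes cl: "closed S" and sub: "K.subspace S"
  obtains P where "kproj P" "range P = S"
proof -
  have ex: "\<exists>y\<in>S. \<forall>s\<in>S. ip (x - y) s = 0" for x
    using closed_subspace_nearest[OF cl subspace_K[OF sub], of x] ip_eq_0_if_inner[OF sub] by metis
  then obtain P where P: "\<And>x. P x \<in> S" "\<And>x s. s \<in> S \<Longrightarrow> ip (x - P x) s = 0" by metis
  have uniq: "P x = y" if "y \<in> S" "\<And>s. s \<in> S \<Longrightarrow> ip (x - y) s = 0" for x y
  proof -
    have d: "P x - y \<in> S" using P(1) that(1) K.subspace_diff[OF sub] by blast
    have "ip (P x - y) (P x - y) = ip (x - y) (P x - y) - ip (x - P x) (P x - y)"
      by (simp add: ip_diff_left)
    then have "ip (P x - y) (P x - y) = 0" using P(2)[OF d] that(2)[OF d] by simp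
    then show ?thesis by simp
  qed
  have fix_S: "P s = s" if "s \<in> S" for s using uniq[of s s] that by simp
  have o: "ip x s = ip (P x) s" if "s \<in> S" for x s using P(2)[OF that, of x] by (simp add: ip_diff_left)
  have "kproj P"
    unfolding kproj_def
  proof (intro conjI allI)
    fix x y a
    show "P (x + y) = P x + P y"
      using P(1) sub by (intro uniq) (auto simp: K.subspace_add ip_simps simp flip: o)
    show "P (a *\<^sub>K x) = a *\<^sub>K P x"
      using P(1) sub by (intro uniq) (auto simp: K.subspace_scale ip_simps simp flip: o)
    show "P (P x) = P x" using P(1) fix_S by blast
    have "ip (P x) y = ip (P x) (P y)" 
      using o[OF P(1), of y x] ip_commute[of "P x" y] ip_commute[of "P x" "P y"] by simp
    then show "ip (P x) y = ip x (P y)" using o[OF P(1), of x y] by simp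
  qed
  moreover have "range P = S" using P(1) fix_S by (metis image_subsetI rangeI subsetI subset_antisym)
  ultimately show ?thesis using that by blast
qed

text \<open>A is the projection onto the closed span of F. It is specified by its kernel, an
  intersection of kernels of continuous real functionals, so that no closure of a span has to be
  formed.\<close>

lemma projection_kernel:
  obtains A where "kproj A" "\<And>x. A x = 0 \<longleftrightarrow> (\<forall>s\<in>F. ip x s = 0)"
proof -
  let ?N = "{x. \<forall>s\<in>F. ip x s = 0}"
  have "?N = (\<Inter>s\<in>F. \<Inter>a. {x. inner x (a *\<^sub>K s) = 0})"
  proof (intro set_eqI iffI)
    fix x assume "x \<in> ?N"
    then show "x \<in> (\<Inter>s\<in>F. \<Inter>a. {x. inner x (a *\<^sub>K s) = 0})" by (auto simp: inner_ip ip_simps)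
  next
    fix x assume x: "x \<in> (\<Inter>s\<in>F. \<Inter>a. {x. inner x (a *\<^sub>K s) = 0})"
    have "ip x s = 0" if "s \<in> F" for s
    proof (rule re_mult_eqI)
      fix a
      have "inner x (cj a *\<^sub>K s) = 0" using x that by blast
      then show "re (a * ip x s) = re (a * 0)" by (simp add: inner_ip ip_simps)
    qed
    then show "x \<in> ?N" by simp
  qed
  moreover have "closed (\<Inter>s\<in>F. \<Inter>a. {x. inner x (a *\<^sub>K s) = 0})"
    by (intro closed_INT ballI closed_Collect_eq continuous_intros)
  ultimately have "closed ?N" by simp
  moreover have "K.subspace ?N" by (auto simp: K.subspace_def ip_simps)
  ultimately obtain P where P: "kproj P" "range P = ?N" by (rule projection_theorem)
  show ?thesis
  proof (rule that[OF kproj_compl[OF P(1)]])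
    fix x
    have "x - P x = 0 \<longleftrightarrow> x \<in> range P" using kproj_range[OF P(1), of x] by auto
    then show "x - P x = 0 \<longleftrightarrow> (\<forall>s\<in>F. ip x s = 0)" using P(2) by simp
  qed
qed

section \<open>Adjoints of isometries\<close>

text \<open>W is \<open>V^*\<close>, with the conjugated adjoint identity when V is
  conjugate-linear. In both cases \<open>inner (V x) y = inner x (W y)\<close>.\<close>

definition isoK :: "('a \<Rightarrow> 'a) \<Rightarrow> ('a \<Rightarrow> 'a) \<Rightarrow> bool" where
  "isoK V W \<longleftrightarrow> (\<forall>x y. V (x + y) = V x + V y) \<and> (\<forall>x. norm (V x) = norm x) \<and>
    ((\<forall>a x. V (a *\<^sub>K x) = a *\<^sub>K V x) \<and> (\<forall>x y. ip (V x) y = ip x (W y)) \<or>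
     (\<forall>a x. V (a *\<^sub>K x) = cj a *\<^sub>K V x) \<and> (\<forall>x y. ip (V x) y = cj (ip x (W y))))"

lemma isometry_real_linear:
  assumes "\<And>x y. V (x + y) = V x + V y"
    "(\<forall>a x. V (a *\<^sub>K x) = a *\<^sub>K V x) \<or> (\<forall>a x. V (a *\<^sub>K x) = cj a *\<^sub>K V x)"
  shows "linear V"
  using assms by (intro linearI) (auto simp: scaleR_K)

text \<open>An isometry has complete, hence closed range; W projects onto that range and then
  inverts V.\<close>

lemma isometry_adjoint:
  assumes add: "\<And>x y. V (x + y) = V x + V y"
    and sc: "(\<forall>a x. V (a *\<^sub>K x) = a *\<^sub>K V x) \<or> (\<forall>a x. V (a *\<^sub>K x) = cj a *\<^sub>K V x)"
    and nV: "\<And>x. norm (V x) = norm x"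
  obtains W where "isoK V W"
proof -
  have lin: "linear V" using isometry_real_linear add sc by blast
  have iV: "inner (V x) (V y) = inner x y" for x y by (rule isometry_inner[OF lin nV])
  have bl: "bounded_linear V"
    using lin nV by (intro bounded_linear_intro[of V 1]) (auto simp: linear_add linear_scale)
  have "complete (V ` UNIV)"
    using complete_isometric_image[of 1 UNIV V] bl nV complete_UNIV by simp
  then have cl: "closed (range V)" by (rule complete_imp_closed)
  have z: "V 0 = 0" using lin by (rule linear_0)
  have "K.subspace (range V)"
    unfolding K.subspace_def
  proof (intro conjI ballI allI)
    show "0 \<in> range V" using z by (metis rangeI)
    fix x y assume "x \<in> range V" "y \<in> range V"
    then obtain u v where "x = V u" "y = V v" by blast
    then have "x + y = V (u + v)" using add by simp
    then show "x + y \<in> range V" by simp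
  next
    fix c x assume "x \<in> range V"
    then obtain u where "x = V u" by blast
    then have "c *\<^sub>K x = V (c *\<^sub>K u) \<or> c *\<^sub>K x = V (cj c *\<^sub>K u)" using sc by auto
    then show "c *\<^sub>K x \<in> range V" by auto
  qed
  then obtain P where P: "kproj P" "range P = range V" using projection_theorem[OF cl] by blast
  then have "\<forall>y. \<exists>w. V w = P y" by (metis rangeE rangeI)
  then obtain W where W: "\<And>y. V (W y) = P y" by metis
  have PV: "P (V x) = V x" for x using P kproj_range by (metis rangeI)
  have VP: "ip (V x) y = ip (V x) (V (W y))" for x y
    using kproj_sa[OF P(1), of "V x" y] PV W by simp
  from sc have "isoK V W"
  proof
    assume l: "\<forall>a x. V (a *\<^sub>K x) = a *\<^sub>K V x"
    have "ip (V x) (V y) = ip x y" for x y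
    proof (rule re_mult_eqI)
      fix a show "re (a * ip (V x) (V y)) = re (a * ip x y)"
        using iV[of "a *\<^sub>K x" y] l by (simp add: inner_ip ip_simps)
    qed
    then show ?thesis unfolding isoK_def using add nV l VP by simp
  next
    assume l: "\<forall>a x. V (a *\<^sub>K x) = cj a *\<^sub>K V x"
    have "ip (V x) (V y) = cj (ip x y)" for x y
    proof (rule re_mult_eqI)
      fix a
      have "re (a * ip (V x) (V y)) = re (cj (a * cj (ip x y)))"
        using iV[of "cj a *\<^sub>K x" y] l by (simp add: inner_ip ip_simps cj_mult)
      then show "re (a * ip (V x) (V y)) = re (a * cj (ip x y))" by simp
    qed
    then show ?thesis unfolding isoK_def using add nV l VP by simp
  qed
  then show ?thesis using that by blast
qed

text \<open>The rule that \<open>V p V^*\<close> projects onto the line of \<open>V e\<close> when p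
  projects onto that of e. In the conjugate-linear case the conjugation in the adjoint cancels
  against that in V.\<close>

lemma isoK_rk1:
  assumes "isoK V W"
  shows "V (rk1 e (W x)) = rk1 (V e) x"
proof -
  consider "\<forall>a x. V (a *\<^sub>K x) = a *\<^sub>K V x" "\<forall>x y. ip (V x) y = ip x (W y)" |
    "\<forall>a x. V (a *\<^sub>K x) = cj a *\<^sub>K V x" "\<forall>x y. ip (V x) y = cj (ip x (W y))"
    using assms unfolding isoK_def by blast
  then show ?thesis
  proof cases
    case 1
    have "ip x (V e) = cj (ip (V e) x)" by (rule ip_commute)
    also have "\<dots> = cj (ip e (W x))" using 1(2) by simp
    also have "\<dots> = ip (W x) e" by (rule ip_commute[symmetric])
    finally have "ip x (V e) = ip (W x) e" .
    then show ?thesis using 1 by (simp add: rk1_def)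
  next
    case 2
    have "ip x (V e) = cj (ip (V e) x)" by (rule ip_commute)
    also have "\<dots> = cj (cj (ip e (W x)))" using 2(2) by simp
    also have "\<dots> = cj (ip (W x) e)" by (subst ip_commute[of "W x" e]) simp
    finally have "ip x (V e) = cj (ip (W x) e)" .
    then show ?thesis using 2 by (simp add: rk1_def)
  qed
qed

end

section \<open>Finite rank\<close>

text \<open>Cliques of a Johnson graph are stars around a common m-set or tops inside an (m+2)-set.
  If some \<open>S k\<close> misses a point c common to \<open>S i0\<close> and \<open>S i1\<close>,
  then \<open>S k\<close> is their union N without c. A member not contained in N would have all its
  points but one in the intersection without c, which has only \<open>m - 1\<close> points.\<close>

lemma johnson_clique:
  fixes S :: "'i \<Rightarrow> 'b set"
  assumes fin: "\<And>i. i \<in> I \<Longrightarrow> finite (S i)" and card: "\<And>i. i \<in> I \<Longrightarrow> card (S i) = Suc m"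
    and int: "\<And>i j. i \<in> I \<Longrightarrow> j \<in> I \<Longrightarrow> i \<noteq> j \<Longrightarrow> card (S i \<inter> S j) = m"
    and i0: "i0 \<in> I" and i1: "i1 \<in> I" and ne: "i0 \<noteq> i1"
  shows "(\<exists>M. finite M \<and> card M = m \<and> (\<forall>i\<in>I. M \<subseteq> S i)) \<or>
    (\<exists>N. finite N \<and> card N = Suc (Suc m) \<and> (\<forall>i\<in>I. S i \<subseteq> N))"
proof (cases "\<forall>i\<in>I. S i0 \<inter> S i1 \<subseteq> S i")
  case True
  then show ?thesis using fin[OF i0] int[OF i0 i1 ne] by (intro disjI1 exI[of _ "S i0 \<inter> S i1"]) auto
next
  case False
  then obtain k c where k: "k \<in> I" and c: "c \<in> S i0" "c \<in> S i1" "c \<notin> S k" by blast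
  let ?N = "S i0 \<union> S i1"
  have k01: "k \<noteq> i0" "k \<noteq> i1" using c by auto
  have N: "card ?N = Suc (Suc m)"
    using card_Un_Int[OF fin[OF i0] fin[OF i1]] card i0 i1 int[OF i0 i1 ne] by simp
  have sub: "S i - {x} = S i \<inter> S j" if "i \<in> I" "j \<in> I" "i \<noteq> j" "x \<in> S i" "x \<notin> S j" for i j x
  proof (rule card_subset_eq[symmetric])
    show "finite (S i - {x})" using fin that by simp
    show "S i \<inter> S j \<subseteq> S i - {x}" using that by auto
    show "card (S i \<inter> S j) = card (S i - {x})" using that fin card int by simp
  qed
  have kk: "S i0 - {c} = S i0 \<inter> S k" "S i1 - {c} = S i1 \<inter> S k"
    using sub[of i0 k c] sub[of i1 k c] i0 i1 k c k01 by auto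
  have "?N - {c} = S k"
  proof (rule card_subset_eq)
    show "finite (S k)" using fin k by simp
    show "?N - {c} \<subseteq> S k" using kk by blast
    show "card (?N - {c}) = card (S k)" using N c card[OF k] fin i0 i1 by simp
  qed
  have "S l \<subseteq> ?N" if l: "l \<in> I" for l
  proof (rule ccontr)
    assume "\<not> S l \<subseteq> ?N"
    then obtain x where x: "x \<in> S l" "x \<notin> ?N" by blast
    then have xk: "x \<notin> S k" using \<open>?N - {c} = S k\<close> by blast
    have l01: "l \<noteq> i0" "l \<noteq> i1" "l \<noteq> k" using x xk by auto
    have "S l - {x} = S l \<inter> S i0" "S l - {x} = S l \<inter> S i1" "S l - {x} = S l \<inter> S k"
      using sub[of l i0 x] sub[of l i1 x] sub[of l k x] l i0 i1 k l01 x xk by auto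
    then have s: "S l - {x} \<subseteq> (S i0 \<inter> S i1) - {c}" using c by blast
    have "card (S l - {x}) \<le> card ((S i0 \<inter> S i1) - {c})"
      using fin[OF i0] s by (intro card_mono) auto
    also have "\<dots> < card (S i0 \<inter> S i1)" using c fin[OF i0] by (intro card_Diff1_less) auto
    also have "\<dots> = m" using int i0 i1 ne by simp
    finally show False using x card[OF l] fin[OF l] by simp
  qed
  then show ?thesis using N fin i0 i1 by (intro disjI2 exI[of _ ?N]) auto
qed

context kspace
begin

lemma finrank_rk1:
  assumes f: "norm f = 1"
  obtains D where "onset D" "span D = range (rk1 f)"
proof -
  obtain F :: "'k set" where F: "finite F" "span F = UNIV" using scalars_finite_dim by blast
  let ?L = "\<lambda>a. a *\<^sub>K f"
  have lin: "linear ?L"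
    by (rule linearI) (simp_all add: scale_add_left scaleR_K scale_scale scaleR_conv_of_real)
  have "range (rk1 f) = range ?L"
  proof (intro subset_antisym subsetI)
    fix x assume "x \<in> range ?L"
    then obtain a where "x = a *\<^sub>K f" by blast
    then have "x = rk1 f x" using f by (simp add: rk1_def ip_simps ip_self_unit)
    then show "x \<in> range (rk1 f)" by (metis rangeI)
  qed (auto simp: rk1_def)
  also have "\<dots> = span (?L ` F)" using linear_span_image[OF lin, of F] F by simp
  finally have "range (rk1 f) = span (?L ` F)" .
  moreover obtain D where "onset D" "span D = span (?L ` F)" using onset_exists[of "?L ` F"] F by auto
  ultimately show ?thesis using that by auto
qed

text \<open>A real orthonormal basis of the scalar line of f consists of unimodular multiples of f,
  and each contributes the same transition probability. So m is the real dimension of that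
  line.\<close>

lemma hs_rk1_ex:
  assumes f: "norm f = 1"
  shows "\<exists>m>0. \<forall>e. norm e = 1 \<longrightarrow> hs (rk1 f) (rk1 e) = m * (norm (ip f e))\<^sup>2"
proof -
  obtain D where D: "onset D" "span D = range (rk1 f)" using finrank_rk1[OF f] .
  have "D \<noteq> {}"
  proof
    assume "D = {}"
    then have "range (rk1 f) = {0}" using D(2) by simp
    moreover have "f \<in> range (rk1 f)" using rk1_self[OF f] by (metis rangeI)
    ultimately show False using f by simp
  qed
  then have "card D > 0" using D by (simp add: onset_def card_gt_0_iff)
  moreover have "hs (rk1 f) (rk1 e) = real (card D) * (norm (ip f e))\<^sup>2" if e: "norm e = 1" for e
  proof -
    have "hs (rk1 f) (rk1 e) = (\<Sum>b\<in>D. inner (rk1 f b) (rk1 e b))"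
      using D rk1_kproj e f by (intro hs_eq kproj_selfadj) auto
    also have "\<dots> = (\<Sum>b\<in>D. (norm (ip f e))\<^sup>2)"
    proof (rule sum.cong[OF refl])
      fix b assume b: "b \<in> D"
      have "b \<in> range (rk1 f)" using D b span_base by blast
      then have fb: "rk1 f b = b" using kproj_range[OF rk1_kproj[OF f]] by simp
      have "norm b = 1" using D(1) b by (simp add: onset_def norm_eq_1)
      moreover have bf: "b = ip b f *\<^sub>K f" using fb by (simp add: rk1_def)
      then have "norm b = norm (ip b f) * norm f" by (metis norm_scale)
      ultimately have nb: "norm (ip b f) = 1" using f by simp
      have "ip b e = ip b f * ip f e" using bf ip_scale_left[of "ip b f" f e] by simp
      then have "norm (ip b e) = norm (ip f e)" using nb by (simp add: norm_mult)
      moreover have "inner (rk1 f b) (rk1 e b) = (norm (ip b e))\<^sup>2"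
        unfolding fb by (simp add: rk1_def inner_ip ip_scale_right)
          (metis mult.commute mult_cj of_real_power re_of_real)
      ultimately show "inner (rk1 f b) (rk1 e b) = (norm (ip f e))\<^sup>2" by simp
    qed
    finally show ?thesis by simp
  qed
  ultimately show ?thesis by (intro exI[of _ "real (card D)"]) auto
qed

text \<open>Rank-one projections and, with \<open>FP\<close>, projections onto spans as vectors of
  \<open>fsop\<close>, where their real linear combinations live.\<close>

definition R :: "'a \<Rightarrow> 'a fsop" where "R e = Fsop (rk1 e)"

definition FP :: "'a set \<Rightarrow> 'a fsop" where "FP B = (\<Sum>b\<in>B. R b)"

lemma opr_R: "norm e = 1 \<Longrightarrow> opr (R e) = rk1 e"
  unfolding R_def
proof (rule Fsop_inverse, clarify)
  assume e: "norm e = 1"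
  obtain D where D: "onset D" "span D = range (rk1 e)" using finrank_rk1[OF e] .
  then show "selfadj (rk1 e) \<and> finrank (rk1 e)"
    using kproj_selfadj[OF rk1_kproj[OF e]] by (auto simp: finrank_def onset_def)
qed

lemma opr_FP: "kon B \<Longrightarrow> opr (FP B) = PS B"
  by (rule ext) (simp add: FP_def opr_sum PS_rk1 opr_R kon_norm)

lemma finrank_PS: "kon B \<Longrightarrow> finrank (PS B)"
  by (metis opr_FP opr_finrank)

lemma Fsop_PS: "kon B \<Longrightarrow> Fsop (PS B) = FP B"
  by (metis opr_FP opr_inverse)

text \<open>The Hilbert--Schmidt form is that of the underlying real space, so it exceeds the one over the
  scalars by the factor \<open>kd\<close>, the real dimension of the scalar field.\<close>

definition kd :: real where
  "kd = (SOME m. m > 0 \<and> (\<forall>e f. norm e = 1 \<longrightarrow> norm f = 1 \<longrightarrow> inner (R e) (R f) = m * (norm (ip e f))\<^sup>2))"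

text \<open>Symmetry of the trace form makes the constants from \<open>hs_rk1_ex\<close> agree for
  non-orthogonal e and f; orthogonal ones are both compared with the normalised sum g.\<close>

lemma kd: "kd > 0 \<and> (\<forall>e f. norm e = 1 \<longrightarrow> norm f = 1 \<longrightarrow> inner (R e) (R f) = kd * (norm (ip e f))\<^sup>2)"
  unfolding kd_def
proof (rule someI_ex)
  obtain \<mu> where \<mu>: "\<And>f. norm f = 1 \<Longrightarrow> \<mu> f > 0"
    "\<And>f e. norm f = 1 \<Longrightarrow> norm e = 1 \<Longrightarrow> inner (R f) (R e) = \<mu> f * (norm (ip f e))\<^sup>2"
    using hs_rk1_ex by (simp add: inner_fsop_def opr_R) metis
  have eq1: "\<mu> e = \<mu> f" if "norm e = 1" "norm f = 1" "ip e f \<noteq> 0" for e f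
  proof -
    have "\<mu> e * (norm (ip e f))\<^sup>2 = \<mu> f * (norm (ip f e))\<^sup>2"
      using \<mu>(2)[OF that(1,2)] \<mu>(2)[OF that(2,1)] by (simp add: inner_commute)
    then show ?thesis using that(3) by (simp add: norm_ip_commute[of f e])
  qed
  have eq: "\<mu> e = \<mu> f" if e: "norm e = 1" and f: "norm f = 1" for e f
  proof (cases "ip e f = 0")
    case True
    define g where "g = (1 / norm (e + f)) *\<^sub>R (e + f)"
    have fe: "ip f e = 0" using True ip_eq_0_commute by blast
    have ie: "ip (e + f) e = 1" "ip (e + f) f = 1"
      using True fe e f by (simp_all add: ip_simps ip_self_unit)
    then have nz: "e + f \<noteq> 0" by auto
    then have "norm g = 1" by (simp add: g_def)
    moreover have "ip g e \<noteq> 0" "ip g f \<noteq> 0"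
      using nz ie by (simp_all add: g_def scaleR_K ip_scale_left)
    ultimately show ?thesis using eq1[of g e] eq1[of g f] e f by simp
  qed (use eq1 that in blast)
  show "\<exists>m>0. \<forall>e f. norm e = 1 \<longrightarrow> norm f = 1 \<longrightarrow> inner (R e) (R f) = m * (norm (ip e f))\<^sup>2"
  proof (cases "\<exists>e::'a. norm e = 1")
    case True
    then obtain e0 :: 'a where "norm e0 = 1" by blast
    then show ?thesis using \<mu> eq by (intro exI[of _ "\<mu> e0"]) metis
  next
    case False
    then show ?thesis by (intro exI[of _ 1]) auto
  qed
qed

lemma kd_pos: "kd > 0"
  and inner_R: "norm e = 1 \<Longrightarrow> norm f = 1 \<Longrightarrow> inner (R e) (R f) = kd * (norm (ip e f))\<^sup>2"
  using kd by auto

lemma inner_FP_R: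
  assumes B: "kon B" and g: "norm g = 1" "PS B g = g"
  shows "inner (FP B) (R g) = kd"
proof -
  have "inner (FP B) (R g) = kd * (\<Sum>b\<in>B. (norm (ip b g))\<^sup>2)"
    by (simp add: FP_def inner_sum_left inner_R kon_norm[OF B] g sum_distrib_left)
  also have "of_real (\<Sum>b\<in>B. (norm (ip b g))\<^sup>2) = ip (PS B g) g"
    unfolding PS_def ip_sum_left of_real_sum
  proof (rule sum.cong[OF refl])
    fix b
    have "ip (ip g b *\<^sub>K b) g = ip b g * cj (ip b g)"
      by (simp add: ip_scale_left flip: ip_commute[of g b] )
    then show "of_real ((norm (ip b g))\<^sup>2) = ip (ip g b *\<^sub>K b) g" by (simp only: mult_cj)
  qed
  then have "of_real (\<Sum>b\<in>B. (norm (ip b g))\<^sup>2) = (of_real 1 :: 'k)" using g by (simp add: ip_self_unit)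
  then have "(\<Sum>b\<in>B. (norm (ip b g))\<^sup>2) = 1" by (simp only: of_real_eq_iff)
  finally show ?thesis by simp
qed

text \<open>The dictionary between traces and combinatorics: for projections diagonal in one
  orthonormal set, inner products count common basis vectors.\<close>

lemma inner_FP:
  assumes B: "kon B" "X \<subseteq> B" "Y \<subseteq> B"
  shows "inner (FP X) (FP Y) = kd * real (card (X \<inter> Y))"
proof -
  have fin: "finite X" "finite Y" using B kon_finite finite_subset by blast+
  have "inner (FP X) (FP Y) = (\<Sum>x\<in>X. \<Sum>y\<in>Y. kd * (norm (ip x y))\<^sup>2)"
  proof -
    have "inner (R x) (FP Y) = (\<Sum>y\<in>Y. kd * (norm (ip x y))\<^sup>2)" if "x \<in> X" for x
      unfolding FP_def inner_sum_right
      using B that by (intro sum.cong refl inner_R kon_norm[OF B(1)]) auto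
    then show ?thesis unfolding FP_def[of X] inner_sum_left by (rule sum.cong[OF refl])
  qed
  also have "\<dots> = (\<Sum>x\<in>X. \<Sum>y\<in>Y. if x = y then kd else 0)"
    using B kon_ip[OF B(1)] by (intro sum.cong refl) (auto simp: subset_iff)
  also have "\<dots> = (\<Sum>x\<in>X. if x \<in> Y then kd else 0)" using fin by (simp add: sum.delta)
  also have "\<dots> = kd * real (card (X \<inter> Y))"
    using fin by (simp add: sum.If_cases Int_def)
  finally show ?thesis .
qed

text \<open>Commutation becomes idempotence of \<open>Q P Q\<close>, which is visible up to unitary
  equivalence. Idempotence gives \<open>P Q x\<close> and \<open>Q P Q x\<close> equal norms, so
  \<open>P Q x\<close> lies in the range of Q by Pythagoras; then \<open>P Q = Q P Q\<close> is
  self-adjoint.\<close>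

lemma kproj_comm_iff:
  assumes P: "kproj P" and Q: "kproj Q" and idem: "\<And>x. Q (P (Q (Q (P (Q x))))) = Q (P (Q x))"
  shows "P (Q x) = Q (P x)"
proof -
  have PQ: "P (Q x) = Q (P (Q x))" for x
  proof -
    let ?y = "P (Q x)"
    have "of_real ((norm ?y)\<^sup>2) = ip x (Q (P (Q x)))"
      by (simp only: ip_self[symmetric] kproj_sa[OF P] kproj_sa[OF Q] kproj_idem[OF P])
    also have "\<dots> = ip x (Q (P (Q (Q (P (Q x))))))" by (simp only: idem)
    also have "\<dots> = ip (Q ?y) (Q ?y)" by (simp only: kproj_sa[OF P] kproj_sa[OF Q])
    also have "\<dots> = of_real ((norm (Q ?y))\<^sup>2)" by (simp only: ip_self)
    finally have "(norm ?y)\<^sup>2 = (norm (Q ?y))\<^sup>2" by (simp only: of_real_eq_iff)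
    then show ?thesis using kproj_pythagoras[OF Q, of ?y] by simp
  qed
  show ?thesis
  proof (rule ip_ext)
    fix z
    have "ip (P (Q x)) z = ip (Q (P (Q x))) z" by (subst PQ) simp
    also have "\<dots> = ip x (Q (P (Q z)))" by (simp only: kproj_sa[OF P] kproj_sa[OF Q])
    also have "\<dots> = ip x (P (Q z))" by (subst (2) PQ) simp
    also have "\<dots> = ip (Q (P x)) z" by (simp only: kproj_sa[OF P] kproj_sa[OF Q])
    finally show "ip (P (Q x)) z = ip (Q (P x)) z" .
  qed
qed

section \<open>What equality of principal angles preserves\<close>

lemma kunitary_inj: "kunitary U \<Longrightarrow> U x = U y \<Longrightarrow> x = y"
proof -
  assume U: "kunitary U" "U x = U y"
  have "x - y = x + (-1) *\<^sub>K y" by simp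
  then have "U (x - y) = U x + (-1) *\<^sub>K U y" using U(1) unfolding kunitary_def by metis
  also have "\<dots> = 0" using U(2) by simp
  finally have "norm (x - y) = 0" using U(1) unfolding kunitary_def by (metis norm_zero)
  then show ?thesis by simp
qed

lemma kangle_commute:
  assumes P: "kproj P" and Q: "kproj Q" and P': "kproj P'" and Q': "kproj Q'"
    and ang: "kangle_eq P' Q' P Q" and comm: "\<And>x. P (Q x) = Q (P x)"
  shows "P' (Q' x) = Q' (P' x)"
proof (rule kproj_comm_iff[OF P' Q'])
  fix x
  obtain U where U: "kunitary U" "U \<circ> (Q' \<circ> P' \<circ> Q') = (Q \<circ> P \<circ> Q) \<circ> U"
    using ang by (auto simp: kangle_eq_def)
  have e: "U (Q' (P' (Q' y))) = Q (P (Q (U y)))" for y using U(2) by (metis comp_apply)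
  have "U (Q' (P' (Q' (Q' (P' (Q' x)))))) = U (Q' (P' (Q' x)))"
    by (simp only: e comm kproj_idem[OF P] kproj_idem[OF Q])
  then show "Q' (P' (Q' (Q' (P' (Q' x))))) = Q' (P' (Q' x))" using kunitary_inj[OF U(1)] by blast
qed

lemma kangle_hs:
  assumes P: "P \<in> KP n" and Q: "Q \<in> KP n" and P': "P' \<in> KP n" and Q': "Q' \<in> KP n"
    and ang: "kangle_eq P' Q' P Q"
  shows "hs P' Q' = hs P Q"
proof -
  obtain U where U: "kunitary U" "U \<circ> (Q' \<circ> P' \<circ> Q') = (Q \<circ> P \<circ> Q) \<circ> U"
    using ang by (auto simp: kangle_eq_def)
  have U': "linear U" "surj U" "\<And>x. norm (U x) = norm x"
    using U(1) by (auto simp: kunitary_def intro!: real_linearI)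
  have kp: "kproj X \<and> finrank X" if "X \<in> KP n" for X
    using that KP_iff[of X n] finrank_PS PS_kproj by auto
  have sa: "selfadj (Y \<circ> X \<circ> Y)" if "kproj X" "kproj Y" for X Y
  proof -
    have "linear (Y \<circ> X \<circ> Y)" by (intro linear_compose kproj_linear that)
    then show ?thesis using that by (simp add: selfadj_def inner_ip kproj_sa)
  qed
  have fr: "finrank (Q' \<circ> P' \<circ> Q')"
    using kp[OF Q'] unfolding finrank_def by fastforce
  have "hs P' Q' = hs (Q' \<circ> P' \<circ> Q') id"
    using kp[OF P'] kp[OF Q'] kproj_idem by (intro hs_compress kproj_selfadj) auto
  also have "\<dots> = hs (Q \<circ> P \<circ> Q) id"
    using U' U(2) fr sa kp[OF P] kp[OF Q] kp[OF P'] kp[OF Q'] by (intro hs_unitary[of U]) auto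
  also have "\<dots> = hs P Q"
    using kp[OF P] kp[OF Q] kproj_idem by (intro hs_compress[symmetric] kproj_selfadj) auto
  finally show ?thesis .
qed

text \<open>P is unchanged by first applying \<open>PS A\<close>, so its range is spanned by the
  images of the finitely many vectors in A.\<close>

lemma kle_PS_finite:
  assumes P: "kproj P" and A: "kon A" and le: "kle P (PS A)"
  obtains B where "kon B" "P = PS B"
proof -
  have "range P = K.span (P ` A)"
  proof (intro subset_antisym)
    show "K.span (P ` A) \<subseteq> range P"
      by (rule K.span_minimal) (auto intro: kproj_subspace[OF P])
    show "range P \<subseteq> K.span (P ` A)"
    proof
      fix y assume "y \<in> range P"
      then obtain x where "y = P x" by blast
      then have "y = P (PS A x)" using kle_left[OF P PS_kproj[OF A] le] by simp
      also have "\<dots> = (\<Sum>a\<in>A. ip x a *\<^sub>K P a)"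
      proof -
        have "P (\<Sum>a\<in>F. ip x a *\<^sub>K a) = (\<Sum>a\<in>F. ip x a *\<^sub>K P a)" for F
          by (induction F rule: infinite_finite_induct)
            (auto simp: kproj_zero[OF P] kproj_add[OF P] kproj_scale[OF P])
        then show ?thesis by (simp add: PS_def)
      qed
      also have "\<dots> \<in> K.span (P ` A)" by (intro K.span_sum K.span_scale K.span_base) auto
      finally show "y \<in> K.span (P ` A)" .
    qed
  qed
  moreover obtain d where "hasdim (K.span (P ` A)) d" using hasdim_span[of "P ` A"] kon_finite[OF A] by auto
  ultimately have "P \<in> KP d" using P by (simp add: KP_def)
  then show ?thesis using that KP_iff by blast
qed

section \<open>Diagonalising commuting projections of finite rank\<close>

lemma kon_Un:
  assumes "kon A" "kon B" "\<And>a b. a \<in> A \<Longrightarrow> b \<in> B \<Longrightarrow> ip a b = 0"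
  shows "kon (A \<union> B)" "A \<inter> B = {}"
proof -
  show d: "A \<inter> B = {}"
  proof (rule ccontr)
    assume "A \<inter> B \<noteq> {}"
    then obtain x where "x \<in> A" "x \<in> B" by blast
    then have "ip x x = 0" using assms(3) by blast
    then show False using kon_norm[OF assms(1) \<open>x \<in> A\<close>] by simp
  qed
  have "ip b a = 0" if "a \<in> A" "b \<in> B" for a b using assms(3)[OF that] ip_eq_0_commute by blast
  then show "kon (A \<union> B)" using assms d unfolding kon_def by (auto simp: disjoint_iff)
qed

lemma PS_Un: "finite A \<Longrightarrow> finite B \<Longrightarrow> A \<inter> B = {} \<Longrightarrow> PS (A \<union> B) x = PS A x + PS B x"
  by (simp add: PS_def sum.union_disjoint)

text \<open>With \<open>E = PS A\<close>, the first projection Q splits E into \<open>Q E\<close>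
  and \<open>E - Q E\<close>. Both parts commute with the remaining projections, so the bases that
  the induction yields for the two parts can be joined.\<close>

lemma simultaneous_diagonalisation:
  assumes "\<forall>Q\<in>set Qs. kproj Q" "\<forall>P\<in>set Qs. \<forall>Q\<in>set Qs. \<forall>x. P (Q x) = Q (P x)"
    and "kon A" "\<forall>Q\<in>set Qs. \<forall>x. Q (PS A x) = PS A (Q x)"
  shows "\<exists>B. kon B \<and> PS B = PS A \<and> (\<forall>Q\<in>set Qs. \<forall>b\<in>B. Q b = b \<or> Q b = 0)"
  using assms
proof (induction Qs arbitrary: A)
  case Nil
  then show ?case by auto
next
  case (Cons Q Qs)
  have Q: "kproj Q" using Cons.prems by simp
  have E: "kproj (PS A)" using Cons.prems PS_kproj by blast
  have QE: "Q (PS A x) = PS A (Q x)" for x using Cons.prems by simp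
  have k1: "kproj (\<lambda>x. Q (PS A x))" by (rule kproj_comp[OF Q E QE])
  have l1: "kle (\<lambda>x. Q (PS A x)) (PS A)" by (simp add: kle_def QE kproj_idem[OF E])
  have k2: "kproj (\<lambda>x. PS A x - Q (PS A x))" by (rule kproj_kle_diff[OF k1 E l1])
  have l2: "kle (\<lambda>x. PS A x - Q (PS A x)) (PS A)"
    by (simp add: kle_def QE kproj_idem[OF E] kproj_diff[OF E])
  obtain A1 where A1: "kon A1" "(\<lambda>x. Q (PS A x)) = PS A1"
    using kle_PS_finite[OF k1 _ l1] Cons.prems(3) by metis
  obtain A2 where A2: "kon A2" "(\<lambda>x. PS A x - Q (PS A x)) = PS A2"
    using kle_PS_finite[OF k2 _ l2] Cons.prems(3) by metis
  have cm: "T (PS A1 x) = PS A1 (T x)" "T (PS A2 x) = PS A2 (T x)" if "T \<in> set Qs" for T x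
  proof -
    have t: "kproj T" "\<And>x. T (Q x) = Q (T x)" "\<And>x. T (PS A x) = PS A (T x)"
      using that Cons.prems by auto
    show "T (PS A1 x) = PS A1 (T x)" "T (PS A2 x) = PS A2 (T x)"
      unfolding A1(2)[symmetric] A2(2)[symmetric] by (simp_all add: kproj_diff[OF t(1)] t)
  qed
  obtain B1 where B1: "kon B1" "PS B1 = PS A1" "\<forall>Q\<in>set Qs. \<forall>b\<in>B1. Q b = b \<or> Q b = 0"
    using Cons.IH[of A1] Cons.prems A1(1) cm by auto
  obtain B2 where B2: "kon B2" "PS B2 = PS A2" "\<forall>Q\<in>set Qs. \<forall>b\<in>B2. Q b = b \<or> Q b = 0"
    using Cons.IH[of A2] Cons.prems A2(1) cm by auto
  have q1: "Q b = b" if "b \<in> B1" for b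
  proof -
    have "b = Q (PS A b)" using PS_base[OF B1(1) that] B1(2) A1(2) by metis
    then show ?thesis by (metis kproj_idem[OF Q])
  qed
  have q2: "Q b = 0" if "b \<in> B2" for b
  proof -
    have "b = PS A b - Q (PS A b)" using PS_base[OF B2(1) that] B2(2) A2(2) by metis
    then show ?thesis by (metis kproj_idem[OF Q] kproj_diff[OF Q] diff_self)
  qed
  have o: "ip a b = 0" if "a \<in> B1" "b \<in> B2" for a b
    using kproj_sa[OF Q, of a b] q1[OF that(1)] q2[OF that(2)] by simp
  note U = kon_Un[OF B1(1) B2(1) o]
  have "PS (B1 \<union> B2) x = PS A x" for x
  proof -
    have "PS (B1 \<union> B2) x = PS A1 x + PS A2 x"
      using PS_Un[OF kon_finite[OF B1(1)] kon_finite[OF B2(1)] U(2)] B1 B2 by simp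
    also have "\<dots> = PS A x" unfolding A1(2)[symmetric] A2(2)[symmetric] by simp
    finally show ?thesis .
  qed
  moreover have "\<forall>T\<in>set (Q # Qs). \<forall>b\<in>B1 \<union> B2. T b = b \<or> T b = 0"
    using q1 q2 B1(3) B2(3) by auto
  ultimately show ?case using U(1) by blast
qed

lemma PS_diagonal:
  assumes B: "kon B" and Q: "kproj Q" and le: "\<And>x. Q (PS B x) = Q x" and d: "\<forall>b\<in>B. Q b = b \<or> Q b = 0"
  shows "Q = PS {b\<in>B. Q b = b}"
proof
  fix x
  have "Q x = Q (PS B x)" using le by simp
  also have "\<dots> = (\<Sum>b\<in>B. ip x b *\<^sub>K Q b)"
  proof -
    have "Q (\<Sum>b\<in>F. ip x b *\<^sub>K b) = (\<Sum>b\<in>F. ip x b *\<^sub>K Q b)" for F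
      by (induction F rule: infinite_finite_induct)
        (auto simp: kproj_zero[OF Q] kproj_add[OF Q] kproj_scale[OF Q])
    then show ?thesis by (simp add: PS_def)
  qed
  also have "\<dots> = (\<Sum>b\<in>B. if Q b = b then ip x b *\<^sub>K b else 0)"
    using d by (intro sum.cong) auto
  also have "\<dots> = PS {b\<in>B. Q b = b} x"
    using kon_finite[OF B] by (simp add: PS_def sum.inter_filter)
  finally show "Q x = PS {b\<in>B. Q b = b} x" .
qed

lemma FP_insert: "finite B \<Longrightarrow> e \<notin> B \<Longrightarrow> FP (insert e B) = R e + FP B"
  by (simp add: FP_def)

lemma FP_remove: "finite B \<Longrightarrow> e \<in> B \<Longrightarrow> FP (B - {e}) = FP B - R e"
  by (simp add: FP_def sum_diff1)

lemma R_phase: "norm c = 1 \<Longrightarrow> R (c *\<^sub>K e) = R e"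
  by (simp add: R_def rk1_phase)

lemma PS_comp:
  assumes C: "kon C" and AB: "A \<subseteq> C" "B \<subseteq> C"
  shows "PS A (PS B x) = PS (A \<inter> B) x"
proof -
  have fin: "finite A" "finite B" using AB kon_finite[OF C] finite_subset by auto
  have "PS A (PS B x) = (\<Sum>a\<in>A. (\<Sum>b\<in>B. ip x b * ip b a) *\<^sub>K a)"
    by (simp add: PS_def ip_sum_left ip_scale_left)
  also have "\<dots> = (\<Sum>a\<in>A. (if a \<in> B then ip x a *\<^sub>K a else 0))"
  proof (rule sum.cong[OF refl])
    fix a assume a: "a \<in> A"
    have "ip x b * ip b a = (if b = a then ip x a else 0)" if "b \<in> B" for b
    proof -
      have "b \<in> C" "a \<in> C" using that a AB by auto
      then show ?thesis using kon_ip[OF C, of b a] by simp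
    qed
    then have "(\<Sum>b\<in>B. ip x b * ip b a) = (\<Sum>b\<in>B. if b = a then ip x a else 0)"
      by (rule sum.cong[OF refl])
    also have "\<dots> = (if a \<in> B then ip x a else 0)" using fin by simp
    finally show "(\<Sum>b\<in>B. ip x b * ip b a) *\<^sub>K a = (if a \<in> B then ip x a *\<^sub>K a else 0)" by simp
  qed
  also have "\<dots> = PS (A \<inter> B) x" using fin by (simp add: PS_def sum.inter_restrict)
  finally show ?thesis .
qed

lemma isoK_id: "isoK (\<lambda>x. x) (\<lambda>x. x)"
  by (simp add: isoK_def)

text \<open>Preserved inner products of the \<open>R e\<close> are preserved transition
  probabilities, so Wigner's theorem applies to the image vectors. A projection of rank n is a sum
  of rank-one ones, and linearity of \<open>\<Phi>\<close> carries the formula over to it.\<close>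

lemma isometry_from_rank_one_images:
  assumes \<phi>: "\<And>P. P \<in> KP n \<Longrightarrow> \<phi> P \<in> KP n"
    and lin: "linear \<Phi>" and ext: "\<And>P. P \<in> KP n \<Longrightarrow> \<Phi> (Fsop P) = Fsop (\<phi> P)"
    and pres: "\<And>e f. norm e = 1 \<Longrightarrow> norm f = 1 \<Longrightarrow> inner (\<Phi> (R e)) (\<Phi> (R f)) = inner (R e) (R f)"
    and img: "\<And>e. norm e = 1 \<Longrightarrow> \<exists>e'. norm e' = 1 \<and> \<Phi> (R e) = R e'"
  shows "\<exists>V W. isoK V W \<and> (\<forall>P\<in>KP n. \<phi> P = V \<circ> P \<circ> W)"
proof -
  obtain f where f: "\<And>e. norm e = 1 \<Longrightarrow> norm (f e) = 1" "\<And>e. norm e = 1 \<Longrightarrow> \<Phi> (R e) = R (f e)"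
    using img by metis
  have "norm (ip (f x) (f y)) = norm (ip x y)" if "norm x = 1" "norm y = 1" for x y
  proof -
    have "kd * (norm (ip (f x) (f y)))\<^sup>2 = kd * (norm (ip x y))\<^sup>2"
      using pres[OF that] f that by (simp add: inner_R)
    then show ?thesis using kd_pos by (simp add: power2_eq_iff_nonneg)
  qed
  then obtain V where V: "\<And>x y. V (x + y) = V x + V y"
    "(\<forall>a x. V (a *\<^sub>K x) = a *\<^sub>K V x) \<or> (\<forall>a x. V (a *\<^sub>K x) = cj a *\<^sub>K V x)"
    "\<And>x. norm (V x) = norm x" "\<And>x. norm x = 1 \<Longrightarrow> \<exists>c. norm c = 1 \<and> f x = c *\<^sub>K V x"
    using wigner[of f] f(1) by blast
  obtain W where W: "isoK V W" using isometry_adjoint[OF V(1-3)] .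
  have RV: "R (f x) = R (V x)" if "norm x = 1" for x using V(4)[OF that] R_phase by auto
  have V0: "V 0 = 0" using V(3)[of 0] by simp
  have "\<phi> P = V \<circ> P \<circ> W" if P: "P \<in> KP n" for P
  proof
    fix x
    obtain B where B: "kon B" "P = PS B" using P KP_iff by blast
    obtain B' where B': "kon B'" "\<phi> P = PS B'" using \<phi>[OF P] KP_iff by blast
    have "FP B' = \<Phi> (FP B)" using ext[OF P] B B' by (simp add: Fsop_PS)
    also have "\<dots> = (\<Sum>b\<in>B. R (V b))"
      unfolding FP_def linear_sum[OF lin] using f(2) RV kon_norm[OF B(1)] by (intro sum.cong) auto
    finally have "opr (FP B') x = (\<Sum>b\<in>B. opr (R (V b)) x)" by (simp add: opr_sum)
    then have "\<phi> P x = (\<Sum>b\<in>B. rk1 (V b) x)"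
      using B' kon_norm[OF B(1)] V(3) by (simp add: opr_FP opr_R)
    also have "\<dots> = (\<Sum>b\<in>B. V (rk1 b (W x)))" by (simp add: isoK_rk1[OF W])
    also have "\<dots> = V (\<Sum>b\<in>B. rk1 b (W x))"
      by (induction B rule: infinite_finite_induct) (auto simp: V0 V(1))
    finally show "\<phi> P x = (V \<circ> P \<circ> W) x" by (simp add: B PS_rk1)
  qed
  then show ?thesis using W by blast
qed

lemma KP_full:
  assumes no: "\<not> (\<exists>C. kon C \<and> card C = Suc n)" and P: "P \<in> KP n"
  shows "P = (\<lambda>x. x)"
proof -
  obtain B where B: "kon B" "card B = n" "P = PS B" using P KP_iff by blast
  have "K.span B = UNIV"
  proof (rule ccontr)
    assume "K.span B \<noteq> UNIV"
    then obtain v where "v \<notin> K.span B" by blast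
    from kon_step[OF B(1) this] obtain e where "norm e = 1" "\<And>b. b \<in> B \<Longrightarrow> ip e b = 0" by metis
    from kon_insert[OF B(1) this] have "kon (insert e B)" "card (insert e B) = Suc n"
      using kon_finite[OF B(1)] B(2) by auto
    then show False using no by blast
  qed
  then show ?thesis using PS_fix[OF B(1)] B(3) by auto
qed

text \<open>Each vector of C is left out exactly once, so the projections onto the spans of the
  \<open>C - {d}\<close> add up to n times that onto the span of C. This needs \<open>n + 1\<close>
  orthonormal vectors.\<close>

lemma rank_one_lincomb:
  assumes C: "kon C" "card C = Suc n" and n: "n \<ge> 1" and c: "c \<in> C"
  shows "R c = (1 / real n) *\<^sub>R (\<Sum>d\<in>C. FP (C - {d})) - FP (C - {c})"
proof -
  have fC: "finite C" using C kon_finite by blast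
  have "(\<Sum>d\<in>C. FP (C - {d})) = (\<Sum>d\<in>C. FP C - R d)"
    by (intro sum.cong refl FP_remove fC)
  also have "\<dots> = real (Suc n) *\<^sub>R FP C - FP C"
    unfolding sum_subtractf using C by (simp add: FP_def scaleR_conv_of_real sum_constant_scaleR)
  also have "\<dots> = real n *\<^sub>R FP C" by (simp add: scaleR_add_left)
  finally show ?thesis using n c fC by (simp add: FP_remove)
qed

context
  fixes n :: nat and \<phi> :: "('a \<Rightarrow> 'a) \<Rightarrow> ('a \<Rightarrow> 'a)" and \<Phi> :: "'a fsop \<Rightarrow> 'a fsop"
  assumes \<phi>: "\<And>P. P \<in> KP n \<Longrightarrow> \<phi> P \<in> KP n"
    and ang: "\<And>P Q. P \<in> KP n \<Longrightarrow> Q \<in> KP n \<Longrightarrow> kangle_eq (\<phi> P) (\<phi> Q) P Q"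
    and n: "n \<ge> 2"
    and lin: "linear \<Phi>" and ext: "\<And>P. P \<in> KP n \<Longrightarrow> \<Phi> (Fsop P) = Fsop (\<phi> P)"
begin

text \<open>The images of the \<open>n\<close>-element subsets of an orthonormal \<open>(n+1)\<close>-set are simultaneously diagonal and
  pairwise adjacent, so they either lie under one projection of rank \<open>n+1\<close> or contain one of rank \<open>n-1\<close>.\<close>

lemma frame_dichotomy:
  assumes C: "kon C" "card C = Suc n"
  shows "(\<forall>c\<in>C. \<exists>e'. norm e' = 1 \<and> \<Phi> (R c) = R e') \<or>
    (\<exists>D. kon D \<and> card D = 2 * n \<and> (\<forall>c\<in>C. \<exists>e'\<in>D. \<Phi> (R c) = (1 / real n) *\<^sub>R FP D - R e'))"
proof -
  have fC: "finite C" using C kon_finite by blast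
  have KPc: "PS (C - {c}) \<in> KP n" if "c \<in> C" for c
    unfolding KP_iff using that C fC by (intro exI[of _ "C - {c}"]) (auto intro: kon_subset)
  define Q where "Q c = \<phi> (PS (C - {c}))" for c
  have QK: "Q c \<in> KP n" if "c \<in> C" for c unfolding Q_def using \<phi> KPc that by blast
  have Qp: "kproj (Q c)" if "c \<in> C" for c using QK[OF that] by (simp add: KP_def)
  have PSp: "kproj (PS (C - {c}))" for c using C(1) by (intro PS_kproj) (auto intro: kon_subset)
  have Qc: "Q c (Q d x) = Q d (Q c x)" if cd: "c \<in> C" "d \<in> C" for c d x
  proof -
    have "PS (C - {c}) (PS (C - {d}) x) = PS (C - {d}) (PS (C - {c}) x)" for x
      using PS_comp[OF C(1), of "C - {c}" "C - {d}"] PS_comp[OF C(1), of "C - {d}" "C - {c}"]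
      by (simp add: Int_commute)
    from kangle_commute[OF PSp PSp Qp[OF cd(1)] Qp[OF cd(2)] _ this] show ?thesis
      using ang[OF KPc[OF cd(1)] KPc[OF cd(2)]] unfolding Q_def by blast
  qed
  \<comment> \<open>One finite-dimensional space containing all the ranges, as simultaneous
    diagonalisation requires.\<close>
  have "\<exists>A. kon A \<and> (\<forall>c\<in>C. \<forall>x. PS A (Q c x) = Q c x)"
  proof -
    have "\<forall>c\<in>C. \<exists>G. kon G \<and> Q c = PS G" using QK KP_iff by blast
    from bchoice[OF this] obtain G where G: "\<And>c. c \<in> C \<Longrightarrow> kon (G c) \<and> Q c = PS (G c)" by blast
    have "finite (\<Union>c\<in>C. G c)" using fC G kon_finite by blast
    then obtain A where A: "kon A" "K.span A = K.span (\<Union>c\<in>C. G c)" by (rule gram_schmidt)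
    have "PS A (Q c x) = Q c x" if "c \<in> C" for c x
    proof -
      have "Q c x \<in> K.span (G c)" using G[OF that] PS_span by simp
      also have "K.span (G c) \<subseteq> K.span A" unfolding A(2) using that by (intro K.span_mono) blast
      finally show ?thesis using PS_fix[OF A(1)] by blast
    qed
    then show ?thesis using A(1) by blast
  qed
  then obtain A where A: "kon A" "\<And>c x. c \<in> C \<Longrightarrow> PS A (Q c x) = Q c x" by blast
  have QA: "Q c (PS A x) = Q c x" if "c \<in> C" for c x
    using kle_left[OF Qp[OF that] PS_kproj[OF A(1)]] A(2)[OF that] by (simp add: kle_def)
  obtain cs where cs: "set cs = C" using finite_list[OF fC] by blast
  obtain B where B: "kon B" "PS B = PS A" "\<forall>c\<in>C. \<forall>b\<in>B. Q c b = b \<or> Q c b = 0"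
    using simultaneous_diagonalisation[of "map Q cs" A] Qp Qc A QA by (auto simp: cs)
  \<comment> \<open>\<open>S c\<close> encodes the image of \<open>C - {c}\<close> as a subset of
    the common eigenbasis B; traces then give the sizes of these sets and of their
    intersections.\<close>
  define S where "S c = {b\<in>B. Q c b = b}" for c
  have QS: "Q c = PS (S c)" if "c \<in> C" for c
    unfolding S_def using that QA[OF that] B Qp by (intro PS_diagonal) auto
  have SB: "S c \<subseteq> B" for c by (auto simp: S_def)
  have fS: "finite (S c)" for c using SB kon_finite[OF B(1)] finite_subset by blast
  have kS: "kon (S c)" for c using kon_subset[OF B(1) SB] .
  have inS: "inner (FP (S c)) (FP (S d)) = kd * real (card (S c \<inter> S d))" for c d
    using inner_FP[OF B(1) SB SB] .
  have inC: "inner (FP (C - {c})) (FP (C - {d})) = kd * real (card ((C - {c}) \<inter> (C - {d})))" for c d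
    using inner_FP[OF C(1)] by blast
  have hsQ: "inner (FP (S c)) (FP (S d)) = inner (FP (C - {c})) (FP (C - {d}))" if cd: "c \<in> C" "d \<in> C" for c d
  proof -
    have "hs (Q c) (Q d) = hs (PS (C - {c})) (PS (C - {d}))"
      unfolding Q_def using cd by (intro kangle_hs[of _ n] ang KPc \<phi>)
    moreover have "kon (C - {c})" "kon (C - {d})" using C(1) by (auto intro: kon_subset)
    ultimately show ?thesis
      unfolding inner_fsop_def using cd QS by (simp add: opr_FP kS)
  qed
  have cardS: "card (S c \<inter> S d) = card ((C - {c}) \<inter> (C - {d}))" if "c \<in> C" "d \<in> C" for c d
    using hsQ[OF that] kd_pos unfolding inS inC by simp
  have c1: "card (S c) = n" if "c \<in> C" for c using cardS[OF that that] C that fC by simp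
  have c2: "card (S c \<inter> S d) = n - 1" if "c \<in> C" "d \<in> C" "c \<noteq> d" for c d
  proof -
    have "(C - {c}) \<inter> (C - {d}) = C - {c} - {d}" by blast
    then show ?thesis using cardS[OF that(1,2)] C that fC by simp
  qed
  obtain m where m: "n = Suc m" using n by (cases n) auto
  obtain i0 i1 where i01: "i0 \<in> C" "i1 \<in> C" "i0 \<noteq> i1"
  proof -
    have "\<not> card C \<le> Suc 0" using C(2) n by simp
    then show ?thesis using that card_le_Suc0_iff_eq[OF fC] by blast
  qed
  have \<Phi>FP: "\<Phi> (FP (C - {c})) = FP (S c)" if "c \<in> C" for c
  proof -
    have "kon (C - {c})" using C(1) by (auto intro: kon_subset)
    then have "\<Phi> (FP (C - {c})) = Fsop (Q c)"
      using ext[OF KPc[OF that]] by (simp add: Q_def Fsop_PS)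
    then show ?thesis using QS[OF that] Fsop_PS[OF kS] by simp
  qed
  have \<Phi>R: "\<Phi> (R c) = (1 / real n) *\<^sub>R (\<Sum>d\<in>C. FP (S d)) - FP (S c)" if "c \<in> C" for c
  proof -
    have "\<Phi> (R c) = \<Phi> ((1 / real n) *\<^sub>R (\<Sum>d\<in>C. FP (C - {d})) - FP (C - {c}))"
      using rank_one_lincomb[OF C _ that] n by simp
    also have "\<dots> = (1 / real n) *\<^sub>R (\<Sum>d\<in>C. \<Phi> (FP (C - {d}))) - \<Phi> (FP (C - {c}))"
      by (simp only: linear_diff[OF lin] linear_scale[OF lin] linear_sum[OF lin])
    also have "\<dots> = (1 / real n) *\<^sub>R (\<Sum>d\<in>C. FP (S d)) - FP (S c)" using \<Phi>FP that by simp
    finally show ?thesis .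
  qed
  have Sinj: "S c \<noteq> S d" if "c \<in> C" "d \<in> C" "c \<noteq> d" for c d
    using c1[OF that(1)] c2[OF that] n by auto
  \<comment> \<open>Here \<open>m = n - 1\<close>: the sets have n elements, and two different ones
    share \<open>n - 1\<close>.\<close>
  have cliq: "(\<exists>M. finite M \<and> card M = m \<and> (\<forall>i\<in>C. M \<subseteq> S i)) \<or>
    (\<exists>N. finite N \<and> card N = Suc (Suc m) \<and> (\<forall>i\<in>C. S i \<subseteq> N))"
    by (rule johnson_clique[OF _ _ _ i01]) (use fS c1 c2 m in auto)
  then show ?thesis
  proof (elim disjE exE conjE)
    \<comment> \<open>The top: each image omits one vector \<open>e c\<close> of N, just as
      \<open>C - {c}\<close> omits c, so the combination in \<open>rank_one_lincomb\<close> returns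
      \<open>R (e c)\<close>.\<close>
    fix N assume N: "finite N" "card N = Suc (Suc m)" "\<forall>i\<in>C. S i \<subseteq> N"
    have "\<exists>e. e \<in> N \<and> S c = N - {e}" if "c \<in> C" for c
    proof -
      have "card (N - S c) = 1" using N that c1[OF that] fS by (simp add: card_Diff_subset m)
      then obtain e where "N - S c = {e}" by (auto simp: card_1_singleton_iff)
      then show ?thesis using N(3) that by blast
    qed
    then obtain e where e: "\<And>c. c \<in> C \<Longrightarrow> e c \<in> N" "\<And>c. c \<in> C \<Longrightarrow> S c = N - {e c}" by metis
    have inj: "inj_on e C" using Sinj e(2) by (metis inj_onI)
    have eN: "e ` C = N"
      using e(1) N inj C m by (intro card_subset_eq) (auto simp: card_image)
    have NB: "N \<subseteq> B"
    proof
      fix x assume "x \<in> N"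
      have "\<exists>c\<in>C. x \<noteq> e c" using inj i01 by (metis inj_on_def)
      then obtain c where "c \<in> C" "x \<noteq> e c" by blast
      then show "x \<in> B" using e(2) \<open>x \<in> N\<close> SB by blast
    qed
    have FS: "FP (S c) = FP N - R (e c)" if "c \<in> C" for c
      using FP_remove[OF N(1) e(1)[OF that]] e(2)[OF that] by simp
    have "(\<Sum>d\<in>C. FP (S d)) = (\<Sum>d\<in>C. FP N - R (e d))" using FS by (rule sum.cong[OF refl])
    also have "\<dots> = real (Suc n) *\<^sub>R FP N - (\<Sum>d\<in>C. R (e d))"
      unfolding sum_subtractf using C by (simp add: sum_constant_scaleR)
    also have "(\<Sum>d\<in>C. R (e d)) = FP N"
      unfolding FP_def eN[symmetric] using inj by (simp add: sum.reindex)
    finally have sum: "(\<Sum>d\<in>C. FP (S d)) = real n *\<^sub>R FP N" by (simp add: scaleR_add_left)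
    have "\<Phi> (R c) = R (e c)" if "c \<in> C" for c
      using \<Phi>R[OF that] FS[OF that] n by (simp add: sum)
    moreover have "norm (e c) = 1" if "c \<in> C" for c
      using kon_norm[OF B(1)] NB e(1)[OF that] by blast
    ultimately show ?thesis by blast
  next
    \<comment> \<open>The star: the images share M and differ in one vector \<open>e c\<close> each.
      The \<open>n - 1\<close> vectors of M and the \<open>n + 1\<close> vectors \<open>e c\<close>
      make up the \<open>2 * n\<close> vectors of \<open>?D\<close>.\<close>
    fix M assume M: "finite M" "card M = m" "\<forall>i\<in>C. M \<subseteq> S i"
    have "\<exists>e. e \<notin> M \<and> S c = insert e M" if "c \<in> C" for c
    proof -
      have "card (S c - M) = 1" using M that c1[OF that] by (simp add: card_Diff_subset m)
      then obtain e where "S c - M = {e}" by (auto simp: card_1_singleton_iff)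
      then show ?thesis using M(3) that by blast
    qed
    then obtain e where e: "\<And>c. c \<in> C \<Longrightarrow> e c \<notin> M" "\<And>c. c \<in> C \<Longrightarrow> S c = insert (e c) M" by metis
    have inj: "inj_on e C" using Sinj e(2) by (metis inj_onI)
    let ?D = "M \<union> e ` C"
    have dj: "M \<inter> e ` C = {}" using e(1) by auto
    have "?D \<subseteq> B" using SB e(2) i01(1) by blast
    then have kD: "kon ?D" using kon_subset[OF B(1)] by blast
    have cD: "card ?D = 2 * n"
      using dj M fC inj C m by (simp add: card_Un_disjoint card_image)
    have FS: "FP (S c) = R (e c) + FP M" if "c \<in> C" for c
      using FP_insert[OF M(1) e(1)[OF that]] e(2)[OF that] by simp
    have FD: "FP ?D = FP M + (\<Sum>d\<in>C. R (e d))"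
      unfolding FP_def using dj M fC inj by (simp add: sum.union_disjoint sum.reindex)
    have "(\<Sum>d\<in>C. FP (S d)) = (\<Sum>d\<in>C. R (e d) + FP M)" using FS by (rule sum.cong[OF refl])
    also have "\<dots> = (\<Sum>d\<in>C. R (e d)) + real (Suc n) *\<^sub>R FP M"
      unfolding sum.distrib using C by (simp add: sum_constant_scaleR)
    also have "\<dots> = FP ?D + real n *\<^sub>R FP M" unfolding FD by (simp add: scaleR_add_left)
    finally have sum: "(\<Sum>d\<in>C. FP (S d)) = FP ?D + real n *\<^sub>R FP M" .
    have "\<Phi> (R c) = (1 / real n) *\<^sub>R FP ?D - R (e c)" if "c \<in> C" for c
      using \<Phi>R[OF that] FS[OF that] n by (simp add: sum scaleR_add_right)
    then show ?thesis using kD cD by blast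
  qed
qed

text \<open>On e the operator has eigenvalue \<open>1 / n - 1\<close>, on the rest of the span of D
  eigenvalue \<open>1 / n\<close>, and neither vanishes for \<open>n \<ge> 2\<close>. So the
  operator alone determines the span of D.\<close>

lemma star_kernel:
  assumes D: "kon D" and e: "e \<in> D"
  shows "opr ((1 / real n) *\<^sub>R FP D - R e) x = 0 \<longleftrightarrow> PS D x = 0"
proof
  have ne: "norm e = 1" using kon_norm D e by blast
  have op: "opr ((1 / real n) *\<^sub>R FP D - R e) x = (1 / real n) *\<^sub>R PS D x - ip x e *\<^sub>K e"
    by (simp add: opr_minus opr_scaleR opr_FP[OF D] opr_R[OF ne] rk1_def)
  have ipe: "ip (PS D x) e = ip x e" by (simp add: kproj_sa[OF PS_kproj[OF D]] PS_base[OF D e])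
  {
    assume "PS D x = 0"
    then show "opr ((1 / real n) *\<^sub>R FP D - R e) x = 0" using op ipe by simp
  next
    assume "opr ((1 / real n) *\<^sub>R FP D - R e) x = 0"
    then have eq: "(1 / real n) *\<^sub>R PS D x = ip x e *\<^sub>K e" using op by simp
    have "ip ((1 / real n) *\<^sub>R PS D x) e = ip (ip x e *\<^sub>K e) e" by (simp only: eq)
    then have "of_real (1 / real n) * ip x e = ip x e"
      by (simp only: scaleR_K ip_scale_left ipe ip_self_unit[OF ne] mult_1_right)
    moreover have "of_real (1 / real n) \<noteq> (of_real 1 :: 'k)" using n by (simp only: of_real_eq_iff) simp
    ultimately have "ip x e = 0" by (metis mult_cancel_right2 of_real_1)
    then show "PS D x = 0" using eq n by simp
  }
qed

text \<open>The eigenvalue \<open>1 / n - 1\<close> is negative, while a projection is positive.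
  Hence a rank-one projection cannot belong to both a top frame and a star frame.\<close>

lemma star_neq_rank_one:
  assumes D: "kon D" and e: "e \<in> D" and f: "norm f = 1"
  shows "(1 / real n) *\<^sub>R FP D - R e \<noteq> R f"
proof
  have ne: "norm e = 1" using kon_norm D e by blast
  assume "(1 / real n) *\<^sub>R FP D - R e = R f"
  then have "opr ((1 / real n) *\<^sub>R FP D - R e) e = opr (R f) e" by simp
  then have "(1 / real n) *\<^sub>R e - e = rk1 f e"
    by (simp add: opr_minus opr_scaleR opr_FP[OF D] opr_R[OF ne] opr_R[OF f] PS_base[OF D e] rk1_self[OF ne])
  then have "inner ((1 / real n) *\<^sub>R e - e) e = inner (rk1 f e) e" by simp
  moreover have "inner (rk1 f e) e = inner (rk1 f e) (rk1 f e)"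
    by (simp add: inner_ip kproj_sa[OF rk1_kproj[OF f]] kproj_idem[OF rk1_kproj[OF f]])
  moreover have "inner e e = 1" using ne by (simp add: norm_eq_1)
  ultimately have "1 / real n - 1 \<ge> 0" by (simp add: inner_diff_left)
  then show False using n by (simp add: field_simps)
qed

lemma star_unique:
  assumes D: "kon D" "e \<in> D" and D': "kon D'" "e' \<in> D'"
    and eq: "(1 / real n) *\<^sub>R FP D - R e = (1 / real n) *\<^sub>R FP D' - R e'"
  shows "PS D = PS D'"
proof -
  have ker: "PS D x = 0 \<longleftrightarrow> PS D' x = 0" for x
    using star_kernel[OF D, of x] star_kernel[OF D', of x] eq by simp
  have "kle (PS B) (PS A)" if A: "kon A" and B: "kon B" and k: "\<And>x. PS A x = 0 \<Longrightarrow> PS B x = 0" for A B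
    unfolding kle_def
  proof
    fix x
    have pa: "kproj (PS A)" and pb: "kproj (PS B)" using A B PS_kproj by auto
    have BA: "PS B (PS A y) = PS B y" for y
      using k[of "y - PS A y"] by (simp add: kproj_diff[OF pa] kproj_diff[OF pb] kproj_idem[OF pa])
    show "PS A (PS B x) = PS B x"
    proof (rule ip_ext)
      fix y show "ip (PS A (PS B x)) y = ip (PS B x) y"
        by (simp only: kproj_sa[OF pa] kproj_sa[OF pb] BA)
    qed
  qed
  then show ?thesis using D(1) D'(1) ker PS_kproj by (intro kle_antisym) auto
qed

text \<open>Suppose a frame through e is a star over D. Pair e with each f of an orthonormal set of
  \<open>2 n + 1\<close> vectors: the image of \<open>R e\<close> forces any frame through e and f
  to be a star over the same span. The resulting vectors \<open>g f\<close> are again orthonormal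
  and lie in a space of dimension \<open>2 n\<close>, one vector too many.\<close>

lemma rank_one_images:
  assumes pres: "\<And>e f. norm e = 1 \<Longrightarrow> norm f = 1 \<Longrightarrow> inner (\<Phi> (R e)) (\<Phi> (R f)) = inner (R e) (R f)"
    and dim: "\<not> hasdim UNIV (2 * n)" and C0: "kon C0" "card C0 = Suc n" and e: "norm e = 1"
  shows "\<exists>e'. norm e' = 1 \<and> \<Phi> (R e) = R e'"
proof -
  have "kon {e}" using e by (simp add: kon_def ip_self_unit)
  then obtain C where C: "kon C" "{e} \<subseteq> C" "card C = card C0"
    using kon_extend[OF _ C0(1), of "{e}"] C0(2) by auto
  have no_star: False
    if D: "kon D" "card D = 2 * n" and star: "\<forall>c\<in>C. \<exists>e'\<in>D. \<Phi> (R c) = (1 / real n) *\<^sub>R FP D - R e'" for D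
  proof -
    have "K.span D \<noteq> UNIV" using dim kon_hasdim[OF D(1)] D(2) by auto
    then obtain v where "v \<notin> K.span D" by blast
    from kon_step[OF D(1) this] obtain u where "norm u = 1" "\<And>b. b \<in> D \<Longrightarrow> ip u b = 0" by metis
    from kon_insert[OF D(1) this] have D1: "kon (insert u D)" "card (insert u D) = Suc (2 * n)"
      using kon_finite[OF D(1)] D(2) by auto
    \<comment> \<open>The set \<open>insert u D\<close> serves only to show that there is room for
      \<open>2 n + 1\<close> orthonormal vectors; \<open>C1\<close> is an extension of C and so
      contains e.\<close>
    obtain C1 where C1: "kon C1" "C \<subseteq> C1" "card C1 = Suc (2 * n)"
      using kon_extend[OF C(1) D1(1)] D1(2) C C0 by auto
    have eC: "e \<in> C" using C by simp
    obtain e0 where e0: "e0 \<in> D" "\<Phi> (R e) = (1 / real n) *\<^sub>R FP D - R e0" using star eC by blast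
    have "\<exists>g. norm g = 1 \<and> PS D g = g \<and> \<Phi> (R f) = (1 / real n) *\<^sub>R FP D - R g" if f: "f \<in> C1" for f
    proof -
      have ef: "{e, f} \<subseteq> C1" using f eC C1 by auto
      have "card {e, f} \<le> Suc n" using n card_insert_le_m1[of 2 "{f}" e] by (simp add: card_insert_if)
      moreover have "Suc n \<le> card C1" using C1 by simp
      ultimately obtain C' where C': "{e, f} \<subseteq> C'" "C' \<subseteq> C1" "card C' = Suc n"
        using exists_subset_between[of "{e, f}" "Suc n" C1] ef kon_finite[OF C1(1)] by auto
      have kC': "kon C'" using kon_subset C1(1) C'(2) by blast
      from frame_dichotomy[OF kC' C'(3)] show ?thesis
      proof
        assume "\<forall>c\<in>C'. \<exists>e'. norm e' = 1 \<and> \<Phi> (R c) = R e'"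
        then obtain e' where "norm e' = 1" "\<Phi> (R e) = R e'" using C'(1) by auto
        then show ?thesis using star_neq_rank_one[OF D(1) e0(1)] e0(2) by metis
      next
        assume "\<exists>D. kon D \<and> card D = 2 * n \<and> (\<forall>c\<in>C'. \<exists>e'\<in>D. \<Phi> (R c) = (1 / real n) *\<^sub>R FP D - R e')"
        then obtain D' where D': "kon D'" "\<forall>c\<in>C'. \<exists>e'\<in>D'. \<Phi> (R c) = (1 / real n) *\<^sub>R FP D' - R e'" by blast
        obtain e1 where e1: "e1 \<in> D'" "\<Phi> (R e) = (1 / real n) *\<^sub>R FP D' - R e1" using D'(2) C'(1) by blast
        have PD: "PS D = PS D'" using star_unique[OF D(1) e0(1) D'(1) e1(1)] e0(2) e1(2) by simp
        then have FD: "FP D = FP D'" using Fsop_PS D(1) D'(1) by metis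
        obtain g where "g \<in> D'" "\<Phi> (R f) = (1 / real n) *\<^sub>R FP D' - R g" using D'(2) C'(1) by blast
        then show ?thesis using PD FD PS_base[OF D'(1)] kon_norm[OF D'(1)] by metis
      qed
    qed
    then have "\<forall>f\<in>C1. \<exists>g. norm g = 1 \<and> PS D g = g \<and> \<Phi> (R f) = (1 / real n) *\<^sub>R FP D - R g" by blast
    from bchoice[OF this] obtain g where g: "\<And>f. f \<in> C1 \<Longrightarrow> norm (g f) = 1" "\<And>f. f \<in> C1 \<Longrightarrow> PS D (g f) = g f"
      "\<And>f. f \<in> C1 \<Longrightarrow> \<Phi> (R f) = (1 / real n) *\<^sub>R FP D - R (g f)" by blast
    have orth: "ip (g f) (g h) = 0" if fh: "f \<in> C1" "h \<in> C1" "f \<noteq> h" for f h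
    proof -
      have nf: "norm f = 1" "norm h = 1" using kon_norm[OF C1(1)] fh by auto
      have "0 = inner (R f) (R h)" using kon_ip[OF C1(1) fh(1,2)] fh(3) nf by (simp add: inner_R)
      also have "\<dots> = inner ((1 / real n) *\<^sub>R FP D - R (g f)) ((1 / real n) *\<^sub>R FP D - R (g h))"
        using pres[OF nf] g(3) fh by simp
      also have "\<dots> = (1 / real n) * (1 / real n) * inner (FP D) (FP D) - (1 / real n) * inner (FP D) (R (g h))
          - (1 / real n) * inner (FP D) (R (g f)) + inner (R (g f)) (R (g h))"
        by (simp add: inner_diff_left inner_diff_right inner_commute algebra_simps)
      \<comment> \<open>The other terms cancel because D has \<open>2 n\<close> elements:
        \<open>2 n / n^2 - 1 / n - 1 / n = 0\<close>.\<close>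
      also have "\<dots> = kd * (norm (ip (g f) (g h)))\<^sup>2"
        using inner_FP[OF D(1), of D D] inner_FP_R[OF D(1)] g(1,2) fh D(2) n
        by (simp add: inner_R field_simps)
      finally show ?thesis using kd_pos by simp
    qed
    have inj: "inj_on g C1"
    proof (rule inj_onI)
      fix f h assume fh: "f \<in> C1" "h \<in> C1" "g f = g h"
      show "f = h"
      proof (rule ccontr)
        assume "f \<noteq> h"
        then have "ip (g f) (g f) = 0" using orth[of f h] fh by simp
        then show False using g(1)[OF fh(1)] by simp
      qed
    qed
    have "kon (g ` C1)"
      unfolding kon_def using kon_finite[OF C1(1)] orth g(1) ip_self_unit by auto
    moreover have "g ` C1 \<subseteq> K.span D" using g(2) PS_span by (metis image_subsetI)
    ultimately have "card (g ` C1) \<le> card D" using kon_card_le kon_finite[OF D(1)] by blast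
    then show False using inj C1(3) D(2) by (simp add: card_image)
  qed
  have "card C = Suc n" using C(3) C0(2) by simp
  from frame_dichotomy[OF C(1) this] show ?thesis using no_star C(2) by blast
qed

end

theorem rank_n_preserver:
  assumes \<phi>: "\<And>P. P \<in> KP n \<Longrightarrow> \<phi> P \<in> KP n"
    and ang: "\<And>P Q. P \<in> KP n \<Longrightarrow> Q \<in> KP n \<Longrightarrow> kangle_eq (\<phi> P) (\<phi> Q) P Q"
    and dim: "n = 1 \<or> \<not> hasdim UNIV (2 * n)"
  shows "\<exists>V W. isoK V W \<and> (\<forall>P\<in>KP n. \<phi> P = V \<circ> P \<circ> W)"
proof -
  define \<phi>' where "\<phi>' A = Fsop (\<phi> (opr A))" for A :: "'a fsop"
  define X where "X = Fsop ` KP n"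
  have opK: "opr (Fsop P) = P" if "P \<in> KP n" for P
    using that opr_FP Fsop_PS KP_iff by metis
  have XK: "opr A \<in> KP n" if "A \<in> X" for A using that opK by (auto simp: X_def)
  have "inner (\<phi>' A) (\<phi>' B) = inner A B" if "A \<in> X" "B \<in> X" for A B
    using kangle_hs[OF XK XK \<phi> \<phi> ang] that XK \<phi> opK by (simp add: inner_fsop_def \<phi>'_def)
  then obtain \<Phi> where \<Phi>: "linear \<Phi>" "\<And>A. A \<in> X \<Longrightarrow> \<Phi> A = \<phi>' A"
    "\<And>A B. A \<in> span X \<Longrightarrow> B \<in> span X \<Longrightarrow> inner (\<Phi> A) (\<Phi> B) = inner A B"
    using inner_preserving_extension[of X \<phi>'] by blast
  have ext: "\<Phi> (Fsop P) = Fsop (\<phi> P)" if "P \<in> KP n" for P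
    using \<Phi>(2)[of "Fsop P"] that opK by (simp add: X_def \<phi>'_def)
  \<comment> \<open>In the third case only the identity can have rank n; in the fourth there is room
    for a frame of \<open>n + 1\<close> vectors.\<close>
  consider "n = 0" | "n = 1" | "n \<ge> 2" "\<not> (\<exists>C. kon C \<and> card C = Suc n)"
    | "n \<ge> 2" "\<exists>C. kon C \<and> card C = Suc n"
  proof -
    have "n = 0 \<or> n = 1 \<or> n \<ge> 2" by linarith
    then show ?thesis using that by blast
  qed
  then show ?thesis
  proof cases
    case 1
    have "P = (\<lambda>x. 0)" if P: "P \<in> KP n" for P
    proof -
      obtain B where "kon B" "card B = 0" "P = PS B" using P 1 KP_iff by blast
      then show ?thesis using kon_finite[of B] by (auto simp: PS_def)
    qed
    then have "\<phi> P = P" if "P \<in> KP n" for P using \<phi> that by metis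
    then show ?thesis using isoK_id by (intro exI[of _ "\<lambda>x. x"]) (auto simp: comp_def)
  next
    case 2
    have R1: "rk1 e \<in> KP n" if "norm e = 1" for e
      unfolding KP_iff using that 2
      by (intro exI[of _ "{e}"]) (auto simp: kon_def ip_self_unit PS_def rk1_def)
    show ?thesis
    proof (rule isometry_from_rank_one_images[OF \<phi> \<Phi>(1) ext])
      fix e f :: 'a assume "norm e = 1" "norm f = 1"
      then have "R e \<in> X" "R f \<in> X" using R1 by (auto simp: X_def R_def)
      then show "inner (\<Phi> (R e)) (\<Phi> (R f)) = inner (R e) (R f)" by (intro \<Phi>(3) span_base)
    next
      fix e :: 'a assume e: "norm e = 1"
      have "\<phi> (rk1 e) \<in> KP 1" using \<phi> R1[OF e] 2 by simp
      then obtain B where B: "kon B" "card B = 1" "\<phi> (rk1 e) = PS B" using KP_iff by blast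
      then obtain b where "B = {b}" by (auto simp: card_1_singleton_iff)
      then have "norm b = 1" "\<phi> (rk1 e) = rk1 b" using B kon_norm by (auto simp: PS_rk1)
      then show "\<exists>e'. norm e' = 1 \<and> \<Phi> (R e) = R e'" using ext[OF R1[OF e]] by (auto simp: R_def)
    qed
  next
    case 3
    then have "P = (\<lambda>x. x)" if "P \<in> KP n" for P using KP_full that by blast
    then have "\<phi> P = P" if "P \<in> KP n" for P using \<phi> that by metis
    then show ?thesis using isoK_id by (intro exI[of _ "\<lambda>x. x"]) (auto simp: comp_def)
  next
    case 4
    then obtain C0 where C0: "kon C0" "card C0 = Suc n" by blast
    have RX: "R e \<in> span X" if e: "norm e = 1" for e
    proof -
      have "kon {e}" using e by (simp add: kon_def ip_self_unit)
      then obtain C where C: "kon C" "{e} \<subseteq> C" "card C = card C0"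
        using kon_extend[OF _ C0(1), of "{e}"] C0(2) by auto
      have FX: "FP (C - {d}) \<in> X" if "d \<in> C" for d
      proof -
        have k: "kon (C - {d})" using C(1) by (auto intro: kon_subset)
        moreover have "card (C - {d}) = n" using that C C0 kon_finite[OF C(1)] by simp
        ultimately have "PS (C - {d}) \<in> KP n" using KP_iff by blast
        then show ?thesis unfolding X_def using Fsop_PS[OF k] by (metis imageI)
      qed
      have "R e = (1 / real n) *\<^sub>R (\<Sum>d\<in>C. FP (C - {d})) - FP (C - {e})"
        using C C0 4 by (intro rank_one_lincomb) auto
      also have "\<dots> \<in> span X"
        using FX C(2) by (intro span_diff span_scale span_sum span_base) auto
      finally show ?thesis .
    qed
    have pres: "inner (\<Phi> (R e)) (\<Phi> (R f)) = inner (R e) (R f)" if "norm e = 1" "norm f = 1" for e f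
      using \<Phi>(3) RX that by blast
    have dim': "\<not> hasdim UNIV (2 * n)" using dim 4 by auto
    show ?thesis
    proof (rule isometry_from_rank_one_images[OF \<phi> \<Phi>(1) ext pres])
      fix e :: 'a assume "norm e = 1"
      then show "\<exists>e'. norm e' = 1 \<and> \<Phi> (R e) = R e'"
        using rank_one_images[OF \<phi> ang 4(1) \<Phi>(1) ext pres dim' C0] by blast
    qed
  qed
qed

end

section \<open>Infinite rank\<close>

context kspace
begin

section \<open>Orthonormal sequences inside projections of infinite rank\<close>

lemma KI_iff: "P \<in> KI \<longleftrightarrow> kproj P \<and> \<not> (\<exists>B. kon B \<and> P = PS B)"
  using KP_iff unfolding KI_def KP_def by blast

lemma KI_kproj: "P \<in> KI \<Longrightarrow> kproj P"
  by (simp add: KI_def)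

lemma kle_refl: "kproj P \<Longrightarrow> kle P P"
  by (simp add: kle_def kproj_idem)

lemma KI_mono: "P \<in> KI \<Longrightarrow> kproj Q \<Longrightarrow> kle P Q \<Longrightarrow> Q \<in> KI"
  unfolding KI_iff using kle_PS_finite by metis

text \<open>For x in the range of P the condition \<open>ip x f = 0\<close> involves only
  \<open>P f\<close>, and finitely many such vectors do not span the range.\<close>

lemma KI_unit:
  assumes P: "P \<in> KI" and F: "finite F"
  shows "\<exists>x. norm x = 1 \<and> P x = x \<and> (\<forall>f\<in>F. ip x f = 0)"
proof -
  have k: "kproj P" using P KI_kproj by blast
  obtain C where C: "kon C" "K.span C = K.span (P ` F)" using gram_schmidt[of "P ` F"] F by blast
  have CP: "K.span C \<subseteq> range P"
    unfolding C(2) by (rule K.span_minimal) (auto intro: kproj_subspace[OF k])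
  have "range P \<noteq> K.span C" using P kon_hasdim[OF C(1)] by (auto simp: KI_def)
  then obtain v where v: "P v = v" "v \<notin> K.span C" using CP kproj_range[OF k] by blast
  obtain e where e: "norm e = 1" "\<And>b. b \<in> C \<Longrightarrow> ip e b = 0" "K.span (insert e C) = K.span (insert v C)"
    using kon_step[OF C(1) v(2)] by metis
  have "K.span (insert v C) \<subseteq> range P"
    by (rule K.span_minimal) (use CP K.span_base v(1) kproj_subspace[OF k] in \<open>auto simp: kproj_range[OF k] subset_iff\<close>)
  then have Pe: "P e = e" using e(3) K.span_base[of e "insert e C"] kproj_range[OF k] by blast
  have "ip e f = 0" if "f \<in> F" for f
  proof -
    have "P f \<in> K.span C" unfolding C(2) using that by (intro K.span_base) simp
    then have "P f = PS C (P f)" using PS_fix[OF C(1)] by simp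
    then have "ip e (P f) = ip e (PS C (P f))" by simp
    also have "\<dots> = ip (PS C e) (P f)" using kproj_sa[OF PS_kproj[OF C(1)]] by simp
    also have "PS C e = 0" using e(2) by (rule PS_orth)
    finally show ?thesis using kproj_sa[OF k, of e f] Pe by simp
  qed
  then show ?thesis using e(1) Pe by blast
qed

text \<open>\<open>KI_unit\<close> is iterated with the vectors already chosen added to F. Letting T
  vary with n interleaves several projections in one sequence.\<close>

lemma KI_sequence:
  assumes T: "\<And>n. T n \<in> KI" and F: "finite F"
  obtains s :: "nat \<Rightarrow> 'a" where "\<And>n. T n (s n) = s n" "\<And>n f. f \<in> F \<Longrightarrow> ip (s n) f = 0"
    "\<And>m n. ip (s m) (s n) = (if m = n then 1 else 0)"
proof -
  let ?Q = "\<lambda>s n x. norm x = 1 \<and> T n x = x \<and> (\<forall>f \<in> F \<union> s ` {..<n}. ip x f = 0)"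
  have "\<exists>s. \<forall>n. ?Q s n (s n)"
  proof (rule dependent_wellorder_choice)
    fix r :: 'a and f g :: "nat \<Rightarrow> 'a" and n
    assume "\<And>y. y < n \<Longrightarrow> f y = g y"
    then have "f ` {..<n} = g ` {..<n}" by (intro image_cong) auto
    then show "?Q f n r = ?Q g n r" by simp
  next
    fix n f
    show "\<exists>r. ?Q f n r" using KI_unit[OF T, of "F \<union> f ` {..<n}" n] F by simp
  qed
  then obtain s where s: "\<And>n. ?Q s n (s n)" by blast
  have less: "ip (s m) (s n) = 0" if "n < m" for m n using s[of m] that by auto
  have "ip (s m) (s n) = (if m = n then 1 else 0)" for m n
  proof (cases m n rule: linorder_cases)
    case less
    then have "ip (s n) (s m) = 0" using \<open>\<And>m n. n < m \<Longrightarrow> ip (s m) (s n) = 0\<close> by blast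
    then show ?thesis using less ip_eq_0_commute by auto
  next
    case equal
    then show ?thesis using s[of n] by (simp add: ip_self_unit)
  next
    case greater
    then show ?thesis using \<open>\<And>m n. n < m \<Longrightarrow> ip (s m) (s n) = 0\<close> by auto
  qed
  moreover have "T n (s n) = s n" "f \<in> F \<Longrightarrow> ip (s n) f = 0" for n f using s[of n] by auto
  ultimately show ?thesis using that[of s] by blast
qed

lemma KI_from_sequence:
  assumes P: "kproj P" and s: "\<And>n::nat. P (s n) = s n" "\<And>m n. ip (s m) (s n) = (if m = n then 1 else 0)"
  shows "P \<in> KI"
  unfolding KI_iff
proof (intro conjI notI P, elim exE conjE)
  fix B assume B: "kon B" "P = PS B"
  have inj: "inj s"
  proof (rule injI)
    fix m n assume "s m = s n"
    then show "m = n" using s(2)[of m n] s(2)[of n n] by (auto split: if_splits)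
  qed
  have "kon (s ` {..card B})"
    unfolding kon_def using s(2) inj by (auto simp: inj_eq)
  moreover have "s ` {..card B} \<subseteq> K.span B"
    using s(1) B(2) PS_span by (metis image_subsetI)
  ultimately have "card (s ` {..card B}) \<le> card B" using kon_card_le kon_finite[OF B(1)] by blast
  moreover have "card (s ` {..card B}) = Suc (card B)" using inj by (subst card_image) (auto intro: inj_on_subset)
  ultimately show False by simp
qed

lemma kernel_fix:
  assumes A: "kproj A" and ker: "\<And>x. A x = 0 \<longleftrightarrow> (\<forall>s\<in>F. ip x s = 0)" and s: "s \<in> F"
  shows "A s = s"
proof -
  have "A (s - A s) = 0" by (simp add: kproj_diff[OF A] kproj_idem[OF A])
  then have "ip (s - A s) s = 0" using ker s by blast
  moreover have "ip (s - A s) (s - A s) = ip (s - A s) s"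
    using kproj_sa[OF A, of "s - A s" s] \<open>A (s - A s) = 0\<close> by (simp add: ip_diff_right)
  ultimately show ?thesis by simp
qed

text \<open>Together with \<open>kernel_fix\<close>: A is the least projection fixing F, as the
  projection onto the closed span should be.\<close>

lemma kernel_kle:
  assumes A: "kproj A" and ker: "\<And>x. A x = 0 \<longleftrightarrow> (\<forall>s\<in>F. ip x s = 0)"
    and P: "kproj P" and fix_F: "\<And>s. s \<in> F \<Longrightarrow> P s = s"
  shows "kle A P"
  unfolding kle_def
proof
  fix x
  have AP: "A (P y) = A y" for y
  proof -
    have "A (y - P y) = 0"
      unfolding ker using fix_F by (simp add: ip_diff_left kproj_sa[OF P])
    then show ?thesis by (simp add: kproj_diff[OF A])
  qed
  show "P (A x) = A x"
  proof (rule ip_ext)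
    fix y show "ip (P (A x)) y = ip (A x) y" by (simp only: kproj_sa[OF P] kproj_sa[OF A] AP)
  qed
qed

definition korth :: "('a \<Rightarrow> 'a) \<Rightarrow> ('a \<Rightarrow> 'a) \<Rightarrow> bool" where
  "korth P Q \<longleftrightarrow> (\<forall>x. P (Q x) = 0)"

text \<open>Infinite rank and infinite corank: the part of \<open>KI\<close> that is closed under
  complements.\<close>

definition II :: "('a \<Rightarrow> 'a) set" where
  "II = {P \<in> KI. (\<lambda>x. x - P x) \<in> KI}"

section \<open>Order expressed by orthogonality\<close>

lemma korth_sym: "kproj P \<Longrightarrow> kproj Q \<Longrightarrow> korth P Q \<Longrightarrow> korth Q P"
  unfolding korth_def using kproj_orth_sym by blast

lemma korth_kle: "korth P Q \<longleftrightarrow> kle Q (\<lambda>x. x - P x)"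
  by (simp add: korth_def kle_def)

lemma kle_compl:
  assumes "kproj P" "kproj Q" "kle P Q"
  shows "kle (\<lambda>x. x - Q x) (\<lambda>x. x - P x)"
  using kle_left[OF assms] by (simp add: kle_def kproj_diff[OF assms(1)])

lemma kle_trans: "kle P Q \<Longrightarrow> kle Q S \<Longrightarrow> kle P S"
  unfolding kle_def by metis

lemma II_kproj: "P \<in> II \<Longrightarrow> kproj P" and II_KI: "P \<in> II \<Longrightarrow> P \<in> KI"
  by (auto simp: II_def KI_def)

lemma II_between:
  assumes P: "P \<in> KI" and L: "kproj L" and Q: "Q \<in> II" and le: "kle P L" "kle L Q"
  shows "L \<in> II"
  unfolding II_def
proof (intro CollectI conjI)
  show "L \<in> KI" using KI_mono[OF P L le(1)] .
  have "(\<lambda>x. x - Q x) \<in> KI" using Q by (simp add: II_def)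
  then show "(\<lambda>x. x - L x) \<in> KI"
    using KI_mono kproj_compl[OF L] kle_compl[OF L II_kproj[OF Q] le(2)] by blast
qed

lemma II_iff_orth: "P \<in> II \<longleftrightarrow> P \<in> KI \<and> (\<exists>S\<in>KI. korth S P)"
proof
  assume P: "P \<in> II"
  then have "korth (\<lambda>x. x - P x) P" by (simp add: korth_def II_kproj kproj_idem)
  then show "P \<in> KI \<and> (\<exists>S\<in>KI. korth S P)" using P by (auto simp: II_def)
next
  assume "P \<in> KI \<and> (\<exists>S\<in>KI. korth S P)"
  then obtain S where S: "P \<in> KI" "S \<in> KI" "korth S P" by blast
  then have "kle S (\<lambda>x. x - P x)" using korth_sym KI_kproj korth_kle by metis
  then have "(\<lambda>x. x - P x) \<in> KI" using S KI_mono kproj_compl KI_kproj by blast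
  then show "P \<in> II" using S by (simp add: II_def)
qed

text \<open>The test projection is the complement of Q, a member of \<open>KI\<close> because Q has
  infinite corank. As \<open>\<phi>\<close> preserves orthogonality, it will preserve the order on
  \<open>II\<close>.\<close>

lemma kle_iff_orth:
  assumes P: "kproj P" and Q: "Q \<in> II"
  shows "kle P Q \<longleftrightarrow> (\<forall>S\<in>KI. korth S Q \<longrightarrow> korth S P)"
proof
  assume le: "kle P Q"
  show "\<forall>S\<in>KI. korth S Q \<longrightarrow> korth S P"
  proof (intro ballI impI)
    fix S assume S: "S \<in> KI" "korth S Q"
    have "S (P x) = 0" for x
    proof -
      have "P x = Q (P x)" using le by (simp add: kle_def)
      then show ?thesis using S(2) unfolding korth_def by metis
    qed
    then show "korth S P" by (simp add: korth_def)
  qed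
next
  assume a: "\<forall>S\<in>KI. korth S Q \<longrightarrow> korth S P"
  have "(\<lambda>x. x - Q x) \<in> KI" using Q by (simp add: II_def)
  moreover have "korth (\<lambda>x. x - Q x) Q" by (simp add: korth_def kproj_idem[OF II_kproj[OF Q]])
  ultimately have "korth (\<lambda>x. x - Q x) P" using a by blast
  then show "kle P Q" by (simp add: korth_def kle_def)
qed

text \<open>Take an orthonormal sequence with even terms in the range of P, odd terms in that of Q
  and all terms orthogonal to F, and split it by indices modulo 4. A is built on the residue 0 and B
  on 1; the residues 2 and 3 keep \<open>P - A\<close> and \<open>Q - B\<close> of infinite rank,
  and 2 also the complement of \<open>A + B\<close>.\<close>

lemma orth_blocks:
  assumes P: "P \<in> KI" and Q: "Q \<in> KI" and F: "finite F"
  obtains A B where "A \<in> II" "B \<in> II" "kle A P" "kle B Q" "korth A B"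
    "(\<lambda>x. A x + B x) \<in> II" "(\<lambda>x. P x - A x) \<in> KI" "(\<lambda>x. Q x - B x) \<in> KI"
    "\<And>f. f \<in> F \<Longrightarrow> A f = 0" "\<And>f. f \<in> F \<Longrightarrow> B f = 0"
proof -
  define T where "T n = (if even n then P else Q)" for n :: nat
  have TK: "T n \<in> KI" for n using P Q by (simp add: T_def)
  obtain s where s: "\<And>n. T n (s n) = s n" "\<And>n f. f \<in> F \<Longrightarrow> ip (s n) f = 0"
    and on: "\<And>m n. ip (s m) (s n) = (if m = n then 1 else 0)"
    using KI_sequence[of T F] TK F by blast
  note kp = KI_kproj[OF P] KI_kproj[OF Q]
  obtain A where A: "kproj A" "\<And>x. A x = 0 \<longleftrightarrow> (\<forall>s\<in>range (\<lambda>k. s (4 * k)). ip x s = 0)"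
    by (rule projection_kernel) blast
  obtain B where B: "kproj B" "\<And>x. B x = 0 \<longleftrightarrow> (\<forall>s\<in>range (\<lambda>k. s (4 * k + 1)). ip x s = 0)"
    by (rule projection_kernel) blast
  have Ps: "P (s (2 * k)) = s (2 * k)" and Qs: "Q (s (2 * k + 1)) = s (2 * k + 1)" for k
    using s(1)[of "2 * k"] s(1)[of "2 * k + 1"] by (auto simp: T_def)
  have As: "A (s (4 * k)) = s (4 * k)" and Bs: "B (s (4 * k + 1)) = s (4 * k + 1)" for k
    using kernel_fix[OF A] kernel_fix[OF B] by blast+
  have A0: "A (s n) = 0" if "\<And>k. n \<noteq> 4 * k" for n unfolding A(2) using on that by simp
  have B0: "B (s n) = 0" if "\<And>k. n \<noteq> 4 * k + 1" for n unfolding B(2) using on that by simp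
  have AP: "kle A P"
    using Ps[of "2 * k" for k] by (intro kernel_kle[OF A kp(1)]) auto
  have BQ: "kle B Q"
    using Qs[of "2 * k" for k] by (intro kernel_kle[OF B kp(2)]) auto
  have "kle B (\<lambda>x. x - A x)"
  proof (rule kernel_kle[OF B kproj_compl[OF A(1)]])
    fix t assume "t \<in> range (\<lambda>k. s (4 * k + 1))"
    then obtain k where "t = s (4 * k + 1)" by blast
    moreover have "4 * k + 1 \<noteq> 4 * j" for j by presburger
    ultimately show "t - A t = t" using A0 by simp
  qed
  then have AB: "korth A B" by (simp add: korth_kle)
  have AB': "A (B x) = 0" for x using AB by (simp add: korth_def)
  note S = kproj_orth_sum[OF A(1) B(1) AB']
  have AK: "A \<in> KI" using on As by (intro KI_from_sequence[OF A(1), of "\<lambda>k. s (4 * k)"]) auto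
  have BK: "B \<in> KI" using on Bs by (intro KI_from_sequence[OF B(1), of "\<lambda>k. s (4 * k + 1)"]) auto
  have n2: "4 * k + 2 \<noteq> 4 * j" "4 * k + 2 \<noteq> 4 * j + 1" "4 * k + 3 \<noteq> 4 * j + 1" for j k :: nat by presburger+
  have PA: "(\<lambda>x. P x - A x) \<in> KI"
  proof (rule KI_from_sequence[OF kproj_kle_diff[OF A(1) kp(1) AP], of "\<lambda>k. s (4 * k + 2)"])
    show "P (s (4 * k + 2)) - A (s (4 * k + 2)) = s (4 * k + 2)" for k
      using Ps[of "2 * k + 1"] A0[of "4 * k + 2"] n2 by simp
  qed (use on in auto)
  have QB: "(\<lambda>x. Q x - B x) \<in> KI"
  proof (rule KI_from_sequence[OF kproj_kle_diff[OF B(1) kp(2) BQ], of "\<lambda>k. s (4 * k + 3)"])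
    show "Q (s (4 * k + 3)) - B (s (4 * k + 3)) = s (4 * k + 3)" for k
    proof -
      have "2 * (2 * k + 1) + 1 = 4 * k + 3" by simp
      then have "Q (s (4 * k + 3)) = s (4 * k + 3)" using Qs[of "2 * k + 1"] by metis
      moreover have "B (s (4 * k + 3)) = 0" using B0 n2(3) by blast
      ultimately show ?thesis by simp
    qed
  qed (use on in auto)
  have "(\<lambda>x. x - (A x + B x)) \<in> KI"
  proof (rule KI_from_sequence[OF kproj_compl[OF S], of "\<lambda>k. s (4 * k + 2)"])
    show "s (4 * k + 2) - (A (s (4 * k + 2)) + B (s (4 * k + 2))) = s (4 * k + 2)" for k
      using A0[of "4 * k + 2"] B0[of "4 * k + 2"] n2 by simp
  qed (use on in auto)
  moreover have leA: "kle A (\<lambda>x. A x + B x)" and leB: "kle B (\<lambda>x. A x + B x)"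
    using AB' kproj_orth_sym[OF A(1) B(1) AB'] by (simp_all add: kle_def kproj_idem[OF A(1)] kproj_idem[OF B(1)])
  ultimately have SI: "(\<lambda>x. A x + B x) \<in> II" using KI_mono[OF AK S] by (simp add: II_def)
  show ?thesis
  proof (rule that[OF _ _ AP BQ AB SI PA QB])
    show "A \<in> II" using II_between[OF AK A(1) SI kle_refl[OF A(1)] leA] .
    show "B \<in> II" using II_between[OF BK B(1) SI kle_refl[OF B(1)] leB] .
    fix f assume f: "f \<in> F"
    have "ip f (s n) = 0" for n using s(2)[OF f] ip_eq_0_commute by blast
    then show "A f = 0" "B f = 0" unfolding A(2) B(2) by auto
  qed
qed

section \<open>Rank-one steps and the covering relation\<close>

lemma kle_rk1: "norm e = 1 \<Longrightarrow> kproj P \<Longrightarrow> P e = e \<Longrightarrow> kle (rk1 e) P"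
  by (simp add: kle_def rk1_def kproj_scale)

lemma rk1_zero:
  assumes P: "kproj P" and e: "P e = 0"
  shows "P (rk1 e x) = 0" "rk1 e (P x) = 0"
  using assms by (simp_all add: rk1_def kproj_scale kproj_sa)

lemma kproj_plus_rk1: "kproj P \<Longrightarrow> norm e = 1 \<Longrightarrow> P e = 0 \<Longrightarrow> kproj (\<lambda>x. P x + rk1 e x)"
  by (intro kproj_orth_sum rk1_kproj) (auto simp: rk1_zero)

lemma KI_minus_rk1:
  assumes P: "P \<in> KI" and e: "norm e = 1" "P e = e"
  shows "(\<lambda>x. P x - rk1 e x) \<in> KI"
  unfolding KI_iff
proof (intro conjI notI)
  have k: "kproj P" using P KI_kproj by blast
  show "kproj (\<lambda>x. P x - rk1 e x)"
    using kproj_kle_diff[OF rk1_kproj[OF e(1)] k kle_rk1[OF e(1) k e(2)]] .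
  assume "\<exists>B. kon B \<and> (\<lambda>x. P x - rk1 e x) = PS B"
  then obtain B where B: "kon B" "(\<lambda>x. P x - rk1 e x) = PS B" by blast
  have "PS B e = 0" using fun_cong[OF B(2), of e] e by (simp add: rk1_self)
  have "ip e b = 0" if "b \<in> B" for b
    using kproj_sa[OF PS_kproj[OF B(1)], of e b] PS_base[OF B(1) that] \<open>PS B e = 0\<close> by simp
  from kon_insert[OF B(1) e(1) this] have i: "kon (insert e B)" "e \<notin> B" by auto
  have "P x = PS (insert e B) x" for x
    using fun_cong[OF B(2), of x] PS_insert[OF kon_finite[OF B(1)] i(2), of x] by (simp add: algebra_simps)
  then show False using P i(1) unfolding KI_iff by blast
qed

lemma II_plus_rk1:
  assumes P: "P \<in> II" and e: "norm e = 1" "P e = 0"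
  shows "(\<lambda>x. P x + rk1 e x) \<in> II"
proof -
  note k = II_kproj[OF P]
  have 1: "kproj (\<lambda>x. P x + rk1 e x)" using kproj_plus_rk1[OF k e] .
  have "kle P (\<lambda>x. P x + rk1 e x)" using k e by (simp add: kle_def kproj_idem rk1_zero)
  then have "(\<lambda>x. P x + rk1 e x) \<in> KI" using KI_mono[OF II_KI[OF P] 1] by blast
  moreover have "(\<lambda>x. (x - P x) - rk1 e x) \<in> KI"
    using P e by (intro KI_minus_rk1) (auto simp: II_def)
  then have "(\<lambda>x. x - (P x + rk1 e x)) \<in> KI" by (simp add: diff_diff_eq)
  ultimately show ?thesis by (simp add: II_def)
qed

lemma II_minus_rk1:
  assumes P: "P \<in> II" and e: "norm e = 1" "P e = e"
  shows "(\<lambda>x. P x - rk1 e x) \<in> II"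
proof -
  have 1: "(\<lambda>x. P x - rk1 e x) \<in> KI" using KI_minus_rk1[OF II_KI[OF P] e] .
  have "kle (\<lambda>x. P x - rk1 e x) P"
    using e by (simp add: kle_def kproj_diff[OF II_kproj[OF P]] kproj_idem[OF II_kproj[OF P]] rk1_def kproj_scale[OF II_kproj[OF P]])
  then show ?thesis using II_between[OF 1 KI_kproj[OF 1] P] kle_refl[OF KI_kproj[OF 1]] by blast
qed

definition covers :: "('a \<Rightarrow> 'a) \<Rightarrow> ('a \<Rightarrow> 'a) \<Rightarrow> bool" where
  "covers P Q \<longleftrightarrow> kle P Q \<and> P \<noteq> Q \<and> (\<forall>L\<in>II. kle P L \<longrightarrow> kle L Q \<longrightarrow> L = P \<or> L = Q)"

text \<open>Adding to P one unit vector from the range of \<open>Q - P\<close> gives an element of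
  \<open>II\<close> above P and below Q, so in a covering pair it is Q. Conversely, for L in
  between, \<open>L - P\<close> is a projection below \<open>rk1 e\<close>, hence 0 or
  \<open>rk1 e\<close>.\<close>

lemma covers_iff:
  assumes P: "P \<in> II" and Q: "Q \<in> II"
  shows "covers P Q \<longleftrightarrow> (\<exists>e. norm e = 1 \<and> P e = 0 \<and> Q = (\<lambda>x. P x + rk1 e x))"
proof
  note kP = II_kproj[OF P] and kQ = II_kproj[OF Q]
  assume c: "covers P Q"
  then have le: "kle P Q" and ne: "P \<noteq> Q" by (auto simp: covers_def)
  then obtain x where x: "Q x - P x \<noteq> 0" by (metis eq_iff_diff_eq_0 ext)
  define e where "e = (1 / norm (Q x - P x)) *\<^sub>R (Q x - P x)"
  have n: "norm e = 1" using x by (simp add: e_def)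
  have "P e = 0" "Q e = e"
    using kle_left[OF kP kQ le] le unfolding e_def scaleR_K
    by (simp_all add: kproj_scale[OF kP] kproj_scale[OF kQ] kproj_diff[OF kP] kproj_diff[OF kQ]
        kproj_idem[OF kP] kproj_idem[OF kQ] kle_def)
  let ?L = "\<lambda>x. P x + rk1 e x"
  have L: "?L \<in> II" using II_plus_rk1[OF P n \<open>P e = 0\<close>] .
  have "kle P ?L" using \<open>P e = 0\<close> by (simp add: kle_def kproj_idem[OF kP] rk1_zero[OF kP])
  moreover have "kle ?L Q"
    using le \<open>Q e = e\<close> by (simp add: kle_def kproj_add[OF kQ] rk1_def kproj_scale[OF kQ])
  ultimately have "?L = P \<or> ?L = Q" using c L unfolding covers_def by blast
  moreover have "?L e \<noteq> P e" using n \<open>P e = 0\<close> by (auto simp: rk1_self)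
  ultimately show "\<exists>e. norm e = 1 \<and> P e = 0 \<and> Q = (\<lambda>x. P x + rk1 e x)" using n \<open>P e = 0\<close> by metis
next
  note kP = II_kproj[OF P] and kQ = II_kproj[OF Q]
  assume "\<exists>e. norm e = 1 \<and> P e = 0 \<and> Q = (\<lambda>x. P x + rk1 e x)"
  then obtain e where e: "norm e = 1" "P e = 0" and Qe: "Q = (\<lambda>x. P x + rk1 e x)" by blast
  have "kle P Q" unfolding Qe using e by (simp add: kle_def kproj_idem[OF kP] rk1_zero[OF kP])
  moreover have "P \<noteq> Q"
  proof
    assume "P = Q"
    then have "P e = Q e" by simp
    then show False unfolding Qe using e by (auto simp: rk1_self)
  qed
  moreover have "L = P \<or> L = Q" if L: "L \<in> II" "kle P L" "kle L Q" for L
  proof -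
    note kL = II_kproj[OF L(1)]
    define D where "D x = L x - P x" for x
    have kD: "kproj D" unfolding D_def using kproj_kle_diff[OF kP kL L(2)] .
    have De: "D x = rk1 e (D x)" for x
    proof -
      have "Q (L x) = L x" "P (L x) = P x" using L(3) kle_left[OF kP kL L(2)] by (auto simp: kle_def)
      then have "rk1 e (L x) = D x" unfolding Qe D_def by (simp add: algebra_simps)
      moreover have "rk1 e (P x) = 0" using rk1_zero[OF kP e(2)] by simp
      moreover have "rk1 e (D x) = rk1 e (L x) - rk1 e (P x)"
        unfolding D_def using kproj_diff[OF rk1_kproj[OF e(1)]] by simp
      ultimately show ?thesis by simp
    qed
    have Dr: "D x = D (rk1 e x)" for x
      using kle_left[OF kD rk1_kproj[OF e(1)]] De by (simp add: kle_def)
    define \<mu> where "\<mu> = ip (D e) e"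
    have "D e = \<mu> *\<^sub>K e" using De[of e] by (simp add: rk1_def \<mu>_def)
    then have Dx: "D x = \<mu> *\<^sub>K rk1 e x" for x
      using Dr[of x] by (simp add: rk1_def kproj_scale[OF kD] scale_scale mult.commute)
    have "\<mu> *\<^sub>K \<mu> *\<^sub>K e = \<mu> *\<^sub>K e"
      using kproj_idem[OF kD, of e] \<open>D e = \<mu> *\<^sub>K e\<close> by (simp add: kproj_scale[OF kD])
    then have "ip (\<mu> *\<^sub>K \<mu> *\<^sub>K e) e = ip (\<mu> *\<^sub>K e) e"
      by (rule arg_cong[where f = "\<lambda>z. ip z e"])
    then have "\<mu> * \<mu> = \<mu>" using e by (simp add: ip_scale_left ip_self_unit)
    then have "\<mu> = 0 \<or> \<mu> = 1" by simp
    then show ?thesis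
    proof
      assume "\<mu> = 0"
      then have "L x = P x" for x using Dx[of x] by (simp add: D_def)
      then show ?thesis by auto
    next
      assume "\<mu> = 1"
      then have "L x = Q x" for x using Dx[of x] unfolding Qe by (simp add: D_def algebra_simps)
      then show ?thesis by auto
    qed
  qed
  ultimately show "covers P Q" unfolding covers_def by blast
qed

section \<open>Compressions, adjoints and eigenvalues\<close>

lemma compress_zero:
  assumes P: "kproj P" and Q: "kproj Q" and z: "\<And>x. Q (P (Q x)) = 0"
  shows "P (Q x) = 0"
proof -
  have "ip (P (Q x)) (P (Q x)) = ip x (Q (P (Q x)))"
    by (simp only: kproj_sa[OF P] kproj_sa[OF Q] kproj_idem[OF P])
  then show ?thesis by (simp add: z)
qed

lemma kunitary_inverse:
  assumes U: "kunitary U"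
  shows "kunitary (inv U)"
proof -
  have s: "U (inv U x) = x" for x using U by (simp add: kunitary_def surj_f_inv_f)
  have i: "inv U (U x) = x" for x using kunitary_inj[OF U] s by blast
  have "inv U (x + y) = inv U x + inv U y" for x y
    using i[of "inv U x + inv U y"] U s by (simp add: kunitary_def)
  moreover have "inv U (a *\<^sub>K x) = a *\<^sub>K inv U x" for a x
    using i[of "a *\<^sub>K inv U x"] U s by (simp add: kunitary_def)
  moreover have "norm (inv U x) = norm x" for x
    using U s by (metis kunitary_def)
  moreover have "surj (inv U)" using i by (metis surjI)
  ultimately show ?thesis by (simp add: kunitary_def)
qed

lemma kangle_sym:
  assumes "kangle_eq P Q P' Q'"
  shows "kangle_eq P' Q' P Q"
proof -
  obtain U where U: "kunitary U" "U \<circ> (Q \<circ> P \<circ> Q) = (Q' \<circ> P' \<circ> Q') \<circ> U"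
    using assms by (auto simp: kangle_eq_def)
  have s: "U (inv U x) = x" for x using U by (simp add: kunitary_def surj_f_inv_f)
  have i: "inv U (U x) = x" for x using kunitary_inj[OF U(1)] s by blast
  have "inv U (Q' (P' (Q' x))) = Q (P (Q (inv U x)))" for x
  proof -
    have "Q' (P' (Q' (U (inv U x)))) = U (Q (P (Q (inv U x))))" using U(2) by (metis comp_apply)
    then show ?thesis by (simp add: s i)
  qed
  then show ?thesis
    unfolding kangle_eq_def using kunitary_inverse[OF U(1)] by (intro exI[of _ "inv U"]) auto
qed

lemma isoK_inner: "isoK V W \<Longrightarrow> inner (V x) y = inner x (W y)"
  unfolding isoK_def inner_ip by auto

lemma isoK_linear: "isoK V W \<Longrightarrow> linear V"
  unfolding isoK_def by (blast intro: isometry_real_linear)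

lemma isoK_left_inverse:
  assumes V: "isoK V W"
  shows "W (V x) = x"
proof -
  have "inner u (W (V x)) = inner u x" for u
    using isoK_inner[OF V, of u "V x"] isometry_inner[OF isoK_linear[OF V]] V by (simp add: isoK_def)
  then show ?thesis using vector_eq_ldot[of "W (V x)" x] by blast
qed

text \<open>T maps the line of e to itself, and its eigenvalue there is idempotent.\<close>

lemma commutes_rk1:
  assumes T: "kproj T" and e: "norm e = 1" and c: "\<And>x. T (rk1 e x) = rk1 e (T x)"
  shows "T e = 0 \<or> T e = e"
proof -
  define \<mu> where "\<mu> = ip (T e) e"
  have Te: "T e = \<mu> *\<^sub>K e" using c[of e] by (simp add: rk1_self[OF e]) (simp add: rk1_def \<mu>_def)
  have "\<mu> *\<^sub>K \<mu> *\<^sub>K e = \<mu> *\<^sub>K e"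
    using kproj_idem[OF T, of e] Te by (simp add: kproj_scale[OF T])
  then have "ip (\<mu> *\<^sub>K \<mu> *\<^sub>K e) e = ip (\<mu> *\<^sub>K e) e" by (rule arg_cong[where f = "\<lambda>z. ip z e"])
  then have "\<mu> * \<mu> = \<mu>" using e by (simp add: ip_scale_left ip_self_unit)
  then have "\<mu> = 0 \<or> \<mu> = 1" by simp
  then show ?thesis using Te by auto
qed

text \<open>\<open>P + t rk1 g\<close> with g in the kernel of P has no eigenvalues besides 0, 1 and
  t: apply P to the equation or, if \<open>P v = 0\<close>, take the component along g.\<close>

lemma eigenvalue_plus_rk1:
  assumes P: "kproj P" and g: "norm g = 1" "P g = 0" and v: "v \<noteq> 0"
    and eq: "P v + of_real t *\<^sub>K rk1 g v = of_real t' *\<^sub>K v"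
  shows "t' = t \<or> t' = 0 \<or> t' = 1"
proof (cases "P v = 0")
  case False
  have "P (P v + of_real t *\<^sub>K rk1 g v) = P v"
    by (simp add: kproj_add[OF P] kproj_idem[OF P] kproj_scale[OF P] rk1_zero[OF P g(2)])
  then have "of_real t' *\<^sub>K P v = 1 *\<^sub>K P v" using eq by (simp add: kproj_scale[OF P])
  then have "of_real t' = (1::'k)" using False by (simp only: K.scale_cancel_right) auto
  then have "t' = 1" using of_real_eq_1_iff by blast
  then show ?thesis by simp
next
  case True
  then have e: "of_real t *\<^sub>K ip v g *\<^sub>K g = of_real t' *\<^sub>K v" using eq by (simp add: rk1_def)
  then have "ip (of_real t *\<^sub>K ip v g *\<^sub>K g) g = ip (of_real t' *\<^sub>K v) g"
    by (rule arg_cong[where f = "\<lambda>z. ip z g"])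
  then have "of_real t * ip v g = of_real t' * ip v g" by (simp only: ip_scale_left ip_self_unit[OF g(1)] mult_1_right)
  then have "of_real t = (of_real t' :: 'k) \<or> ip v g = 0" by auto
  then show ?thesis using e v by auto
qed

text \<open>A projection of infinite rank is recovered from the projections of infinite rank and corank that
  commute with it, because each rank-one projection below it is a product of two of those.\<close>

lemma rk1_product:
  assumes P: "P \<in> KI" and e: "norm e = 1" "P e = e"
  obtains A B where "A \<in> II" "B \<in> II" "\<And>x. P (A x) = A (P x)" "\<And>x. P (B x) = B (P x)"
    "\<And>x. A (B x) = rk1 e x"
proof -
  note k = KI_kproj[OF P]
  let ?P = "\<lambda>x. P x - rk1 e x"
  have P0: "?P \<in> KI" using KI_minus_rk1[OF P e] .
  \<comment> \<open>A and B are orthogonal blocks below \<open>P - rk1 e\<close>. After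
    \<open>rk1 e\<close> is added to both, only \<open>rk1 e\<close> survives in their
    product.\<close>
  obtain A B where AB: "A \<in> II" "B \<in> II" "kle A ?P" "kle B ?P" "korth A B"
    by (rule orth_blocks[OF P0 P0 finite.emptyI]) blast
  have Pe: "?P e = 0" using e by (simp add: rk1_self)
  have PA: "T e = 0" "kle T P" if T: "T \<in> II" "kle T ?P" for T
  proof -
    have "T e = T (?P e)" using kle_left[OF II_kproj[OF T(1)] KI_kproj[OF P0] T(2)] by simp
    then show "T e = 0" unfolding Pe by (simp add: kproj_zero[OF II_kproj[OF T(1)]])
    have "kle ?P P"
      using e by (simp add: kle_def kproj_diff[OF k] kproj_idem[OF k] rk1_def kproj_scale[OF k])
    then show "kle T P" using T(2) kle_trans by blast
  qed
  note A = II_kproj[OF AB(1)] PA[OF AB(1,3)] and B = II_kproj[OF AB(2)] PA[OF AB(2,4)]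
  have comm: "P (T x + rk1 e x) = T (P x) + rk1 e (P x)" if T: "kproj T" "kle T P" for T x
    using kle_left[OF T(1) k T(2)] T(2) e
    by (simp add: kproj_add[OF k] kle_def rk1_def kproj_scale[OF k] kproj_sa[OF k])
  show ?thesis
  proof (rule that[of "\<lambda>x. A x + rk1 e x" "\<lambda>x. B x + rk1 e x"])
    show "(\<lambda>x. A x + rk1 e x) \<in> II" "(\<lambda>x. B x + rk1 e x) \<in> II"
      using II_plus_rk1 AB(1,2) e(1) A(2) B(2) by auto
    show "P (A x + rk1 e x) = A (P x) + rk1 e (P x)" "P (B x + rk1 e x) = B (P x) + rk1 e (P x)" for x
      using comm A B by auto
    have AB0: "A (B x) = 0" for x using AB(5) by (simp add: korth_def)
    show "A (B x + rk1 e x) + rk1 e (B x + rk1 e x) = rk1 e x" for x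
      by (simp add: kproj_add[OF A(1)] AB0 rk1_zero[OF A(1,2)] kproj_add[OF rk1_kproj[OF e(1)]]
          rk1_zero[OF B(1,2)] kproj_idem[OF rk1_kproj[OF e(1)]])
  qed
qed

context
  fixes \<phi> :: "('a \<Rightarrow> 'a) \<Rightarrow> ('a \<Rightarrow> 'a)"
  assumes surj: "\<phi> ` KI = KI"
    and ang: "\<And>P Q. P \<in> KI \<Longrightarrow> Q \<in> KI \<Longrightarrow> kangle_eq (\<phi> P) (\<phi> Q) P Q"
begin

section \<open>The induced automorphism of the order on \<open>II\<close>\<close>

lemma phi_KI: "P \<in> KI \<Longrightarrow> \<phi> P \<in> KI"
  using surj by blast

text \<open>\<open>Q P Q = 0\<close> is invariant under unitary equivalence and already means
  \<open>P Q = 0\<close>.\<close>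

lemma phi_orth_imp:
  assumes P: "kproj P" "kproj Q" "kproj P'" "kproj Q'" and a: "kangle_eq P' Q' P Q" and o: "korth P Q"
  shows "korth P' Q'"
proof -
  obtain U where U: "kunitary U" "U \<circ> (Q' \<circ> P' \<circ> Q') = (Q \<circ> P \<circ> Q) \<circ> U"
    using a by (auto simp: kangle_eq_def)
  have "Q' (P' (Q' x)) = 0" for x
  proof -
    have "U (Q' (P' (Q' x))) = Q (P (Q (U x)))" using U(2) by (metis comp_apply)
    also have "\<dots> = 0" using o kproj_zero[OF P(2)] by (simp add: korth_def)
    finally have "norm (Q' (P' (Q' x))) = 0" using U(1) unfolding kunitary_def by (metis norm_zero)
    then show ?thesis by simp
  qed
  then show ?thesis using compress_zero[OF P(3,4)] by (simp add: korth_def)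
qed

lemma phi_orth:
  assumes "P \<in> KI" "Q \<in> KI"
  shows "korth (\<phi> P) (\<phi> Q) \<longleftrightarrow> korth P Q"
  using phi_orth_imp[of P Q "\<phi> P" "\<phi> Q"] phi_orth_imp[of "\<phi> P" "\<phi> Q" P Q]
    ang[OF assms] kangle_sym[OF ang[OF assms]] assms phi_KI KI_kproj by blast

lemma phi_commute:
  assumes "P \<in> KI" "Q \<in> KI"
  shows "(\<forall>x. \<phi> P (\<phi> Q x) = \<phi> Q (\<phi> P x)) \<longleftrightarrow> (\<forall>x. P (Q x) = Q (P x))"
  using kangle_commute[of P Q "\<phi> P" "\<phi> Q"] kangle_commute[of "\<phi> P" "\<phi> Q" P Q]
    ang[OF assms] kangle_sym[OF ang[OF assms]] assms phi_KI KI_kproj by blast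

lemma phi_II:
  assumes "P \<in> KI"
  shows "\<phi> P \<in> II \<longleftrightarrow> P \<in> II"
proof -
  have "(\<exists>S\<in>KI. korth S (\<phi> P)) \<longleftrightarrow> (\<exists>S\<in>KI. korth (\<phi> S) (\<phi> P))"
    using surj by (metis (no_types, lifting) image_iff)
  also have "\<dots> \<longleftrightarrow> (\<exists>S\<in>KI. korth S P)" using phi_orth assms by auto
  finally show ?thesis using assms phi_KI by (simp add: II_iff_orth)
qed

lemma phi_II_ex:
  assumes "P' \<in> II"
  obtains P where "P \<in> II" "P' = \<phi> P"
proof -
  have "P' \<in> \<phi> ` KI" using assms surj II_KI by blast
  then obtain P where "P \<in> KI" "P' = \<phi> P" by blast
  then show ?thesis using that assms phi_II by blast
qed

lemma phi_image_II: "\<phi> ` II = II"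
proof (intro subset_antisym subsetI)
  fix P' assume "P' \<in> II"
  then obtain P where "P \<in> II" "P' = \<phi> P" by (rule phi_II_ex)
  then show "P' \<in> \<phi> ` II" by blast
qed (use phi_II II_KI in blast)

lemma phi_kle:
  assumes P: "P \<in> II" and Q: "Q \<in> II"
  shows "kle (\<phi> P) (\<phi> Q) \<longleftrightarrow> kle P Q"
proof -
  note k = II_KI[OF P] II_KI[OF Q]
  have "\<phi> Q \<in> II" using phi_II k Q by blast
  then have "kle (\<phi> P) (\<phi> Q) \<longleftrightarrow> (\<forall>S\<in>KI. korth S (\<phi> Q) \<longrightarrow> korth S (\<phi> P))"
    using kle_iff_orth phi_KI KI_kproj k by blast
  also have "\<dots> \<longleftrightarrow> (\<forall>S\<in>KI. korth (\<phi> S) (\<phi> Q) \<longrightarrow> korth (\<phi> S) (\<phi> P))"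
    using surj by (metis (no_types, lifting) image_iff)
  also have "\<dots> \<longleftrightarrow> (\<forall>S\<in>KI. korth S Q \<longrightarrow> korth S P)" using phi_orth k by auto
  also have "\<dots> \<longleftrightarrow> kle P Q" using kle_iff_orth[OF II_kproj[OF P] Q] by simp
  finally show ?thesis .
qed

lemma phi_inj: "P \<in> II \<Longrightarrow> Q \<in> II \<Longrightarrow> \<phi> P = \<phi> Q \<Longrightarrow> P = Q"
proof -
  assume PQ: "P \<in> II" "Q \<in> II" "\<phi> P = \<phi> Q"
  then have "kproj (\<phi> P)" using phi_KI II_KI KI_kproj by blast
  then have "kle (\<phi> P) (\<phi> Q)" "kle (\<phi> Q) (\<phi> P)" using kle_refl PQ(3) by auto
  then show ?thesis using phi_kle PQ kle_antisym II_kproj by blast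
qed

lemma phi_covers:
  assumes P: "P \<in> II" and Q: "Q \<in> II"
  shows "covers (\<phi> P) (\<phi> Q) \<longleftrightarrow> covers P Q"
proof -
  have "(\<forall>L\<in>II. kle (\<phi> P) L \<longrightarrow> kle L (\<phi> Q) \<longrightarrow> L = \<phi> P \<or> L = \<phi> Q) \<longleftrightarrow>
    (\<forall>L\<in>II. kle (\<phi> P) (\<phi> L) \<longrightarrow> kle (\<phi> L) (\<phi> Q) \<longrightarrow> \<phi> L = \<phi> P \<or> \<phi> L = \<phi> Q)"
  proof -
    have "(\<forall>L\<in>\<phi> ` II. X L) \<longleftrightarrow> (\<forall>L\<in>II. X (\<phi> L))" for X by blast
    then show ?thesis unfolding phi_image_II .
  qed
  also have "\<dots> \<longleftrightarrow> (\<forall>L\<in>II. kle P L \<longrightarrow> kle L Q \<longrightarrow> L = P \<or> L = Q)"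
  proof (intro ball_cong refl)
    fix L assume L: "L \<in> II"
    show "(kle (\<phi> P) (\<phi> L) \<longrightarrow> kle (\<phi> L) (\<phi> Q) \<longrightarrow> \<phi> L = \<phi> P \<or> \<phi> L = \<phi> Q) \<longleftrightarrow>
      (kle P L \<longrightarrow> kle L Q \<longrightarrow> L = P \<or> L = Q)"
      using phi_kle[OF P L] phi_kle[OF L Q] phi_inj[OF L P] phi_inj[OF L Q] by blast
  qed
  finally show ?thesis unfolding covers_def using phi_kle[OF P Q] phi_inj[OF P Q] by blast
qed

text \<open>The orthogonal sum is the least upper bound in \<open>II\<close>, and
  \<open>\<phi>\<close> is an order automorphism of \<open>II\<close>. Surjectivity provides L: the
  sum of the images is itself an image, so minimality can be tested before applying
  \<open>\<phi>\<close>.\<close>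

lemma phi_sum:
  assumes P: "P \<in> II" and S: "S \<in> II" and o: "korth P S" and PS: "(\<lambda>x. P x + S x) \<in> II"
  shows "\<phi> (\<lambda>x. P x + S x) = (\<lambda>x. \<phi> P x + \<phi> S x)"
proof -
  let ?T = "\<lambda>x. P x + S x" and ?L = "\<lambda>x. \<phi> P x + \<phi> S x"
  have I: "\<phi> P \<in> II" "\<phi> S \<in> II" "\<phi> ?T \<in> II" using phi_II P S PS II_KI by auto
  note k = II_kproj[OF P] II_kproj[OF S] II_kproj[OF PS] and k' = I[THEN II_kproj]
  have sum_kle: "kle A (\<lambda>x. A x + B x)" "kle B (\<lambda>x. A x + B x)"
    if "kproj A" "kproj B" "korth A B" for A B
    using that kproj_orth_sym[OF that(1,2)] by (auto simp: kle_def korth_def kproj_idem)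
  have o': "korth (\<phi> P) (\<phi> S)" using phi_orth P S o II_KI by blast
  have kL: "kproj ?L" using o' k' by (intro kproj_orth_sum) (auto simp: korth_def)
  have "kle (\<phi> P) (\<phi> ?T)" "kle (\<phi> S) (\<phi> ?T)"
    using phi_kle P S PS sum_kle[OF k(1,2) o] by auto
  then have LT: "kle ?L (\<phi> ?T)" by (simp add: kle_def kproj_add[OF k'(3)])
  have "?L \<in> II" using II_between[OF II_KI[OF I(1)] kL I(3)] sum_kle[OF k'(1,2) o'] LT by blast
  then obtain L where L: "L \<in> II" "?L = \<phi> L" by (rule phi_II_ex)
  have "kle P L" "kle S L" using sum_kle[OF k'(1,2) o'] L phi_kle P S by auto
  then have "kle ?T L" by (simp add: kle_def kproj_add[OF II_kproj[OF L(1)]])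
  then have "kle (\<phi> ?T) ?L" using phi_kle PS L by simp
  then show ?thesis using LT kle_antisym kL k'(3) by blast
qed

section \<open>The induced map of rank-one projections\<close>

lemma phi_rk1:
  assumes P: "P \<in> II" and e: "norm e = 1" "P e = 0"
  shows "\<exists>a. norm a = 1 \<and> \<phi> P a = 0 \<and> \<phi> (\<lambda>x. P x + rk1 e x) = (\<lambda>x. \<phi> P x + rk1 a x)"
proof -
  have Q: "(\<lambda>x. P x + rk1 e x) \<in> II" using II_plus_rk1[OF P e] .
  have "covers P (\<lambda>x. P x + rk1 e x)" using covers_iff[OF P Q] e by blast
  then have "covers (\<phi> P) (\<phi> (\<lambda>x. P x + rk1 e x))" using phi_covers[OF P Q] by blast
  then show ?thesis using covers_iff[of "\<phi> P" "\<phi> (\<lambda>x. P x + rk1 e x)"] phi_II P Q II_KI by metis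
qed

text \<open>For P in \<open>II\<close> and a unit vector e in its kernel, \<open>phi_rk1\<close>
  makes this a rank-one projection, the candidate for the image of \<open>rk1 e\<close>. A priori it
  depends on P.\<close>

definition jump :: "('a \<Rightarrow> 'a) \<Rightarrow> 'a \<Rightarrow> 'a \<Rightarrow> 'a" where
  "jump P e x = \<phi> (\<lambda>x. P x + rk1 e x) x - \<phi> P x"

lemma jump_sum:
  assumes P: "P \<in> II" and S: "S \<in> II" and o: "korth P S" and PS: "(\<lambda>x. P x + S x) \<in> II"
    and e: "norm e = 1" "P e = 0" "S e = 0"
  shows "jump (\<lambda>x. P x + S x) e = jump P e"
proof
  fix x
  have Pe: "(\<lambda>x. P x + rk1 e x) \<in> II" using II_plus_rk1[OF P e(1,2)] .
  have PSe: "(\<lambda>x. (P x + S x) + rk1 e x) \<in> II" using II_plus_rk1[OF PS e(1)] e by simp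
  have eq: "(\<lambda>x. (P x + S x) + rk1 e x) = (\<lambda>x. (P x + rk1 e x) + S x)" by (simp add: algebra_simps)
  have "korth (\<lambda>x. P x + rk1 e x) S"
    using o rk1_zero(2)[OF II_kproj[OF S] e(3)] by (simp add: korth_def)
  then have "\<phi> (\<lambda>x. (P x + rk1 e x) + S x) = (\<lambda>x. \<phi> (\<lambda>x. P x + rk1 e x) x + \<phi> S x)"
    using phi_sum[OF Pe S] PSe unfolding eq by blast
  then show "jump (\<lambda>x. P x + S x) e x = jump P e x"
    unfolding jump_def eq phi_sum[OF P S o PS] by simp
qed

lemma jump_sub:
  assumes P: "P \<in> II" and A: "A \<in> II" "kle A P" and PA: "(\<lambda>x. P x - A x) \<in> KI" and e: "norm e = 1" "P e = 0"
  shows "jump P e = jump A e"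
proof -
  note k = II_kproj[OF P] II_kproj[OF A(1)]
  let ?S = "\<lambda>x. P x - A x"
  have Ae: "A e = 0" using kle_left[OF k(2,1) A(2), of e] e kproj_zero[OF k(2)] by simp
  have "kle ?S P" using A(2) by (simp add: kle_def kproj_diff[OF k(1)] kproj_idem[OF k(1)])
  then have S: "?S \<in> II" using II_between[OF PA KI_kproj[OF PA] P kle_refl[OF KI_kproj[OF PA]]] by blast
  have o: "korth A ?S" using kle_left[OF k(2,1) A(2)] by (simp add: korth_def kproj_diff[OF k(2)] kproj_idem[OF k(2)])
  have "(\<lambda>x. A x + ?S x) = P" by simp
  then show ?thesis using jump_sum[OF A(1) S o _ e(1) Ae] P e Ae by simp
qed

text \<open>P and Q may have no common upper bound in \<open>II\<close>, so orthogonal blocks A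
  below P and B below Q mediate: the jump stays the same along P, A, \<open>A + B\<close>, B, Q,
  where each step adds or removes an orthogonal summand.\<close>

lemma jump_indep:
  assumes P: "P \<in> II" and Q: "Q \<in> II" and e: "norm e = 1" "P e = 0" "Q e = 0"
  shows "jump P e = jump Q e"
proof -
  obtain A B where AB: "A \<in> II" "B \<in> II" "kle A P" "kle B Q" "korth A B"
    "(\<lambda>x. A x + B x) \<in> II" "(\<lambda>x. P x - A x) \<in> KI" "(\<lambda>x. Q x - B x) \<in> KI"
    by (rule orth_blocks[OF II_KI[OF P] II_KI[OF Q] finite.emptyI]) blast
  note k = II_kproj[OF P] II_kproj[OF Q] II_kproj[OF AB(1)] II_kproj[OF AB(2)]
  have Ae: "A e = 0" using kle_left[OF k(3,1) AB(3), of e] e kproj_zero[OF k(3)] by simp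
  have Be: "B e = 0" using kle_left[OF k(4,2) AB(4), of e] e kproj_zero[OF k(4)] by simp
  have "jump P e = jump A e" using jump_sub[OF P AB(1,3,7) e(1,2)] .
  also have "\<dots> = jump (\<lambda>x. A x + B x) e" using jump_sum[OF AB(1,2,5,6) e(1) Ae Be] by simp
  also have "(\<lambda>x. A x + B x) = (\<lambda>x. B x + A x)" by (simp add: add.commute)
  also have "jump (\<lambda>x. B x + A x) e = jump B e"
    using jump_sum[OF AB(2,1) korth_sym[OF k(3,4) AB(5)] _ e(1) Be Ae] AB(6) by (simp add: add.commute)
  also have "\<dots> = jump Q e" using jump_sub[OF Q AB(2,4,8) e(1,3)] by simp
  finally show ?thesis .
qed

context
  assumes inf_dim: "\<not> (\<exists>d. hasdim UNIV d)"
begin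

lemma II_avoid:
  assumes "finite F"
  obtains P where "P \<in> II" "\<And>f. f \<in> F \<Longrightarrow> P f = 0"
proof -
  have "(\<lambda>x. x) \<in> KI" using inf_dim kproj_id by (simp add: KI_def)
  from orth_blocks[OF this this assms] show ?thesis using that by metis
qed

text \<open>A vector is chosen for one base P and transferred to every other base by
  \<open>jump_indep\<close>, so a single \<open>f e\<close> serves all P.\<close>

lemma phi_vectors:
  obtains f where "\<And>e. norm e = 1 \<Longrightarrow> norm (f e) = 1"
    "\<And>P e. P \<in> II \<Longrightarrow> norm e = 1 \<Longrightarrow> P e = 0 \<Longrightarrow> \<phi> P (f e) = 0"
    "\<And>P e. P \<in> II \<Longrightarrow> norm e = 1 \<Longrightarrow> P e = 0 \<Longrightarrow> \<phi> (\<lambda>x. P x + rk1 e x) = (\<lambda>x. \<phi> P x + rk1 (f e) x)"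
proof -
  have "\<exists>a. norm a = 1 \<and> (\<forall>P\<in>II. P e = 0 \<longrightarrow> \<phi> P a = 0 \<and> \<phi> (\<lambda>x. P x + rk1 e x) = (\<lambda>x. \<phi> P x + rk1 a x))"
    if e: "norm e = 1" for e
  proof -
    obtain P where P: "P \<in> II" "P e = 0" using II_avoid[of "{e}"] by auto
    obtain a where a: "norm a = 1" "\<phi> (\<lambda>x. P x + rk1 e x) = (\<lambda>x. \<phi> P x + rk1 a x)"
      using phi_rk1[OF P(1) e P(2)] by blast
    have Ja: "jump P e = rk1 a" using a(2) by (auto simp: jump_def)
    have "\<phi> Q a = 0 \<and> \<phi> (\<lambda>x. Q x + rk1 e x) = (\<lambda>x. \<phi> Q x + rk1 a x)" if Q: "Q \<in> II" "Q e = 0" for Q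
    proof -
      obtain b where b: "norm b = 1" "\<phi> Q b = 0" "\<phi> (\<lambda>x. Q x + rk1 e x) = (\<lambda>x. \<phi> Q x + rk1 b x)"
        using phi_rk1[OF Q(1) e Q(2)] by blast
      have "jump Q e = rk1 b" using b(3) by (auto simp: jump_def)
      then have ab: "rk1 a = rk1 b" using jump_indep[OF P(1) Q(1) e P(2) Q(2)] Ja by simp
      have "a = ip a b *\<^sub>K b" using rk1_self[OF a(1)] ab by (simp add: rk1_def)
      moreover have "kproj (\<phi> Q)" using phi_KI II_KI Q(1) KI_kproj by blast
      ultimately have "\<phi> Q a = 0" using b(2) kproj_scale[of "\<phi> Q" "ip a b" b] by simp
      then show ?thesis using b(3) ab by simp
    qed
    then show ?thesis using a(1) by blast
  qed
  then have "\<forall>e. \<exists>a. norm e = 1 \<longrightarrow> norm a = 1 \<and> (\<forall>P\<in>II. P e = 0 \<longrightarrow> \<phi> P a = 0 \<and> \<phi> (\<lambda>x. P x + rk1 e x) = (\<lambda>x. \<phi> P x + rk1 a x))"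
    by blast
  from choice[OF this] obtain f where f: "\<forall>e. norm e = 1 \<longrightarrow> norm (f e) = 1 \<and>
    (\<forall>P\<in>II. P e = 0 \<longrightarrow> \<phi> P (f e) = 0 \<and> \<phi> (\<lambda>x. P x + rk1 e x) = (\<lambda>x. \<phi> P x + rk1 (f e) x))" by blast
  show ?thesis by (rule that[of f]) (use f in auto)
qed

text \<open>Compressing \<open>P + rk1 e\<close> by \<open>P + rk1 g\<close> turns the transition
  probability of e and g into an eigenvalue, which unitary equivalence preserves.\<close>

lemma compress_plus_rk1:
  assumes P: "kproj P" and e: "norm e = 1" "P e = 0" and g: "norm g = 1" "P g = 0"
  shows "P (P (P x + rk1 g x) + rk1 e (P x + rk1 g x)) + rk1 g (P (P x + rk1 g x) + rk1 e (P x + rk1 g x))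
    = P x + of_real ((norm (ip e g))\<^sup>2) *\<^sub>K rk1 g x"
proof -
  note ke = rk1_kproj[OF e(1)] and kg = rk1_kproj[OF g(1)]
  have "rk1 g (rk1 e (rk1 g x)) = (ip g e * ip e g) *\<^sub>K rk1 g x"
    by (simp add: rk1_def ip_scale_left scale_scale mult.assoc)
  also have "ip g e * ip e g = of_real ((norm (ip e g))\<^sup>2)"
    using ip_commute[of g e] mult_cj[of "ip e g"] by (simp add: mult.commute)
  finally show ?thesis
    by (simp add: kproj_add[OF P] kproj_add[OF ke] kproj_add[OF kg] kproj_idem[OF P] rk1_zero[OF P e(2)] rk1_zero[OF P g(2)])
qed

theorem infinite_rank_isometry_on_II:
  obtains V W where "isoK V W" "surj V" "\<And>P x. P \<in> II \<Longrightarrow> \<phi> P (V x) = V (P x)"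
proof -
  obtain f where f: "\<And>e. norm e = 1 \<Longrightarrow> norm (f e) = 1"
    "\<And>P e. P \<in> II \<Longrightarrow> norm e = 1 \<Longrightarrow> P e = 0 \<Longrightarrow> \<phi> P (f e) = 0"
    "\<And>P e. P \<in> II \<Longrightarrow> norm e = 1 \<Longrightarrow> P e = 0 \<Longrightarrow> \<phi> (\<lambda>x. P x + rk1 e x) = (\<lambda>x. \<phi> P x + rk1 (f e) x)"
    using phi_vectors by blast
  have "norm (ip (f e) (f g)) = norm (ip e g)" if e: "norm e = 1" and g: "norm g = 1" for e g
  proof -
    obtain P where "P \<in> II" "\<And>f. f \<in> {e, g} \<Longrightarrow> P f = 0" using II_avoid[of "{e, g}"] by blast
    then have P: "P \<in> II" "P e = 0" "P g = 0" by auto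
    let ?E = "\<lambda>x. P x + rk1 e x" and ?G = "\<lambda>x. P x + rk1 g x"
    let ?t = "(norm (ip e g))\<^sup>2" and ?t' = "(norm (ip (f e) (f g)))\<^sup>2"
    have EG: "?E \<in> II" "?G \<in> II" using II_plus_rk1[OF P(1)] e g P by auto
    have fE: "\<phi> ?E = (\<lambda>x. \<phi> P x + rk1 (f e) x)" "\<phi> ?G = (\<lambda>x. \<phi> P x + rk1 (f g) x)"
      using f(3) P e g by auto
    have kP: "kproj P" and kP': "kproj (\<phi> P)" using P(1) II_kproj phi_KI II_KI KI_kproj by auto
    have f0: "\<phi> P (f e) = 0" "\<phi> P (f g) = 0" using f(2) P e g by auto
    obtain U where U: "kunitary U" "U \<circ> (\<phi> ?G \<circ> \<phi> ?E \<circ> \<phi> ?G) = (?G \<circ> ?E \<circ> ?G) \<circ> U"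
      using ang[OF II_KI[OF EG(1)] II_KI[OF EG(2)]] by (auto simp: kangle_eq_def)
    have "U ((\<phi> ?G \<circ> \<phi> ?E \<circ> \<phi> ?G) x) = (?G \<circ> ?E \<circ> ?G) (U x)" for x
      using fun_cong[OF U(2), of x] by (simp only: comp_apply)
    then have eq: "U (\<phi> P x + of_real ?t' *\<^sub>K rk1 (f g) x) = P (U x) + of_real ?t *\<^sub>K rk1 g (U x)" for x
      unfolding fE comp_apply compress_plus_rk1[OF kP e P(2) g P(3)]
        compress_plus_rk1[OF kP' f(1)[OF e] f0(1) f(1)[OF g] f0(2)] .
    have Usc: "U (a *\<^sub>K x) = a *\<^sub>K U x" for a x using U(1) by (simp add: kunitary_def)
    have nU: "norm (U x) = norm x" for x using U(1) by (simp add: kunitary_def)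
    \<comment> \<open>U carries the eigenvector \<open>f g\<close> for \<open>?t'\<close> to an
      eigenvector of \<open>P + ?t rk1 g\<close>, whose possible eigenvalues are 0, 1 and
      \<open>?t\<close>.\<close>
    have c1: "?t' = ?t \<or> ?t' = 0 \<or> ?t' = 1"
    proof (rule eigenvalue_plus_rk1[OF kP g P(3)])
      show "U (f g) \<noteq> 0" using nU[of "f g"] f(1)[OF g] by auto
      show "P (U (f g)) + of_real ?t *\<^sub>K rk1 g (U (f g)) = of_real ?t' *\<^sub>K U (f g)"
        using eq[of "f g"] f0 by (simp add: rk1_self[OF f(1)[OF g]] Usc)
    qed
    have c2: "?t = ?t' \<or> ?t = 0 \<or> ?t = 1"
    proof -
      obtain v where v: "U v = g" using U(1) by (metis kunitary_def surjD)
      have "U (\<phi> P v + of_real ?t' *\<^sub>K rk1 (f g) v) = U (of_real ?t *\<^sub>K v)"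
        using eq[of v] P by (simp add: v rk1_self[OF g] Usc)
      then have "\<phi> P v + of_real ?t' *\<^sub>K rk1 (f g) v = of_real ?t *\<^sub>K v" using kunitary_inj[OF U(1)] by blast
      moreover have "v \<noteq> 0" using nU[of v] v g by auto
      ultimately show ?thesis using eigenvalue_plus_rk1[OF kP' f(1)[OF g] f0(2)] by blast
    qed
    \<comment> \<open>The eigenvalues 0 and 1 may stem from P itself. The value 1 is recognised
      separately, since it means that the two projections coincide; this settles the ambiguity left
      by \<open>c1\<close> and \<open>c2\<close>.\<close>
    have r1: "?t' = 1" if "?t = 1"
    proof -
      have "norm (ip e g) = 1" using that by (simp add: power2_eq_1_iff) (metis norm_ge_zero neg_0_le_iff_le not_one_le_zero)
      then have "rk1 e = rk1 g" using rk1_eqI e g by blast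
      then have "\<phi> ?E = \<phi> ?G" by simp
      then have "rk1 (f e) = rk1 (f g)" unfolding fE by (auto simp: fun_eq_iff)
      then show ?thesis using rk1_eqD f(1) e g by simp
    qed
    have r2: "?t = 1" if "?t' = 1"
    proof -
      have "norm (ip (f e) (f g)) = 1" using that by (simp add: power2_eq_1_iff) (metis norm_ge_zero neg_0_le_iff_le not_one_le_zero)
      then have "rk1 (f e) = rk1 (f g)" using rk1_eqI f(1) e g by blast
      then have "\<phi> ?E = \<phi> ?G" unfolding fE by simp
      then have "?E = ?G" using phi_inj EG by blast
      then have "rk1 e = rk1 g" by (auto simp: fun_eq_iff)
      then show ?thesis using rk1_eqD e g by simp
    qed
    have "?t' = ?t" using c1 c2 r1 r2 by linarith
    then show ?thesis by (simp add: power2_eq_iff_nonneg)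
  qed
  then obtain V where V: "\<And>x y. V (x + y) = V x + V y"
    "(\<forall>a x. V (a *\<^sub>K x) = a *\<^sub>K V x) \<or> (\<forall>a x. V (a *\<^sub>K x) = cj a *\<^sub>K V x)"
    "\<And>x. norm (V x) = norm x" "\<And>x. norm x = 1 \<Longrightarrow> \<exists>c. norm c = 1 \<and> f x = c *\<^sub>K V x"
    using wigner[of f] f(1) by blast
  obtain W where W: "isoK V W" using isometry_adjoint[OF V(1-3)] .
  have lin: "linear V" using isoK_linear[OF W] .
  have rs: "c *\<^sub>K V x \<in> range V" for c x
  proof -
    have "c *\<^sub>K V x = V (c *\<^sub>K x) \<or> c *\<^sub>K V x = V (cj c *\<^sub>K x)" using V(2) by auto
    then show ?thesis by auto
  qed
  \<comment> \<open>Adding \<open>rk1 b\<close> to \<open>\<phi> P\<close> is a covering step, hence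
    the image of a covering step by some e; then b is a multiple of \<open>f e\<close>.\<close>
  have "y \<in> range V" for y
  proof (cases "y = 0")
    case True
    then show ?thesis using linear_0[OF lin] by (metis rangeI)
  next
    case False
    define b where "b = (1 / norm y) *\<^sub>R y"
    have b: "norm b = 1" using False by (simp add: b_def)
    obtain P' where P': "P' \<in> II" "P' b = 0" using II_avoid[of "{b}"] by auto
    obtain P where P: "P \<in> II" "P' = \<phi> P" using P'(1) by (rule phi_II_ex)
    have "(\<lambda>x. P' x + rk1 b x) \<in> II" using II_plus_rk1[OF P'(1) b P'(2)] .
    then obtain Q where Q: "Q \<in> II" "(\<lambda>x. P' x + rk1 b x) = \<phi> Q" by (rule phi_II_ex)
    have "covers (\<phi> P) (\<phi> Q)"
      using covers_iff[of "\<phi> P" "\<phi> Q"] P Q P' b phi_II II_KI by metis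
    then have "covers P Q" using phi_covers P Q by blast
    then obtain e where e: "norm e = 1" "P e = 0" "Q = (\<lambda>x. P x + rk1 e x)" using covers_iff P Q by blast
    have "\<phi> Q = (\<lambda>x. \<phi> P x + rk1 (f e) x)" using f(3)[OF P(1) e(1,2)] e(3) by simp
    then have "rk1 b = rk1 (f e)" using Q(2) P(2) by (auto simp: fun_eq_iff)
    then have "b = ip b (f e) *\<^sub>K f e" using rk1_self[OF b] by (simp add: rk1_def)
    then obtain c where "b = c *\<^sub>K V e" using V(4)[OF e(1)] by (metis scale_scale)
    moreover have "y = of_real (norm y) *\<^sub>K b" using False by (simp add: b_def scale_of_real)
    ultimately have "y = (of_real (norm y) * c) *\<^sub>K V e" by (metis scale_scale)
    then show ?thesis using rs by metis
  qed
  then have sV: "surj V" by blast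
  have unit: "x = norm x *\<^sub>R (x /\<^sub>R norm x)" "norm (x /\<^sub>R norm x) = 1" if "x \<noteq> 0" for x :: 'a
    using that by simp_all
  have "\<phi> P (V x) = V (P x)" if P: "P \<in> II" for P x
  proof -
    have k: "kproj P" and k': "kproj (\<phi> P)" using P II_kproj phi_KI II_KI KI_kproj by auto
    have fV: "f e = c *\<^sub>K V e \<Longrightarrow> norm c = 1 \<Longrightarrow> \<phi> P (V e) = (1 / c) *\<^sub>K \<phi> P (f e)" for c e
    proof -
      assume "f e = c *\<^sub>K V e" "norm c = 1"
      then have "V e = (1 / c) *\<^sub>K f e" by (auto simp: scale_scale)
      then show ?thesis by (simp add: kproj_scale[OF k'])
    qed
    \<comment> \<open>A vector e in the range of P is handled through the base
      \<open>P - rk1 e\<close>, one in the kernel (in \<open>B\<close>) through P itself.\<close>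
    have A: "\<phi> P (V e) = V e" if e: "norm e = 1" "P e = e" for e
    proof -
      let ?P = "\<lambda>x. P x - rk1 e x"
      have P0: "?P \<in> II" using II_minus_rk1[OF P e] .
      have Pe: "?P e = 0" using e by (simp add: rk1_self)
      have "\<phi> P = (\<lambda>x. \<phi> ?P x + rk1 (f e) x)" using f(3)[OF P0 e(1) Pe] by simp
      then have "\<phi> P (f e) = f e" using f(2)[OF P0 e(1) Pe] rk1_self[OF f(1)[OF e(1)]] by simp
      moreover obtain c where c: "norm c = 1" "f e = c *\<^sub>K V e" using V(4)[OF e(1)] by blast
      ultimately have "\<phi> P (V e) = (1 / c) *\<^sub>K c *\<^sub>K V e" using fV by metis
      then show ?thesis using c(1) by (auto simp: scale_scale)
    qed
    have B: "\<phi> P (V e) = 0" if e: "norm e = 1" "P e = 0" for e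
    proof -
      obtain c where c: "norm c = 1" "f e = c *\<^sub>K V e" using V(4)[OF e(1)] by blast
      then show ?thesis unfolding fV[OF c(2,1)] using f(2)[OF P e] by (simp only: K.scale_zero_right)
    qed
    have PR: "P (r *\<^sub>R z) = r *\<^sub>R P z" "\<phi> P (r *\<^sub>R z) = r *\<^sub>R \<phi> P z" "V (r *\<^sub>R z) = r *\<^sub>R V z" for r z
      using linear_scale[OF lin] linear_scale[OF kproj_linear[OF k]] linear_scale[OF kproj_linear[OF k']] by auto
    have A': "\<phi> P (V u) = V u" if "P u = u" for u
    proof (cases "u = 0")
      case False
      have "P (u /\<^sub>R norm u) = u /\<^sub>R norm u" using that by (simp add: PR)
      then have "\<phi> P (V (u /\<^sub>R norm u)) = V (u /\<^sub>R norm u)" using A unit[OF False] by blast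
      then have "\<phi> P (V (norm u *\<^sub>R (u /\<^sub>R norm u))) = V (norm u *\<^sub>R (u /\<^sub>R norm u))" by (simp only: PR)
      then show ?thesis using unit[OF False] by simp
    qed (simp add: linear_0[OF lin] kproj_zero[OF k'])
    have B': "\<phi> P (V u) = 0" if "P u = 0" for u
    proof (cases "u = 0")
      case False
      have "P (u /\<^sub>R norm u) = 0" using that by (simp add: PR)
      then have "\<phi> P (V (u /\<^sub>R norm u)) = 0" using B unit[OF False] by blast
      then have "\<phi> P (V (norm u *\<^sub>R (u /\<^sub>R norm u))) = 0" by (simp only: PR) simp
      then show ?thesis using unit[OF False] by simp
    qed (simp add: linear_0[OF lin] kproj_zero[OF k'])
    have "V x = V (P x) + V (x - P x)" using V(1)[of "P x" "x - P x"] by simp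
    then have "\<phi> P (V x) = \<phi> P (V (P x)) + \<phi> P (V (x - P x))" by (simp add: kproj_add[OF k'])
    also have "\<dots> = V (P x)" using A'[of "P x"] B'[of "x - P x"] by (simp add: kproj_idem[OF k] kproj_diff[OF k])
    finally show ?thesis .
  qed
  then show ?thesis using that W sV by blast
qed

text \<open>For P of finite corank, commutation shows that \<open>\<phi> P\<close> fixes or kills
  \<open>V x\<close> for each x in the range of P. Comparing additive subgroups makes the
  alternative uniform, and killing is excluded by an element of \<open>II\<close> below P. The same
  argument backwards shows that no further \<open>V x\<close> are fixed.\<close>

theorem infinite_rank_preserver: "\<exists>V W. isoK V W \<and> surj V \<and> (\<forall>P\<in>KI. \<phi> P = V \<circ> P \<circ> W)"
proof -
  obtain V W where V: "isoK V W" "surj V" "\<And>P x. P \<in> II \<Longrightarrow> \<phi> P (V x) = V (P x)"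
    using infinite_rank_isometry_on_II by blast
  have lin: "linear V" using isoK_linear[OF V(1)] .
  have nV: "norm (V x) = norm x" for x using V(1) by (simp add: isoK_def)
  have WV: "W (V x) = x" for x using isoK_left_inverse[OF V(1)] .
  have VW: "V (W y) = y" for y using V(2) WV by (metis surjD)
  have Vdiff: "V (x - y) = V x - V y" for x y using linear_diff[OF lin] .
  have Vinj: "V x = V y \<Longrightarrow> x = y" for x y using WV by metis
  have rkV: "rk1 (V z) (V x) = V (rk1 z x)" for z x using isoK_rk1[OF V(1), of z "V x"] WV by simp
  have "\<phi> P (V x) = V (P x)" if P: "P \<in> KI" for P x
  proof (cases "P \<in> II")
    case True
    then show ?thesis using V(3) by blast
  next
    case False
    have k: "kproj P" and k': "kproj (\<phi> P)" and P': "\<phi> P \<in> KI" using P phi_KI KI_kproj by auto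
    let ?N = "{x. P x = x}" and ?N' = "{x. \<phi> P (V x) = V x}"
    have d1: "x - y \<in> ?N" if "x \<in> ?N" "y \<in> ?N" for x y using that by (simp add: kproj_diff[OF k])
    have d2: "x - y \<in> ?N'" if "x \<in> ?N'" "y \<in> ?N'" for x y using that by (simp add: Vdiff kproj_diff[OF k'])
    have d3: "x - y \<in> {x. P x = 0}" if "x \<in> {x. P x = 0}" "y \<in> {x. P x = 0}" for x y
      using that by (simp add: kproj_diff[OF k])
    have d4: "x - y \<in> {x. \<phi> P (V x) = 0}" if "x \<in> {x. \<phi> P (V x) = 0}" "y \<in> {x. \<phi> P (V x) = 0}" for x y
      using that by (simp add: Vdiff kproj_diff[OF k'])
    have sc: "P (r *\<^sub>R z) = r *\<^sub>R P z" "\<phi> P (r *\<^sub>R z) = r *\<^sub>R \<phi> P z" "V (r *\<^sub>R z) = r *\<^sub>R V z" for r z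
      using linear_scale[OF lin] linear_scale[OF kproj_linear[OF k]] linear_scale[OF kproj_linear[OF k']] by auto
    have unit: "norm (x /\<^sub>R norm x) = 1" if "x \<noteq> 0" for x :: 'a using that by simp
    have V0: "V 0 = 0" using linear_0[OF lin] .
    \<comment> \<open>On \<open>II\<close> the map is already conjugation by V, so
      \<open>\<phi> A\<close> times \<open>\<phi> B\<close> is \<open>rk1 (V x)\<close>, and
      \<open>\<phi> P\<close> commutes with both factors.\<close>
    have u1: "\<phi> P (V x) = V x \<or> \<phi> P (V x) = 0" if x: "norm x = 1" "P x = x" for x
    proof -
      obtain A B where AB: "A \<in> II" "B \<in> II" "\<And>x. P (A x) = A (P x)" "\<And>x. P (B x) = B (P x)"
        "\<And>z. A (B z) = rk1 x z" using rk1_product[OF P x] by blast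
      have c: "\<phi> P (\<phi> A y) = \<phi> A (\<phi> P y)" "\<phi> P (\<phi> B y) = \<phi> B (\<phi> P y)" for y
        using phi_commute[OF P II_KI[OF AB(1)]] phi_commute[OF P II_KI[OF AB(2)]] AB(3,4) by auto
      have "\<phi> A (\<phi> B y) = rk1 (V x) y" for y
        using V(3)[OF AB(1)] V(3)[OF AB(2)] VW AB(5) rkV by metis
      then have "\<phi> P (rk1 (V x) y) = rk1 (V x) (\<phi> P y)" for y using c by metis
      moreover have "norm (V x) = 1" using nV x by simp
      ultimately show ?thesis using commutes_rk1[OF k'] by blast
    qed
    have u2: "P x = x \<or> P x = 0" if x: "norm x = 1" "\<phi> P (V x) = V x" for x
    proof -
      have "norm (V x) = 1" using nV x by simp
      then obtain A' B' where AB': "A' \<in> II" "B' \<in> II" "\<And>x. \<phi> P (A' x) = A' (\<phi> P x)" "\<And>x. \<phi> P (B' x) = B' (\<phi> P x)"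
        "\<And>z. A' (B' z) = rk1 (V x) z" using rk1_product[OF P' _ x(2)] by blast
      obtain A where A: "A \<in> II" "A' = \<phi> A" using AB'(1) by (rule phi_II_ex)
      obtain B where B: "B \<in> II" "B' = \<phi> B" using AB'(2) by (rule phi_II_ex)
      have c: "P (A y) = A (P y)" "P (B y) = B (P y)" for y
        using phi_commute[OF P II_KI[OF A(1)]] phi_commute[OF P II_KI[OF B(1)]] AB'(3,4) A(2) B(2) by auto
      have "A (B y) = rk1 x y" for y
      proof (rule Vinj)
        have "V (A (B y)) = \<phi> A (\<phi> B (V y))" using V(3) A(1) B(1) by simp
        also have "\<dots> = rk1 (V x) (V y)" using AB'(5) A(2) B(2) by simp
        finally show "V (A (B y)) = V (rk1 x y)" using rkV by simp
      qed
      then have "P (rk1 x y) = rk1 x (P y)" for y using c by metis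
      then show ?thesis using commutes_rk1[OF k x(1)] by blast
    qed
    have "?N \<subseteq> ?N' \<union> {x. \<phi> P (V x) = 0}"
    proof
      fix x assume x: "x \<in> ?N"
      show "x \<in> ?N' \<union> {x. \<phi> P (V x) = 0}"
      proof (cases "x = 0")
        case False
        then have "\<phi> P (V (x /\<^sub>R norm x)) = V (x /\<^sub>R norm x) \<or> \<phi> P (V (x /\<^sub>R norm x)) = 0"
          using u1[OF unit[OF False]] x by (simp add: sc)
        then show ?thesis using False by (simp add: sc)
      qed (simp add: V0 kproj_zero[OF k'])
    qed
    then have "?N \<subseteq> ?N' \<or> ?N \<subseteq> {x. \<phi> P (V x) = 0}" 
      by (rule additive_unionE[rotated 3]) (erule (1) d2, erule (1) d4, erule (1) d1)
    moreover have "\<not> ?N \<subseteq> {x. \<phi> P (V x) = 0}"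
    proof
      assume z: "?N \<subseteq> {x. \<phi> P (V x) = 0}"
      obtain A where A: "A \<in> II" "kle A P" by (rule orth_blocks[OF P P finite.emptyI]) blast
      have "\<phi> P (\<phi> A y) = 0" for y
      proof -
        have "\<phi> A y = V (A (W y))" using V(3)[OF A(1), of "W y"] VW by simp
        moreover have "A (W y) \<in> ?N" using A(2) by (simp add: kle_def)
        ultimately show ?thesis using z by auto
      qed
      then have "korth (\<phi> P) (\<phi> A)" by (simp add: korth_def)
      then have "korth P A" using phi_orth P A II_KI by blast
      then have "A x = 0" for x using A(2) by (simp add: korth_def kle_def)
      then have "A = PS {}" by (auto simp: PS_def)
      moreover have "kon {}" by (simp add: kon_def)
      ultimately show False using II_KI[OF A(1)] unfolding KI_iff by blast
    qed
    ultimately have N1: "?N \<subseteq> ?N'" by blast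
    have "?N' \<subseteq> ?N \<union> {x. P x = 0}"
    proof
      fix x assume x: "x \<in> ?N'"
      show "x \<in> ?N \<union> {x. P x = 0}"
      proof (cases "x = 0")
        case False
        then have "P (x /\<^sub>R norm x) = x /\<^sub>R norm x \<or> P (x /\<^sub>R norm x) = 0"
          using u2[OF unit[OF False]] x by (simp add: sc)
        then show ?thesis using False by (simp add: sc)
      qed (simp add: kproj_zero[OF k])
    qed
    then have "?N' \<subseteq> ?N \<or> ?N' \<subseteq> {x. P x = 0}" 
      by (rule additive_unionE[rotated 3]) (erule (1) d1, erule (1) d3, erule (1) d2)
    moreover have "\<not> ?N' \<subseteq> {x. P x = 0}"
    proof
      assume "?N' \<subseteq> {x. P x = 0}"
      moreover obtain u where "norm u = 1" "P u = u" using KI_unit[OF P, of "{}"] by auto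
      ultimately show False using N1 by auto
    qed
    ultimately have N2: "?N' \<subseteq> ?N" by blast
    \<comment> \<open>\<open>\<phi> P (V w)\<close> is \<open>V z\<close> for some z in the range of
      P, and that range is orthogonal to w.\<close>
    have Z: "\<phi> P (V w) = 0" if w: "P w = 0" for w
    proof -
      define z where "z = W (\<phi> P (V w))"
      have Vz: "V z = \<phi> P (V w)" by (simp add: z_def VW)
      then have "z \<in> ?N'" by (simp add: kproj_idem[OF k'])
      then have Pz: "P z = z" using N2 by blast
      have "inner (V z) (V z) = inner (\<phi> P (V w)) (V z)" using Vz by simp
      also have "\<dots> = inner (V w) (\<phi> P (V z))" by (simp add: inner_ip kproj_sa[OF k'])
      also have "\<phi> P (V z) = V z" using Vz by (simp add: kproj_idem[OF k'])
      also have "inner (V w) (V z) = inner w z" using isometry_inner[OF lin nV] .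
      also have "\<dots> = inner w (P z)" using Pz by simp
      also have "\<dots> = inner (P w) z" by (simp add: inner_ip kproj_sa[OF k])
      finally have "inner (V z) (V z) = 0" using w by simp
      then show ?thesis using Vz by simp
    qed
    have "V x = V (P x) + V (x - P x)" by (simp add: Vdiff)
    then have "\<phi> P (V x) = \<phi> P (V (P x)) + \<phi> P (V (x - P x))" by (simp add: kproj_add[OF k'])
    also have "\<phi> P (V (P x)) = V (P x)" using N1 kproj_idem[OF k] by blast
    also have "\<phi> P (V (x - P x)) = 0" by (rule Z) (simp add: kproj_diff[OF k] kproj_idem[OF k])
    finally show ?thesis by simp
  qed
  then have "\<phi> P = V \<circ> P \<circ> W" if "P \<in> KI" for P
    using that VW by (auto simp: fun_eq_iff) metis
  then show ?thesis using V(1,2) by blast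
qed

end

end

end

section \<open>The real and the complex case\<close>

lemma real_kspace: "kspace (scaleR :: real \<Rightarrow> 'a::{real_inner, complete_space} \<Rightarrow> 'a) inner (\<lambda>x. x) (\<lambda>x. x)"
proof
  show "\<exists>F::real set. finite F \<and> span F = UNIV"
    by (intro exI[of _ "{1}"]) (auto simp: span_singleton intro: range_eqI[of _ _ x for x])
qed (auto simp: algebra_simps inner_add_left inner_commute power2_eq_square)

lemma complex_kspace: "kspace (scaleC :: complex \<Rightarrow> 'b::{complex_inner, complete_space} \<Rightarrow> 'b) cinner cnj Re"
proof
  show "\<exists>F::complex set. finite F \<and> span F = UNIV"
  proof (intro exI[of _ "{1, \<i>}"] conjI)
    have "z \<in> span {1, \<i>}" for z :: complex
    proof -
      have "z = Re z *\<^sub>R 1 + Im z *\<^sub>R \<i>" by (simp add: complex_eq_iff)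
      moreover have "Re z *\<^sub>R 1 + Im z *\<^sub>R \<i> \<in> span {1, \<i>}"
        by (intro span_add span_scale span_base) auto
      ultimately show ?thesis by simp
    qed
    then show "span {1, \<i>} = (UNIV :: complex set)" by blast
  qed simp
  show "a = of_real (Re a)" if "cnj a = a" for a using that by (simp add: complex_eq_iff)
  \<comment> \<open>Real part and modulus leave only the sign of the imaginary part open.\<close>
  show "a = b \<or> a = cnj b" if "Re a = Re b" "norm a = norm b" for a b
  proof -
    have "(Im a)\<^sup>2 = (Im b)\<^sup>2" using that by (simp add: cmod_def)
    then have "Im a = Im b \<or> Im a = - Im b" by (rule power2_eq_iff[THEN iffD1])
    then show ?thesis using that by (auto simp: complex_eq_iff)
  qed
  show "a * cnj a = of_real ((norm a)\<^sup>2)" for a by (rule complex_norm_square[symmetric])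
qed (simp_all add: scaleC_add_right scaleC_add_left scaleC_scaleC scaleC_of_real cinner_add_left
    cinner_scaleC_left inner_cinner, rule cinner_commute)

theorem mainTheorem1:
  fixes R :: "'a::{real_inner, complete_space} itself"
    and C :: "'b::{complex_inner, complete_space} itself"
  shows
  \<comment> \<open>real Hilbert space, rank n\<close>
  "(\<forall>(n::nat) (\<phi>::('a \<Rightarrow> 'a) \<Rightarrow> ('a \<Rightarrow> 'a)).
      rdim_ge TYPE('a) n
      \<and> (\<forall>P\<in>rProj n. \<phi> P \<in> rProj n)
      \<and> (\<forall>P\<in>rProj n. \<forall>Q\<in>rProj n. rangle_eq (\<phi> P) (\<phi> Q) P Q)
      \<and> (n = 1 \<or> \<not> rhas_dim (UNIV::'a set) (2 * n))
      \<longrightarrow> (\<exists>V W. linear V \<and> (\<forall>x. norm (V x) = norm x) \<and> radjoint V W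
              \<and> (\<forall>P\<in>rProj n. \<phi> P = V \<circ> P \<circ> W)))
   \<and>
  \<comment> \<open>complex Hilbert space, rank n\<close>
   (\<forall>(n::nat) (\<phi>::('b \<Rightarrow> 'b) \<Rightarrow> ('b \<Rightarrow> 'b)).
      cdim_ge TYPE('b) n
      \<and> (\<forall>P\<in>cProj n. \<phi> P \<in> cProj n)
      \<and> (\<forall>P\<in>cProj n. \<forall>Q\<in>cProj n. cangle_eq (\<phi> P) (\<phi> Q) P Q)
      \<and> (n = 1 \<or> \<not> chas_dim (UNIV::'b set) (2 * n))
      \<longrightarrow> (\<exists>V W. ((clinear V \<and> cadjoint V W) \<or> (cantilinear V \<and> cantiadjoint V W))
              \<and> (\<forall>x. norm (V x) = norm x)
              \<and> (\<forall>P\<in>cProj n. \<phi> P = V \<circ> P \<circ> W)))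
   \<and>
  \<comment> \<open>real Hilbert space, infinite rank\<close>
   (\<forall>\<phi>::('a \<Rightarrow> 'a) \<Rightarrow> ('a \<Rightarrow> 'a).
      \<not> (\<exists>d. rhas_dim (UNIV::'a set) d)
      \<and> \<phi> ` rProj_inf = rProj_inf
      \<and> (\<forall>P\<in>rProj_inf. \<forall>Q\<in>rProj_inf. rangle_eq (\<phi> P) (\<phi> Q) P Q)
      \<longrightarrow> (\<exists>U W. runitary U \<and> radjoint U W \<and> (\<forall>P\<in>rProj_inf. \<phi> P = U \<circ> P \<circ> W)))
   \<and>
  \<comment> \<open>complex Hilbert space, infinite rank\<close>
   (\<forall>\<phi>::('b \<Rightarrow> 'b) \<Rightarrow> ('b \<Rightarrow> 'b).
      \<not> (\<exists>d. chas_dim (UNIV::'b set) d)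
      \<and> \<phi> ` cProj_inf = cProj_inf
      \<and> (\<forall>P\<in>cProj_inf. \<forall>Q\<in>cProj_inf. cangle_eq (\<phi> P) (\<phi> Q) P Q)
      \<longrightarrow> (\<exists>U W. ((cunitary U \<and> cadjoint U W) \<or> (cantiunitary U \<and> cantiadjoint U W))
              \<and> (\<forall>P\<in>cProj_inf. \<phi> P = U \<circ> P \<circ> W)))"
proof -
  interpret R: kspace "scaleR :: real \<Rightarrow> 'a \<Rightarrow> 'a" inner "\<lambda>x. x" "\<lambda>x. x" by (rule real_kspace)
  interpret C: kspace "scaleC :: complex \<Rightarrow> 'b \<Rightarrow> 'b" cinner cnj Re by (rule complex_kspace)
  \<comment> \<open>The notions of the statement are identified with the two instances of
    \<open>kspace\<close>; each clause then is an instance of \<open>rank_n_preserver\<close> or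
    \<open>infinite_rank_preserver\<close>.\<close>
  have rp: "rproj = (R.kproj :: ('a \<Rightarrow> 'a) \<Rightarrow> bool)"
  proof (rule ext, rule iffI)
    fix P :: "'a \<Rightarrow> 'a" assume "rproj P"
    then show "R.kproj P"
      unfolding rproj_def R.kproj_def
      by (auto simp: linear_add linear_scale bounded_linear.linear fun_eq_iff)
  next
    fix P :: "'a \<Rightarrow> 'a" assume P: "R.kproj P"
    have "bounded_linear P"
      by (rule bounded_linear_intro[of P 1, OF R.kproj_add[OF P] R.kproj_scale[OF P]])
        (simp only: mult_1_right R.kproj_norm_le[OF P])
    then show "rproj P" using P unfolding rproj_def R.kproj_def by auto
  qed
  have rd: "rhas_dim = (R.hasdim :: 'a set \<Rightarrow> nat \<Rightarrow> bool)"
    by (intro ext) (simp add: rhas_dim_def R.hasdim_def dependent_raw_def span_raw_def)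
  have rP: "rProj n = (R.KP n :: ('a \<Rightarrow> 'a) set)" for n by (simp add: rProj_def R.KP_def rp rd)
  have rI: "rProj_inf = (R.KI :: ('a \<Rightarrow> 'a) set)" by (simp add: rProj_inf_def R.KI_def rp rd)
  have ru: "runitary = (R.kunitary :: ('a \<Rightarrow> 'a) \<Rightarrow> bool)"
    by (intro ext) (auto simp: runitary_def R.kunitary_def linear_iff)
  have ra: "rangle_eq = (R.kangle_eq :: ('a \<Rightarrow> 'a) \<Rightarrow> _)"
    by (intro ext) (simp add: rangle_eq_def R.kangle_eq_def ru)
  have ri: "linear V \<and> (\<forall>x. norm (V x) = norm x) \<and> radjoint V W" if "R.isoK V W" for V W
    using that R.isoK_linear[OF that] R.isoK_inner[OF that] by (auto simp: R.isoK_def radjoint_def)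
  have cp: "cproj = (C.kproj :: ('b \<Rightarrow> 'b) \<Rightarrow> bool)"
  proof (rule ext, rule iffI)
    fix P :: "'b \<Rightarrow> 'b" assume "cproj P"
    then show "C.kproj P" unfolding cproj_def C.kproj_def clinear_def by (auto simp: fun_eq_iff)
  next
    fix P :: "'b \<Rightarrow> 'b" assume P: "C.kproj P"
    have "bounded_op P" 
      unfolding bounded_op_def by (intro exI[of _ 1] allI) (simp only: mult_1_right C.kproj_norm_le[OF P])
    then show "cproj P" using P unfolding cproj_def C.kproj_def clinear_def by auto
  qed
  have cd: "chas_dim = (C.hasdim :: 'b set \<Rightarrow> nat \<Rightarrow> bool)"
    by (intro ext) (simp add: chas_dim_def C.hasdim_def)
  have cP: "cProj n = (C.KP n :: ('b \<Rightarrow> 'b) set)" for n by (simp add: cProj_def C.KP_def cp cd)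
  have cI: "cProj_inf = (C.KI :: ('b \<Rightarrow> 'b) set)" by (simp add: cProj_inf_def C.KI_def cp cd)
  have cu: "cunitary = (C.kunitary :: ('b \<Rightarrow> 'b) \<Rightarrow> bool)"
    by (intro ext) (auto simp: cunitary_def C.kunitary_def clinear_def)
  have ca: "cangle_eq = (C.kangle_eq :: ('b \<Rightarrow> 'b) \<Rightarrow> _)"
    by (intro ext) (simp add: cangle_eq_def C.kangle_eq_def cu)
  have ci: "((clinear V \<and> cadjoint V W) \<or> (cantilinear V \<and> cantiadjoint V W)) \<and> (\<forall>x. norm (V x) = norm x)"
    if "C.isoK V W" for V W
    using that by (auto simp: C.isoK_def clinear_def cadjoint_def cantilinear_def cantiadjoint_def)
  show ?thesis
    unfolding rP rI ra rd cP cI ca cd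
  proof (intro conjI allI impI; elim conjE)
    fix n and \<phi> :: "('a \<Rightarrow> 'a) \<Rightarrow> ('a \<Rightarrow> 'a)"
    assume "\<forall>P\<in>R.KP n. \<phi> P \<in> R.KP n" "\<forall>P\<in>R.KP n. \<forall>Q\<in>R.KP n. R.kangle_eq (\<phi> P) (\<phi> Q) P Q"
      "n = 1 \<or> \<not> R.hasdim UNIV (2 * n)"
    then obtain V W where "R.isoK V W" "\<forall>P\<in>R.KP n. \<phi> P = V \<circ> P \<circ> W"
      using R.rank_n_preserver[of n \<phi>] by blast
    then show "\<exists>V W. linear V \<and> (\<forall>x. norm (V x) = norm x) \<and> radjoint V W \<and> (\<forall>P\<in>R.KP n. \<phi> P = V \<circ> P \<circ> W)"
      using ri by blast
  next
    fix n and \<phi> :: "('b \<Rightarrow> 'b) \<Rightarrow> ('b \<Rightarrow> 'b)"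
    assume "\<forall>P\<in>C.KP n. \<phi> P \<in> C.KP n" "\<forall>P\<in>C.KP n. \<forall>Q\<in>C.KP n. C.kangle_eq (\<phi> P) (\<phi> Q) P Q"
      "n = 1 \<or> \<not> C.hasdim UNIV (2 * n)"
    then obtain V W where "C.isoK V W" "\<forall>P\<in>C.KP n. \<phi> P = V \<circ> P \<circ> W"
      using C.rank_n_preserver[of n \<phi>] by blast
    then show "\<exists>V W. (clinear V \<and> cadjoint V W \<or> cantilinear V \<and> cantiadjoint V W) \<and>
        (\<forall>x. norm (V x) = norm x) \<and> (\<forall>P\<in>C.KP n. \<phi> P = V \<circ> P \<circ> W)"
      using ci by blast
  next
    fix \<phi> :: "('a \<Rightarrow> 'a) \<Rightarrow> ('a \<Rightarrow> 'a)"
    assume "\<nexists>d. R.hasdim UNIV d" "\<phi> ` R.KI = R.KI" "\<forall>P\<in>R.KI. \<forall>Q\<in>R.KI. R.kangle_eq (\<phi> P) (\<phi> Q) P Q"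
    then obtain V W where VW: "R.isoK V W" "surj V" "\<forall>P\<in>R.KI. \<phi> P = V \<circ> P \<circ> W"
      using R.infinite_rank_preserver[of \<phi>] by blast
    then have "runitary V \<and> radjoint V W" using ri[OF VW(1)] by (simp add: runitary_def)
    then show "\<exists>U W. runitary U \<and> radjoint U W \<and> (\<forall>P\<in>R.KI. \<phi> P = U \<circ> P \<circ> W)" using VW(3) by blast
  next
    fix \<phi> :: "('b \<Rightarrow> 'b) \<Rightarrow> ('b \<Rightarrow> 'b)"
    assume "\<nexists>d. C.hasdim UNIV d" "\<phi> ` C.KI = C.KI" "\<forall>P\<in>C.KI. \<forall>Q\<in>C.KI. C.kangle_eq (\<phi> P) (\<phi> Q) P Q"
    then obtain V W where VW: "C.isoK V W" "surj V" "\<forall>P\<in>C.KI. \<phi> P = V \<circ> P \<circ> W"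
      using C.infinite_rank_preserver[of \<phi>] by blast
    then have "cunitary V \<and> cadjoint V W \<or> cantiunitary V \<and> cantiadjoint V W"
      using ci[OF VW(1)] by (auto simp: cunitary_def cantiunitary_def)
    then show "\<exists>U W. (cunitary U \<and> cadjoint U W \<or> cantiunitary U \<and> cantiadjoint U W) \<and>
        (\<forall>P\<in>C.KI. \<phi> P = U \<circ> P \<circ> W)" using VW(3) by blast
  qed
qed

end
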